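(* Let $k$ be an algebraically closed field of characteristic zero, let $R=k[x_1,\ldots,x_n]$ with $n\ge3$, and let $J\subseteq R$ be a $d$-equigenerated strict almost complete intersection of height $2$ and homological dimension $2$. Then $$\deg(R/J)\le d^2-d.$$ In particular, $\deg(R/J)\ne d^2-d+1$.
   Context: A $d$-equigenerated strict almost complete intersection of height $2$ is an ideal $J$ with $\mathrm{ht}(J)=2$ minimally generated by three homogeneous forms of degree $d$ ($d\ge2$). Homological dimension $2$ means that $J$ has projective dimension $2$ as an $R$-module (equivalently $\mathrm{pd}_R(R/J)=3$). $\deg(R/J)$ is the multiplicity of $R/J$. *)

theory Defs
  imports
    "HOL-Library.Poly_Mapping"
    "HOL-Library.Extended_Nat"
    "HOL-Library.Cardinality"
    "HOL-Computational_Algebra.Polynomial"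
begin

text \<open>
  The polynomial ring over \<open>'k\<close> whose variables are indexed by the finite type \<open>'n\<close>, with the
  convolution product of \<open>HOL-Library.Poly_Mapping\<close>; the number of variables is \<open>CARD('n)\<close>.
\<close>

type_synonym ('n, 'k) mpoly = "('n \<Rightarrow>\<^sub>0 nat) \<Rightarrow>\<^sub>0 'k"

text \<open>
  Coefficientwise scalar multiplication. It is used both for the \<open>'k\<close>-vector space structure of
  \<open>('n, 'k) mpoly\<close> and for the structure of free module with basis \<open>'i\<close> on \<open>'i \<Rightarrow>\<^sub>0 'a\<close>.
\<close>

definition pm_scale :: "'a::comm_ring_1 \<Rightarrow> ('i \<Rightarrow>\<^sub>0 'a) \<Rightarrow> ('i \<Rightarrow>\<^sub>0 'a)" where
  "pm_scale c p = Poly_Mapping.map ((*) c) p"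

lemma lookup_pm_scale: "Poly_Mapping.lookup (pm_scale c p) i = c * Poly_Mapping.lookup p i"
  unfolding pm_scale_def by (simp add: map.rep_eq when_def)

lemma module_pm_scale: "module (pm_scale :: 'a::comm_ring_1 \<Rightarrow> ('i \<Rightarrow>\<^sub>0 'a) \<Rightarrow> _)"
  by unfold_locales
    (auto intro!: poly_mapping_eqI simp: lookup_pm_scale lookup_add algebra_simps)

lemma vector_space_pm_scale: "vector_space (pm_scale :: 'a::field \<Rightarrow> ('i \<Rightarrow>\<^sub>0 'a) \<Rightarrow> _)"
  by unfold_locales
    (auto intro!: poly_mapping_eqI simp: lookup_pm_scale lookup_add algebra_simps)

lemma module_times: "module ((*) :: 'a::comm_ring_1 \<Rightarrow> 'a \<Rightarrow> 'a)"
  by unfold_locales (auto simp: algebra_simps)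


section \<open>Ideals and height\<close>

abbreviation is_ideal :: "'a::comm_ring_1 set \<Rightarrow> bool" where
  "is_ideal \<equiv> module.subspace (*)"

abbreviation ideal_gen :: "'a::comm_ring_1 set \<Rightarrow> 'a set" where
  "ideal_gen \<equiv> module.span (*)"

definition prime_ideal :: "'a::comm_ring_1 set \<Rightarrow> bool" where
  "prime_ideal P \<longleftrightarrow>
     is_ideal P \<and> P \<noteq> UNIV \<and> (\<forall>x y. x * y \<in> P \<longrightarrow> x \<in> P \<or> y \<in> P)"

definition prime_height :: "'a::comm_ring_1 set \<Rightarrow> enat" where
  "prime_height P = Sup {enat m | m. \<exists>Q :: nat \<Rightarrow> 'a set.
     (\<forall>i\<le>m. prime_ideal (Q i)) \<and> (\<forall>i<m. Q i \<subset> Q (Suc i)) \<and> Q m = P}"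

definition ideal_height :: "'a::comm_ring_1 set \<Rightarrow> enat" where
  "ideal_height I = Inf {prime_height P | P. prime_ideal P \<and> I \<subseteq> P}"


section \<open>Projective dimension\<close>

text \<open>
  Countably generated projective modules, realised as direct summands of the free module of
  countable rank.
\<close>

definition projective_summand :: "(nat \<Rightarrow>\<^sub>0 'a::comm_ring_1) set \<Rightarrow> bool" where
  "projective_summand P \<longleftrightarrow> module.subspace pm_scale P \<and>
     (\<exists>Q. module.subspace pm_scale Q \<and> P \<inter> Q = {0} \<and> {p + q | p q. p \<in> P \<and> q \<in> Q} = UNIV)"

text \<open>
  \<open>projective_resolution scale M m P \<epsilon> \<delta>\<close> says that
  \<open>0 \<rightarrow> P m \<rightarrow> \<dots> \<rightarrow> P 1 \<rightarrow> P 0 \<rightarrow> M \<rightarrow> 0\<close> is exact, with augmentation \<open>\<epsilon>\<close> from \<open>P 0\<close> onto \<open>M\<close>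
  and \<open>\<delta> i\<close> from \<open>P (i + 1)\<close> to \<open>P i\<close>. Here \<open>M\<close> is a submodule of the module \<open>'b\<close>.
  The maps are defined on the whole ambient free module; this is no restriction, because a
  homomorphism on a direct summand extends to the ambient module.
\<close>

definition projective_resolution ::
  "('a::comm_ring_1 \<Rightarrow> 'b::ab_group_add \<Rightarrow> 'b) \<Rightarrow> 'b set \<Rightarrow> nat \<Rightarrow>
   (nat \<Rightarrow> (nat \<Rightarrow>\<^sub>0 'a) set) \<Rightarrow> ((nat \<Rightarrow>\<^sub>0 'a) \<Rightarrow> 'b) \<Rightarrow>
   (nat \<Rightarrow> (nat \<Rightarrow>\<^sub>0 'a) \<Rightarrow> (nat \<Rightarrow>\<^sub>0 'a)) \<Rightarrow> bool" where
  "projective_resolution scale M m P \<epsilon> \<delta> \<longleftrightarrow>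
     (\<forall>i. projective_summand (P i)) \<and> (\<forall>i>m. P i = {0}) \<and>
     module_hom pm_scale scale \<epsilon> \<and> (\<forall>i. module_hom pm_scale pm_scale (\<delta> i)) \<and>
     \<epsilon> ` P 0 = M \<and>
     \<delta> 0 ` P 1 = {x \<in> P 0. \<epsilon> x = 0} \<and>
     (\<forall>i. \<delta> (Suc i) ` P (Suc (Suc i)) = {x \<in> P (Suc i). \<delta> i x = 0})"

text \<open>
  The projective dimension of a submodule \<open>M\<close> of \<open>'b\<close>. Since only countably generated projective
  modules occur, this is meant for finitely generated modules over Noetherian rings, which have
  resolutions by finitely generated projectives of every length not smaller than the projective
  dimension.
\<close>

definition proj_dim :: "('a::comm_ring_1 \<Rightarrow> 'b::ab_group_add \<Rightarrow> 'b) \<Rightarrow> 'b set \<Rightarrow> enat" where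
  "proj_dim scale M = Inf {enat m | m. \<exists>P \<epsilon> \<delta>. projective_resolution scale M m P \<epsilon> \<delta>}"


section \<open>Grading, Hilbert polynomial and multiplicity\<close>

definition mon_deg :: "('n::finite \<Rightarrow>\<^sub>0 nat) \<Rightarrow> nat" where
  "mon_deg m = (\<Sum>i\<in>UNIV. Poly_Mapping.lookup m i)"

definition forms :: "nat \<Rightarrow> ('n::finite, 'k::field) mpoly set" where
  "forms t = {f. \<forall>m\<in>Poly_Mapping.keys f. mon_deg m = t}"

text \<open>
  For a homogeneous ideal \<open>I\<close> of \<open>R\<close>: the dimension over \<open>'k\<close> of the degree \<open>t\<close> part
  \<open>R\<^sub>t / (I \<inter> R\<^sub>t)\<close> of \<open>R/I\<close>. Here \<open>R\<^sub>t\<close> is finite-dimensional.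
\<close>

definition hilbert_fun :: "('n::finite, 'k::field) mpoly set \<Rightarrow> nat \<Rightarrow> nat" where
  "hilbert_fun I t =
     vector_space.dim pm_scale (forms t :: ('n, 'k) mpoly set)
     - vector_space.dim pm_scale (I \<inter> forms t)"

definition hilbert_poly :: "('n::finite, 'k::field) mpoly set \<Rightarrow> rat poly" where
  "hilbert_poly I =
     (THE p. \<forall>\<^sub>F t in sequentially. poly p (of_nat t) = of_nat (hilbert_fun I t))"

text \<open>
  The multiplicity \<open>deg(R/I)\<close>: \<open>(D - 1)!\<close> times the leading coefficient of the Hilbert polynomial
  when \<open>D = dim R/I > 0\<close> (the Hilbert polynomial then has degree \<open>D - 1\<close>), and the vector space
  dimension of \<open>R/I\<close> when the Hilbert polynomial vanishes.
\<close>

definition mult_quot :: "('n::finite, 'k::field) mpoly set \<Rightarrow> rat" where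
  "mult_quot I =
     (if hilbert_poly I = 0 then of_nat (\<Sum>t | hilbert_fun I t \<noteq> 0. hilbert_fun I t)
      else fact (degree (hilbert_poly I)) * lead_coeff (hilbert_poly I))"


section \<open>Strict almost complete intersections of height two\<close>

definition minimally_generates :: "'a::comm_ring_1 set \<Rightarrow> 'a set \<Rightarrow> bool" where
  "minimally_generates G I \<longleftrightarrow> ideal_gen G = I \<and> (\<forall>H. H \<subset> G \<longrightarrow> ideal_gen H \<noteq> I)"

definition equigenerated_strict_aci2 :: "nat \<Rightarrow> ('n::finite, 'k::field) mpoly set \<Rightarrow> bool" where
  "equigenerated_strict_aci2 d J \<longleftrightarrow>
     ideal_height J = 2 \<and> (\<exists>G \<subseteq> forms d. card G = 3 \<and> minimally_generates G J)"

end

theory Submission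
  imports Defs "HOL-Library.Product_Plus" "HOL-Library.FuncSet"
begin

text \<open>
  Let \<open>J = (f1, f2, f3)\<close> and let \<open>s\<close> be a nonzero syzygy of least degree \<open>r\<close>, so \<open>1 \<le> r \<le> d\<close>. By unique
  factorization the cross product of \<open>s\<close> with a syzygy \<open>t\<close> is \<open>c(t) (f1, f2, f3)\<close>, and \<open>c\<close> identifies the
  syzygies modulo \<open>R s\<close> with an ideal \<open>C\<close>. Counting dimensions,
  \<open>deg(R/J) = d\<^sup>2 - r (d - r) - e\<close>, where \<open>e\<close> is the multiplicity of \<open>R/C\<close> in codimension two.
  If \<open>e = 0\<close>, then \<open>C\<close> contains a regular sequence of length three; this forces \<open>C = R\<close>, so the syzygies
  are free and \<open>J\<close> has projective dimension at most one. Hence \<open>e \<ge> 1\<close>, which suffices for \<open>r < d\<close>. For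
  \<open>r = d\<close> one takes the Koszul syzygy, for which \<open>C = (f2, f3) : f1\<close> has no elements of degree below
  \<open>d\<close>; after a linear change of coordinates, unmixedness of \<open>C\<close> and Gauss' lemma give \<open>e \<ge> d\<close>.
  Height two enters twice: the \<open>f\<^sub>i\<close> have no common factor, and \<open>J\<close> meets the polynomial ring in some
  \<open>n - 2\<close> of the variables trivially, which fixes the degree of the Hilbert polynomial.
\<close>

section \<open>Polynomials in some of the variables\<close>

text \<open>For \<open>0 < r < d\<close> the product \<open>r (d - r)\<close> is at least
  \<open>d - 1\<close>, so one unit from \<open>e\<close> closes the gap to
  \<open>d\<^sup>2 - d\<close>; at \<open>r = d\<close> it vanishes and all of \<open>d\<close> must
  come from \<open>e\<close>. Hence the different treatment of the two ranges of \<open>r\<close>.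
  Only inequalities between Hilbert functions are proved, and both estimates of \<open>e\<close>
  rest on one count: a graded piece of \<open>C\<close> too large to avoid the span of a set of
  monomials contains a nonzero form supported on them. If \<open>e\<close> were 0, the count with
  the monomials in \<open>n - 2\<close> variables would apply in every linear coordinate system.
  Changing coordinates between three applications puts three elements of \<open>C\<close> in
  triangular position: one monic in \<open>z\<close>, one monic in \<open>y\<close> and free of
  \<open>z\<close>, one free of both. Division with remainder makes them a regular sequence, so no
  theory of depth enters.\<close>

definition additive_ext :: "('i \<Rightarrow> 'a::zero \<Rightarrow> 'b::comm_monoid_add) \<Rightarrow> ('i \<Rightarrow>\<^sub>0 'a) \<Rightarrow> 'b" where
  "additive_ext \<phi> f = (\<Sum>m\<in>Poly_Mapping.keys f. \<phi> m (Poly_Mapping.lookup f m))"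

lemma additive_ext_zero [simp]: "additive_ext \<phi> 0 = 0"
  by (simp add: additive_ext_def)

lemma additive_ext_single: "(\<And>m. \<phi> m 0 = 0) \<Longrightarrow> additive_ext \<phi> (Poly_Mapping.single m c) = \<phi> m c"
  by (cases "c = 0") (auto simp: additive_ext_def)

lemma additive_ext_add:
  assumes "\<And>m. \<phi> m 0 = 0" "\<And>m a b. \<phi> m (a + b) = \<phi> m a + \<phi> m b"
  shows "additive_ext \<phi> (f + g) = additive_ext \<phi> f + additive_ext \<phi> g"
  unfolding additive_ext_def using setsum_keys_plus_distrib[of \<phi> f g] assms by simp

lemma pm_sum_single:
  fixes f :: "'i \<Rightarrow>\<^sub>0 'a::comm_monoid_add"
  shows "f = (\<Sum>m\<in>Poly_Mapping.keys f. Poly_Mapping.single m (Poly_Mapping.lookup f m))"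
proof (rule poly_mapping_eqI)
  fix k
  have "(\<Sum>m\<in>Poly_Mapping.keys f. Poly_Mapping.lookup (Poly_Mapping.single m (Poly_Mapping.lookup f m)) k)
    = (\<Sum>m\<in>Poly_Mapping.keys f. if m = k then Poly_Mapping.lookup f k else 0)"
    by (rule sum.cong) (auto simp: lookup_single when_def)
  also have "\<dots> = Poly_Mapping.lookup f k"
    by (auto simp: sum.delta in_keys_iff)
  finally show "Poly_Mapping.lookup f k = Poly_Mapping.lookup (\<Sum>m\<in>Poly_Mapping.keys f. Poly_Mapping.single m (Poly_Mapping.lookup f m)) k"
    by (simp add: lookup_sum)
qed

text \<open>The last premise speaks of the terms of \<open>f\<close> itself, so a hypothesis on the
  support of \<open>f\<close>, such as lying in \<open>forms t\<close> or \<open>polys V\<close>, is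
  available for each term.\<close>

lemma pm_sum_induct:
  fixes f :: "'i \<Rightarrow>\<^sub>0 'a::comm_monoid_add"
  assumes "P 0" "\<And>f g. P f \<Longrightarrow> P g \<Longrightarrow> P (f + g)"
    and "\<And>m. m \<in> Poly_Mapping.keys f \<Longrightarrow> P (Poly_Mapping.single m (Poly_Mapping.lookup f m))"
  shows "P f"
proof -
  have "P (\<Sum>m\<in>A. Poly_Mapping.single m (Poly_Mapping.lookup f m))" if "A \<subseteq> Poly_Mapping.keys f" for A
  proof -
    have "finite A" using that finite_subset by (metis finite_keys)
    then show ?thesis using that
      by (induction A) (auto intro: assms)
  qed
  then show ?thesis using pm_sum_single[of f] by (metis order_refl)
qed

lemma pm_induct [case_names single add]:
  fixes f :: "'i \<Rightarrow>\<^sub>0 'a::comm_monoid_add"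
  assumes "\<And>m c. P (Poly_Mapping.single m c)" "\<And>f g. P f \<Longrightarrow> P g \<Longrightarrow> P (f + g)"
  shows "P f"
  by (rule pm_sum_induct) (use assms assms(1)[of undefined 0] in auto)

text \<open>Both sides are additive in each factor, so products of terms decide. The homomorphisms
  \<open>upoly\<close>, \<open>hgen\<close> and \<open>eval_hom\<close> are all of this kind, and
  their multiplicativity reduces to this check.\<close>

lemma additive_ext_mult:
  fixes \<phi> :: "'i::comm_monoid_add \<Rightarrow> 'a::comm_semiring_1 \<Rightarrow> 'b::comm_semiring_1"
  assumes "\<And>m. \<phi> m 0 = 0" "\<And>m a b. \<phi> m (a + b) = \<phi> m a + \<phi> m b"
    and m: "\<And>m m' a b. \<phi> (m + m') (a * b) = \<phi> m a * \<phi> m' b"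
  shows "additive_ext \<phi> (f * g) = additive_ext \<phi> f * additive_ext \<phi> g"
proof (induction f rule: pm_induct)
  case (single m c)
  show ?case
  proof (induction g rule: pm_induct)
    case (single m' c')
    show ?case by (simp add: mult_single additive_ext_single assms(1) m)
  next
    case (add g h)
    then show ?case by (simp add: distrib_left additive_ext_add assms(1,2))
  qed
next
  case (add f g)
  then show ?case by (simp add: distrib_right additive_ext_add assms(1,2))
qed

abbreviation lkp where "lkp \<equiv> Poly_Mapping.lookup"
abbreviation sng where "sng \<equiv> Poly_Mapping.single"
abbreviation kys where "kys \<equiv> Poly_Mapping.keys"

definition cst :: "'k::field \<Rightarrow> ('n, 'k) mpoly" where "cst c = sng 0 c"
definition var :: "'n \<Rightarrow> ('n, 'k::field) mpoly" where "var i = sng (sng i 1) 1"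

lemma cst_simps [simp]: "cst 0 = 0" "cst 1 = 1"
  "cst (a + b) = cst a + cst b" "cst (a * b) = cst a * cst b" "cst (- a) = - cst a" "cst (a - b) = cst a - cst b"
  by (auto simp: cst_def single_add mult_single single_uminus single_diff)

lemma cst_eq_0_iff [simp]: "cst a = 0 \<longleftrightarrow> a = 0"
  by (metis cst_def lookup_single_eq lookup_zero single_zero)

lemma lookup_cst_mult: "lkp (cst c * f) m = c * lkp f m"
  by (simp add: cst_def mult_map_scale_conv_mult[symmetric] map.rep_eq when_def)

lemma pm_scale_cst: "pm_scale c f = cst c * f"
  by (rule poly_mapping_eqI) (simp add: lookup_pm_scale lookup_cst_mult)

text \<open>Polynomial rings in fewer variables are subsets of one type, so that inductions on the
  number of variables can run over finite sets \<open>V\<close>.\<close>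

definition polys :: "'n set \<Rightarrow> ('n, 'k::field) mpoly set" where
  "polys V = {f. \<forall>m\<in>kys f. kys m \<subseteq> V}"

lemma polys_UNIV [simp]: "polys UNIV = UNIV" by (auto simp: polys_def)
lemma polys_mono: "V \<subseteq> W \<Longrightarrow> polys V \<subseteq> polys W" by (auto simp: polys_def)
lemma polys_0 [simp]: "0 \<in> polys V" by (auto simp: polys_def)
lemma polys_single: "sng m c \<in> polys V \<longleftrightarrow> c = 0 \<or> kys m \<subseteq> V" by (auto simp: polys_def)
lemma polys_cst [simp]: "cst c \<in> polys V" by (auto simp: cst_def polys_single)
lemma polys_1 [simp]: "1 \<in> polys V" using polys_cst[of 1] by simp
lemma polys_var [simp]: "var i \<in> polys V \<longleftrightarrow> i \<in> V" by (auto simp: var_def polys_single)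
lemma polys_add [intro]: "f \<in> polys V \<Longrightarrow> g \<in> polys V \<Longrightarrow> f + g \<in> polys V"
  unfolding polys_def using keys_add[of f g] by blast
lemma polys_mult [intro]: "f \<in> polys V \<Longrightarrow> g \<in> polys V \<Longrightarrow> f * g \<in> polys V"
proof -
  assume a: "f \<in> polys V" "g \<in> polys V"
  have "kys m \<subseteq> V" if m: "m \<in> kys (f * g)" for m
  proof -
    obtain a b where ab: "m = a + b" "a \<in> kys f" "b \<in> kys g" using subsetD[OF keys_mult[of f g] m] by blast
    then show ?thesis using a keys_add[of a b] unfolding polys_def by blast
  qed
  then show ?thesis by (auto simp: polys_def)
qed
lemma polys_uminus [intro]: "f \<in> polys V \<Longrightarrow> - f \<in> polys V"
  by (auto simp: polys_def in_keys_iff)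
lemma polys_diff [intro]: "f \<in> polys V \<Longrightarrow> g \<in> polys V \<Longrightarrow> f - g \<in> polys V"
  using polys_add[of f V "- g"] polys_uminus by fastforce
lemma polys_power [intro]: "f \<in> polys V \<Longrightarrow> f ^ j \<in> polys V"
  by (induction j) auto
lemma polys_empty: "f \<in> polys {} \<longleftrightarrow> (\<exists>c. f = cst c)"
proof
  assume f: "f \<in> polys {}"
  have "f = cst (lkp f 0)"
  proof (rule poly_mapping_eqI)
    fix m show "lkp f m = lkp (cst (lkp f 0)) m"
      using f by (cases "m = 0") (auto simp: polys_def cst_def lookup_single in_keys_iff)
  qed
  then show "\<exists>c. f = cst c" by blast
qed auto

text \<open>\<open>upoly x f\<close> is \<open>f\<close> regarded as a univariate polynomial in the variable \<open>x\<close>.\<close>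

definition upoly :: "'n \<Rightarrow> ('n, 'k::field) mpoly \<Rightarrow> ('n, 'k) mpoly poly" where
  "upoly x = additive_ext (\<lambda>m c. monom (sng (m - sng x (lkp m x)) c) (lkp m x))"

lemma upoly_single: "upoly x (sng m c) = monom (sng (m - sng x (lkp m x)) c) (lkp m x)"
  by (simp add: upoly_def additive_ext_single)

lemma upoly_0 [simp]: "upoly x 0 = 0" by (simp add: upoly_def)
lemma upoly_add: "upoly x (f + g) = upoly x f + upoly x g"
  unfolding upoly_def by (rule additive_ext_add) (auto simp: single_add add_monom)
lemma upoly_mult: "upoly x (f * g) = upoly x f * upoly x g"
proof -
  have "m + m' - sng x (lkp (m + m') x) = (m - sng x (lkp m x)) + (m' - sng x (lkp m' x))" for m m' :: "'a \<Rightarrow>\<^sub>0 nat"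
    by (rule poly_mapping_eqI) (auto simp: lookup_add lookup_minus lookup_single when_def)
  then show ?thesis
    unfolding upoly_def by (intro additive_ext_mult) (auto simp: single_add add_monom mult_monom mult_single lookup_add)
qed
lemma upoly_uminus: "upoly x (- f) = - upoly x f"
  using upoly_add[of x f "- f"] by (simp add: minus_unique)
lemma upoly_diff: "upoly x (f - g) = upoly x f - upoly x g"
  using upoly_add[of x f "- g"] by (simp add: upoly_uminus)

definition coef :: "'n \<Rightarrow> nat \<Rightarrow> ('n, 'k::field) mpoly \<Rightarrow> ('n, 'k) mpoly" where
  "coef x j f = coeff (upoly x f) j"
definition deg_in :: "'n \<Rightarrow> ('n, 'k::field) mpoly \<Rightarrow> nat" where
  "deg_in x f = degree (upoly x f)"

lemma lookup_coef: "lkp (coef x j f) m = (if lkp m x = 0 then lkp f (m + sng x j) else 0)"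
proof (induction f rule: pm_induct)
  case (single m' c)
  have *: "m' - sng x (lkp m' x) = m \<and> lkp m' x = j \<longleftrightarrow> lkp m x = 0 \<and> m' = m + sng x j"
    by (auto simp: poly_mapping_eq_iff fun_eq_iff lookup_add lookup_minus lookup_single when_def)
  have "lkp (coef x j (sng m' c)) m = (if m' - sng x (lkp m' x) = m \<and> lkp m' x = j then c else 0)"
    by (simp add: coef_def upoly_single lookup_single when_def)
  then show ?case unfolding * by (auto simp: lookup_single when_def)
next
  case (add f g)
  then show ?case by (auto simp: coef_def upoly_add lookup_add)
qed

lemma coef_0 [simp]: "coef x j 0 = 0" by (simp add: coef_def)
lemma coef_add: "coef x j (f + g) = coef x j f + coef x j g" by (simp add: coef_def upoly_add)
lemma coef_mult: "coef x j (f * g) = (\<Sum>i\<le>j. coef x i f * coef x (j - i) g)"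
  by (simp add: coef_def upoly_mult coeff_mult)

lemma coef_polys: assumes "f \<in> polys V" shows "coef x j f \<in> polys (V - {x})"
proof -
  have "kys m \<subseteq> V - {x}" if "lkp (coef x j f) m \<noteq> 0" for m
  proof -
    have m: "lkp m x = 0" "lkp f (m + sng x j) \<noteq> 0" using that by (auto simp: lookup_coef split: if_splits)
    then have k: "kys (m + sng x j) \<subseteq> V" using assms by (auto simp: polys_def in_keys_iff)
    have "kys m \<subseteq> kys (m + sng x j)" by (auto simp: in_keys_iff lookup_add)
    with k m show ?thesis by (auto simp: in_keys_iff)
  qed
  then show ?thesis by (auto simp: polys_def in_keys_iff)
qed

lemma upoly_polys: assumes "f \<in> polys V" "x \<notin> V" shows "upoly x f = [:f:]"
proof -
  have "coef x j f = (if j = 0 then f else 0)" for j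
  proof (rule poly_mapping_eqI)
    fix m
    have 1: "lkp m x = 0" if "lkp f m \<noteq> 0" for m
      using assms that unfolding polys_def by (metis (mono_tags, lifting) in_keys_iff mem_Collect_eq subsetD)
    show "lkp (coef x j f) m = lkp (if j = 0 then f else 0) m"
      using 1[of m] 1[of "m + sng x j"] by (cases "lkp f m = 0"; cases "lkp f (m + sng x j) = 0"; cases j) (auto simp: lookup_coef lookup_add)
  qed
  then show ?thesis
    by (intro poly_eqI) (auto simp: coef_def coeff_pCons split: nat.splits)
qed

lemma upoly_cst [simp]: "upoly x (cst c) = [:cst c:]"
  by (rule upoly_polys[of _ "{}"]) auto
lemma upoly_1 [simp]: "upoly x 1 = 1"
  using upoly_cst[of x 1] by (simp add: one_pCons)
lemma upoly_var: "upoly x (var x) = monom 1 1"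
proof -
  have "sng x (Suc 0) - sng x (lkp (sng x (Suc 0)) x) = 0" by simp
  then show ?thesis by (simp add: var_def upoly_single)
qed

lemma var_power: "var x ^ j = sng (sng x j) 1"
  by (induction j) (auto simp: var_def mult_single single_add[symmetric])

lemma coef_expand: "f = (\<Sum>j\<le>deg_in x f. coef x j f * var x ^ j)"
proof -
  have *: "poly (upoly x f) (var x) = f"
  proof (induction f rule: pm_induct)
    case (single m c)
    have "m - sng x (lkp m x) + sng x (lkp m x) = m"
      by (rule poly_mapping_eqI) (auto simp: lookup_add lookup_minus lookup_single when_def)
    then show ?case by (simp add: upoly_single poly_monom var_power mult_single)
  next
    case (add f g)
    then show ?case by (simp add: upoly_add)
  qed
  show ?thesis by (subst *[symmetric]) (simp add: poly_altdef coef_def deg_in_def)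
qed

lemma upoly_eq_0_iff [simp]: "upoly x f = 0 \<longleftrightarrow> f = 0"
  using coef_expand[of f x] by (auto simp: coef_def)

lemma deg_in_0 [simp]: "deg_in x 0 = 0" by (simp add: deg_in_def)
lemma deg_in_cst [simp]: "deg_in x (cst c) = 0" by (simp add: deg_in_def)
lemma lc_nonzero: "f \<noteq> 0 \<Longrightarrow> coef x (deg_in x f) f \<noteq> 0"
  by (simp add: coef_def deg_in_def)
lemma coef_beyond: "j > deg_in x f \<Longrightarrow> coef x j f = 0"
  by (simp add: coef_def deg_in_def coeff_eq_0)
lemma deg_in_le: "(\<And>j. j > d \<Longrightarrow> coef x j f = 0) \<Longrightarrow> deg_in x f \<le> d"
  unfolding coef_def deg_in_def by (rule degree_le) auto
lemma deg_in_diff_le: "deg_in x f \<le> d \<Longrightarrow> deg_in x g \<le> d \<Longrightarrow> deg_in x (f - g) \<le> d"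
  by (simp add: deg_in_def upoly_diff degree_diff_le)

lemma deg_in_polys: "f \<in> polys V \<Longrightarrow> x \<notin> V \<Longrightarrow> deg_in x f = 0"
  by (simp add: deg_in_def upoly_polys)
lemma deg_in_0_polys: assumes "f \<in> polys (insert x V)" "deg_in x f = 0" shows "f \<in> polys V"
proof -
  have "f = coef x 0 f" using coef_expand[of f x] assms(2) by simp
  moreover have "coef x 0 f \<in> polys (insert x V - {x})" by (rule coef_polys[OF assms(1)])
  ultimately show ?thesis using polys_mono[of "insert x V - {x}" V] by auto
qed
lemma deg_in_0_compl: assumes "deg_in x f = 0" shows "f \<in> polys (- {x})"
proof (rule deg_in_0_polys[OF _ assms])
  have "insert x (- {x}) = UNIV" by auto
  then show "f \<in> polys (insert x (- {x}))" by simp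
qed

lemma mult_lc: "coef x (deg_in x f + deg_in x g) (f * g) = coef x (deg_in x f) f * coef x (deg_in x g) g"
  by (simp add: coef_def deg_in_def upoly_mult coeff_mult_degree_sum)

text \<open>The top coefficient in \<open>x\<close> of a product is the product of the top
  coefficients, which lie in the ring with one variable less.\<close>

lemma mpoly_mult_nonzero_aux:
  fixes f g :: "('n, 'k::field) mpoly"
  assumes "finite V" "f \<in> polys V" "g \<in> polys V" "f \<noteq> 0" "g \<noteq> 0"
  shows "f * g \<noteq> 0"
  using assms
proof (induction V arbitrary: f g)
  case empty
  then obtain a b where "f = cst a" "g = cst b" by (auto simp: polys_empty)
  with empty show ?case by (simp flip: cst_simps(4))
next
  case (insert x V)
  have k: "coef x j h \<in> polys V" if "h \<in> polys (insert x V)" for j h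
    using coef_polys[OF that, of x j] insert(2) by simp
  have "coef x (deg_in x f + deg_in x g) (f * g) \<noteq> 0"
    unfolding mult_lc using insert.prems by (intro insert.IH k lc_nonzero) auto
  then show ?case by auto
qed

lemma mpoly_mult_eq_0_iff [simp]:
  fixes f g :: "('n::finite, 'k::field) mpoly"
  shows "f * g = 0 \<longleftrightarrow> f = 0 \<or> g = 0"
  using mpoly_mult_nonzero_aux[of UNIV f g] by auto

lemma mpoly_mult_left_cancel [simp]:
  fixes f g :: "('n::finite, 'k::field) mpoly"
  shows "f * g = f * h \<longleftrightarrow> f = 0 \<or> g = h"
  using mpoly_mult_eq_0_iff[of f "g - h"] by (simp add: right_diff_distrib del: mpoly_mult_eq_0_iff)

lemma mpoly_power_eq_0_iff [simp]:
  fixes f :: "('n::finite, 'k::field) mpoly"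
  shows "f ^ j = 0 \<longleftrightarrow> f = 0 \<and> j > 0"
  by (induction j) auto

lemma deg_in_mult:
  fixes f g :: "('n::finite, 'k::field) mpoly"
  assumes "f \<noteq> 0" "g \<noteq> 0"
  shows "deg_in x (f * g) = deg_in x f + deg_in x g"
proof (rule antisym)
  show "deg_in x (f * g) \<le> deg_in x f + deg_in x g" by (simp add: deg_in_def upoly_mult degree_mult_le)
  have "coef x (deg_in x f + deg_in x g) (f * g) \<noteq> 0"
    unfolding mult_lc using assms by (simp add: lc_nonzero)
  then show "deg_in x f + deg_in x g \<le> deg_in x (f * g)" using coef_beyond by (metis not_le)
qed

lemma polys_iff_deg_in: "f \<in> polys V \<longleftrightarrow> (\<forall>x. x \<notin> V \<longrightarrow> deg_in x f = 0)"
proof (intro iffI allI impI)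
  fix x assume "f \<in> polys V" "x \<notin> V"
  then show "deg_in x f = 0" by (rule deg_in_polys)
next
  assume r: "\<forall>x. x \<notin> V \<longrightarrow> deg_in x f = 0"
  have "x \<in> V" if m: "m \<in> kys f" "x \<in> kys m" for m x
  proof (rule ccontr)
    assume "x \<notin> V"
    with r have "deg_in x f = 0" by simp
    from deg_in_0_compl[OF this] m show False by (auto simp: polys_def)
  qed
  then show "f \<in> polys V" by (auto simp: polys_def)
qed

text \<open>Degrees in each variable add up, so a variable of a factor cannot disappear in the
  product. Hence \<open>dvd\<close> in the whole ring can stand for divisibility inside
  \<open>polys V\<close>.\<close>

lemma polys_mult_iff:
  fixes f g :: "('n::finite, 'k::field) mpoly"
  assumes "f \<noteq> 0" "g \<noteq> 0"
  shows "f * g \<in> polys V \<longleftrightarrow> f \<in> polys V \<and> g \<in> polys V"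
  unfolding polys_iff_deg_in deg_in_mult[OF assms] by auto

lemma polys_dvd:
  fixes f g :: "('n::finite, 'k::field) mpoly"
  assumes "f dvd g" "g \<noteq> 0" "g \<in> polys V"
  shows "f \<in> polys V"
proof -
  obtain h where h: "g = f * h" using assms(1) by (elim dvdE)
  then have "f \<noteq> 0" "h \<noteq> 0" using assms(2) by auto
  from polys_mult_iff[OF this] show ?thesis using assms(3) unfolding h by blast
qed

text \<open>Each round multiplies by the leading coefficient of \<open>g\<close> in \<open>x\<close>
  and cancels the top term. Everything stays in \<open>polys V\<close>, as the induction behind
  unique factorization requires.\<close>

lemma pseudo_division:
  fixes f g :: "('n::finite, 'k::field) mpoly"
  assumes "g \<noteq> 0" "f \<in> polys V" "g \<in> polys V" "x \<in> V"
  shows "\<exists>N q r. coef x (deg_in x g) g ^ N * f = q * g + r \<and> (r = 0 \<or> deg_in x r < deg_in x g)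
     \<and> q \<in> polys V \<and> r \<in> polys V"
  using assms(2)
proof (induction "deg_in x f" arbitrary: f rule: less_induct)
  case less
  define a where "a = coef x (deg_in x g) g"
  have aV: "a \<in> polys V" unfolding a_def by (rule subsetD[OF polys_mono coef_polys[OF assms(3)]]) auto
  show ?case
  proof (cases "f = 0 \<or> deg_in x f < deg_in x g")
    case True
    then have "coef x (deg_in x g) g ^ 0 * f = 0 * g + f \<and> (f = 0 \<or> deg_in x f < deg_in x g) \<and> 0 \<in> polys V \<and> f \<in> polys V"
      using less(2) by simp
    then show ?thesis by blast
  next
    case False
    define b where "b = coef x (deg_in x f) f"
    have bV: "b \<in> polys V" unfolding b_def by (rule subsetD[OF polys_mono coef_polys[OF less(2)]]) auto
    define k where "k = deg_in x f - deg_in x g"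
    define f' where "f' = a * f - b * var x ^ k * g"
    have df: "deg_in x f = k + deg_in x g" using False by (simp add: k_def)
    have f'V: "f' \<in> polys V" unfolding f'_def using aV bV less(2) assms(3,4)
      by (intro polys_diff polys_mult polys_power) auto
    have av: "upoly x a = [:a:]" "upoly x b = [:b:]"
      unfolding a_def b_def by (rule upoly_polys[OF coef_polys[of _ UNIV]]; simp)+
    have v: "upoly x (var x ^ k) = monom 1 k"
      by (induction k) (auto simp: upoly_mult upoly_var mult_monom)
    have if': "upoly x f' = smult a (upoly x f) - smult b (monom 1 k * upoly x g)"
      by (simp add: f'_def upoly_diff upoly_mult av v mult.assoc)
    have c: "coef x j f' = a * coef x j f - b * (if j < k then 0 else coef x (j - k) g)" for j
      unfolding coef_def if' by (simp add: coeff_monom_mult)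
    have z: "coef x j f' = 0" if "j \<ge> deg_in x f" for j
    proof (cases "j = deg_in x f")
      case True
      have "coef x (deg_in x f - k) g = a" by (simp add: df a_def)
      then show ?thesis unfolding c True b_def[symmetric] by (simp add: df mult.commute)
    next
      case False
      then show ?thesis unfolding c using that df by (simp add: coef_beyond)
    qed
    show ?thesis
    proof (cases "f' = 0")
      case True
      then have "a ^ 1 * f = (b * var x ^ k) * g + 0" by (simp add: f'_def)
      moreover have "b * var x ^ k \<in> polys V" using bV assms(4) by (intro polys_mult polys_power) auto
      ultimately show ?thesis
        unfolding a_def[symmetric] by (intro exI[of _ 1] exI[of _ "b * var x ^ k"] exI[of _ 0]) auto
    next
      case False
      have lt: "deg_in x f' < deg_in x f"
      proof (rule ccontr)
        assume "\<not> deg_in x f' < deg_in x f"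
        then show False using z[of "deg_in x f'"] lc_nonzero[OF False] by simp
      qed
      obtain N q r where
        h: "a ^ N * f' = q * g + r" "r = 0 \<or> deg_in x r < deg_in x g" "q \<in> polys V" "r \<in> polys V"
        using less(1)[OF lt f'V] unfolding a_def[symmetric] by (elim exE conjE)
      have "a ^ Suc N * f = (q + a ^ N * (b * var x ^ k)) * g + r"
        using h(1) by (simp add: f'_def algebra_simps)
      moreover have "q + a ^ N * (b * var x ^ k) \<in> polys V"
        using h(3) aV bV assms(4) by (intro polys_add polys_mult polys_power) auto
      ultimately show ?thesis using h(2,4) unfolding a_def[symmetric]
        by (intro exI[of _ "Suc N"] exI[of _ "q + a ^ N * (b * var x ^ k)"] exI[of _ r]) auto
    qed
  qed
qed

section \<open>Substitution and evaluation\<close>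

lemma mpoly_induct [case_names cst var add mult]:
  fixes f :: "('n, 'k::field) mpoly"
  assumes c: "\<And>c. P (cst c)" and v: "\<And>i. P (var i)"
    and a: "\<And>f g. P f \<Longrightarrow> P g \<Longrightarrow> P (f + g)" and m: "\<And>f g. P f \<Longrightarrow> P g \<Longrightarrow> P (f * g)"
  shows "P f"
proof (induction f rule: pm_induct)
  case (single m c)
  have "P (sng m c)" for c
  proof (induction m arbitrary: c rule: pm_induct)
    case (single i k)
    have "P (var i ^ k)" by (induction k) (use c[of 1] v m in auto)
    then have "P (cst c * var i ^ k)" using assms by blast
    then show ?case by (simp add: var_power cst_def mult_single)
  next
    case (add m m')
    have "P (sng m c * sng m' 1)" using add m by blast
    then show ?case by (simp add: mult_single)
  qed
  then show ?case .
next
  case (add f g)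
  then show ?case using a by blast
qed

definition eval_hom :: "('k::field \<Rightarrow> 'r::comm_ring_1) \<Rightarrow> ('n::finite \<Rightarrow> 'r) \<Rightarrow> ('n, 'k) mpoly \<Rightarrow> 'r" where
  "eval_hom c h = additive_ext (\<lambda>m a. c a * (\<Prod>i\<in>UNIV. h i ^ lkp m i))"

definition subst_vars :: "('n::finite \<Rightarrow> ('n, 'k::field) mpoly) \<Rightarrow> ('n, 'k) mpoly \<Rightarrow> ('n, 'k) mpoly" where
  "subst_vars = eval_hom cst"
definition evalp :: "('n::finite \<Rightarrow> 'k::field) \<Rightarrow> ('n, 'k) mpoly \<Rightarrow> 'k" where
  "evalp = eval_hom id"

lemma eval_hom_hom:
  assumes "c 0 = 0" "c 1 = 1" "\<And>a b. c (a + b) = c a + c b" "\<And>a b. c (a * b) = c a * c b"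
  shows "eval_hom c h (f + g) = eval_hom c h f + eval_hom c h g"
    "eval_hom c h (f * g) = eval_hom c h f * eval_hom c h g"
    "eval_hom c h (cst a) = c a" "eval_hom c h (var i) = h i"
proof -
  show "eval_hom c h (f + g) = eval_hom c h f + eval_hom c h g"
    unfolding eval_hom_def by (rule additive_ext_add) (auto simp: assms algebra_simps)
  show "eval_hom c h (f * g) = eval_hom c h f * eval_hom c h g"
    unfolding eval_hom_def
    by (rule additive_ext_mult) (auto simp: assms algebra_simps lookup_add power_add prod.distrib)
  show "eval_hom c h (cst a) = c a"
    unfolding eval_hom_def cst_def by (subst additive_ext_single) (auto simp: assms)
  have "(\<Prod>j\<in>UNIV. h j ^ lkp (sng i 1) j) = (\<Prod>j\<in>UNIV. if j = i then h i else 1)"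
    by (rule prod.cong) (auto simp: lookup_single when_def)
  then show "eval_hom c h (var i) = h i"
    unfolding eval_hom_def var_def by (subst additive_ext_single) (auto simp: assms)
qed

lemma subst_vars_add: "subst_vars h (f + g) = subst_vars h f + subst_vars h g"
  and subst_vars_mult: "subst_vars h (f * g) = subst_vars h f * subst_vars h g"
  and subst_vars_cst [simp]: "subst_vars h (cst a) = cst a"
  and subst_vars_var [simp]: "subst_vars h (var i) = h i"
  unfolding subst_vars_def by (rule eval_hom_hom; simp)+

lemma evalp_add: "evalp P (f + g) = evalp P f + evalp P g"
  and evalp_mult: "evalp P (f * g) = evalp P f * evalp P g"
  and evalp_cst [simp]: "evalp P (cst a) = a"
  and evalp_var [simp]: "evalp P (var i) = P i"
  unfolding evalp_def by ((subst eval_hom_hom; simp)+)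

lemma evalp_0 [simp]: "evalp P 0 = 0" using evalp_cst[of P 0] by simp
lemma evalp_1 [simp]: "evalp P 1 = 1" using evalp_cst[of P 1] by simp
lemma evalp_power: "evalp P (f ^ k) = evalp P f ^ k" by (induction k) (auto simp: evalp_mult)
lemma evalp_sum: "evalp P (sum f A) = (\<Sum>i\<in>A. evalp P (f i))"
  by (induction A rule: infinite_finite_induct) (auto simp: evalp_add)
lemma subst_vars_0 [simp]: "subst_vars P 0 = 0" using subst_vars_cst[of P 0] by simp
lemma evalp_subst_vars: "evalp P (subst_vars h f) = evalp (\<lambda>i. evalp P (h i)) f"
  by (induction f rule: mpoly_induct) (auto simp: subst_vars_add subst_vars_mult evalp_add evalp_mult)

lemma subst_vars_subst_vars: "subst_vars h (subst_vars h' f) = subst_vars (\<lambda>i. subst_vars h (h' i)) f"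
  by (induction f rule: mpoly_induct) (auto simp: subst_vars_add subst_vars_mult)

lemma subst_vars_id: "subst_vars var f = f"
  by (induction f rule: mpoly_induct) (auto simp: subst_vars_add subst_vars_mult)

lemma evalp_single: "evalp P (sng m c) = c * (\<Prod>i\<in>UNIV. P i ^ lkp m i)"
  unfolding evalp_def eval_hom_def by (subst additive_ext_single) auto

lemma subst_vars_single: "subst_vars h (sng m c) = cst c * (\<Prod>i\<in>UNIV. h i ^ lkp m i)"
  unfolding subst_vars_def eval_hom_def by (subst additive_ext_single) auto

lemma evalp_cong_polys: assumes "f \<in> polys V" "\<And>i. i \<in> V \<Longrightarrow> P i = Q i" shows "evalp P f = evalp Q f"
proof (rule pm_sum_induct[of "\<lambda>f. evalp P f = evalp Q f"])
  fix m assume m: "m \<in> kys f"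
  have "(\<Prod>i\<in>UNIV. P i ^ lkp m i) = (\<Prod>i\<in>UNIV. Q i ^ lkp m i)"
  proof (rule prod.cong[OF refl])
    fix i
    have "kys m \<subseteq> V" using assms(1) m by (simp add: polys_def)
    then show "P i ^ lkp m i = Q i ^ lkp m i"
      using assms(2)[of i] subsetD[of "kys m" V i] by (cases "lkp m i = 0") (auto simp: in_keys_iff)
  qed
  then show "evalp P (sng m (lkp f m)) = evalp Q (sng m (lkp f m))" by (simp add: evalp_single)
qed (auto simp: evalp_add)

lemma subst_vars_polys:
  assumes "f \<in> polys V" "\<And>i. i \<in> V \<Longrightarrow> h i \<in> polys W" shows "subst_vars h f \<in> polys W"
proof (rule pm_sum_induct[of "\<lambda>f. subst_vars h f \<in> polys W"])
  fix m assume m: "m \<in> kys f"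
  have mV: "kys m \<subseteq> V" using assms(1) m by (simp add: polys_def)
  have "h i ^ lkp m i \<in> polys W" for i
    using assms(2)[of i] subsetD[OF mV, of i] by (cases "lkp m i = 0") (auto simp: in_keys_iff)
  then have "(\<Prod>i\<in>A. h i ^ lkp m i) \<in> polys W" for A
    by (induction A rule: infinite_finite_induct) auto
  then show "subst_vars h (sng m (lkp f m)) \<in> polys W" by (auto simp: subst_vars_single)
qed (auto simp: subst_vars_add)

text \<open>Characteristic zero enters through the infinitude of the field: once the other
  coordinates avoid the zeros of the leading coefficient in \<open>x\<close>, only finitely many
  values of \<open>x\<close> are roots.\<close>

lemma exists_nonroot:
  fixes f :: "('n::finite, 'k::field_char_0) mpoly"
  assumes "f \<noteq> 0" shows "\<exists>P. evalp P f \<noteq> 0"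
proof -
  have "\<exists>P. evalp P f \<noteq> 0" if "finite V" "f \<in> polys V" "f \<noteq> 0" for V :: "'n set" and f :: "('n, 'k) mpoly"
    using that
  proof (induction V arbitrary: f)
    case empty
    then show ?case by (auto simp: polys_empty)
  next
    case (insert x V)
    have k: "coef x j f \<in> polys V" for j using coef_polys[OF insert(4), of x j] insert(2) by simp
    obtain P where P: "evalp P (coef x (deg_in x f) f) \<noteq> 0"
      using insert.IH[OF k lc_nonzero[OF insert(5)]] by blast
    define q where "q = (\<Sum>j\<le>deg_in x f. monom (evalp P (coef x j f)) j)"
    have "coeff q (deg_in x f) = evalp P (coef x (deg_in x f) f)"
      unfolding q_def by (simp add: coeff_sum if_distrib cong: if_cong)
    then have "q \<noteq> 0" using P by auto
    then have "finite {a. poly q a = 0}" by (rule poly_roots_finite)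
    then obtain a where a: "poly q a \<noteq> 0"
      using infinite_UNIV_char_0[where 'a='k] by (metis (mono_tags, lifting) Collect_cong UNIV_def)
    have "evalp (P(x := a)) (coef x j f) = evalp P (coef x j f)" for j
      using insert(2) by (intro evalp_cong_polys[OF k]) auto
    then have "evalp (P(x := a)) f = poly q a"
      by (subst coef_expand[of f x]) (simp add: evalp_sum evalp_mult evalp_power q_def poly_sum poly_monom)
    then show ?case using a by metis
  qed
  from this[of UNIV f] assms show ?thesis by simp
qed

section \<open>Homogeneous components\<close>

lemma mon_deg_add: "mon_deg (m + m') = mon_deg m + mon_deg m'"
  by (simp add: mon_deg_def lookup_add sum.distrib)
lemma mon_deg_0 [simp]: "mon_deg 0 = 0" by (simp add: mon_deg_def)
lemma mon_deg_single [simp]: "mon_deg (sng i k) = k"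
proof -
  have "(\<Sum>j\<in>UNIV. lkp (sng i k) j) = (\<Sum>j\<in>UNIV. if j = i then k else 0)"
    by (rule sum.cong) (auto simp: lookup_single when_def)
  then show ?thesis by (simp add: mon_deg_def)
qed
lemma mon_deg_eq_0 [simp]: "mon_deg m = 0 \<longleftrightarrow> m = 0"
  unfolding mon_deg_def by (auto intro: poly_mapping_eqI)

text \<open>The grading as a ring homomorphism into polynomials in one auxiliary variable: the
  coefficient of index \<open>t\<close> is the component of degree \<open>t\<close>, so components
  of products are computed by univariate multiplication.\<close>

definition hgen :: "('n::finite, 'k::field) mpoly \<Rightarrow> ('n, 'k) mpoly poly" where
  "hgen = additive_ext (\<lambda>m c. monom (sng m c) (mon_deg m))"
definition hcomp :: "nat \<Rightarrow> ('n::finite, 'k::field) mpoly \<Rightarrow> ('n, 'k) mpoly" where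
  "hcomp t f = coeff (hgen f) t"

lemma hgen_single: "hgen (sng m c) = monom (sng m c) (mon_deg m)"
  by (simp add: hgen_def additive_ext_single)
lemma hgen_0 [simp]: "hgen 0 = 0" by (simp add: hgen_def)
lemma hgen_add: "hgen (f + g) = hgen f + hgen g"
  unfolding hgen_def by (rule additive_ext_add) (auto simp: single_add add_monom)
lemma hgen_mult: "hgen (f * g) = hgen f * hgen g"
  unfolding hgen_def by (rule additive_ext_mult) (auto simp: single_add add_monom mult_monom mult_single mon_deg_add)

lemma hcomp_0 [simp]: "hcomp t 0 = 0" by (simp add: hcomp_def)
lemma hcomp_add: "hcomp t (f + g) = hcomp t f + hcomp t g" by (simp add: hcomp_def hgen_add)
lemma hcomp_mult: "hcomp t (f * g) = (\<Sum>i\<le>t. hcomp i f * hcomp (t - i) g)" by (simp add: hcomp_def hgen_mult coeff_mult)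

lemma lookup_hcomp: "lkp (hcomp t f) m = (if mon_deg m = t then lkp f m else 0)"
proof (induction f rule: pm_induct)
  case (single m' c)
  show ?case by (auto simp: hcomp_def hgen_single lookup_single when_def)
next
  case (add f g)
  then show ?case by (auto simp: hcomp_add lookup_add)
qed

lemma hcomp_forms [simp]: "hcomp t f \<in> forms t"
  by (auto simp: forms_def in_keys_iff lookup_hcomp split: if_splits)
lemma hcomp_expand: "f = (\<Sum>t\<le>degree (hgen f). hcomp t f)"
proof -
  have *: "poly (hgen f) 1 = f"
  proof (induction f rule: pm_induct)
    case (single m c)
    then show ?case by (simp add: hgen_single poly_monom)
  next
    case (add f g)
    then show ?case by (simp add: hgen_add)
  qed
  show ?thesis by (subst *[symmetric]) (simp add: poly_altdef hcomp_def)
qed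

lemma hgen_forms: assumes "f \<in> forms t" shows "hgen f = monom f t"
proof (rule poly_eqI)
  fix j
  have "hcomp j f = (if j = t then f else 0)"
  proof (rule poly_mapping_eqI)
    fix m
    have "mon_deg m = t" if "lkp f m \<noteq> 0" using assms that by (auto simp: forms_def in_keys_iff)
    then show "lkp (hcomp j f) m = lkp (if j = t then f else 0) m"
      by (cases "lkp f m = 0") (auto simp: lookup_hcomp)
  qed
  then show "coeff (hgen f) j = coeff (monom f t) j" by (auto simp: hcomp_def)
qed

lemma hcomp_of_form: "f \<in> forms t \<Longrightarrow> hcomp j f = (if j = t then f else 0)"
  by (simp add: hcomp_def hgen_forms)

lemma forms_hcomp: "f \<in> forms t \<longleftrightarrow> hcomp t f = f"
  using hcomp_of_form[of f t t] hcomp_forms[of t f] by metis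

lemma hcomp_form_mult: assumes "f \<in> forms a" shows "hcomp t (f * g) = (if a \<le> t then f * hcomp (t - a) g else 0)"
  by (simp add: hcomp_def hgen_mult hgen_forms[OF assms] coeff_monom_mult)

lemma hgen_eq_0_iff [simp]: "hgen f = 0 \<longleftrightarrow> f = 0"
  using hcomp_expand[of f] by (auto simp: hcomp_def)

lemma forms_0 [simp]: "0 \<in> forms t" by (simp add: forms_def)
lemma forms_add [intro]: "f \<in> forms t \<Longrightarrow> g \<in> forms t \<Longrightarrow> f + g \<in> forms t"
  by (simp add: forms_hcomp hcomp_add)
lemma forms_mult [intro]: "f \<in> forms a \<Longrightarrow> g \<in> forms b \<Longrightarrow> f * g \<in> forms (a + b)"
  by (subst forms_hcomp) (simp add: hcomp_form_mult hcomp_of_form)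
lemma forms_cst [simp]: "cst c \<in> forms 0"
  by (auto simp: forms_def cst_def)
lemma forms_1 [simp]: "1 \<in> forms 0" using forms_cst[of 1] by simp
lemma forms_cst_mult [intro]: "f \<in> forms t \<Longrightarrow> cst c * f \<in> forms t"
  using forms_mult[of "cst c" 0 f t] by simp
lemma forms_uminus [intro]: "f \<in> forms t \<Longrightarrow> - f \<in> forms t"
  using forms_cst_mult[of f t "-1"] by simp
lemma forms_diff [intro]: "f \<in> forms t \<Longrightarrow> g \<in> forms t \<Longrightarrow> f - g \<in> forms t"
  using forms_add[of f t "- g"] by auto
lemma forms_var [simp]: "var i \<in> forms 1"
  by (auto simp: forms_def var_def)
lemma forms_power: "f \<in> forms t \<Longrightarrow> f ^ k \<in> forms (k * t)"
  by (induction k) auto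
lemma forms_0_cst: "f \<in> forms 0 \<longleftrightarrow> (\<exists>c. f = cst c)"
proof
  assume f: "f \<in> forms 0"
  then have "f \<in> polys {}" by (auto simp: polys_def forms_def)
  then show "\<exists>c. f = cst c" by (simp add: polys_empty)
qed auto
lemma forms_unique: "f \<in> forms a \<Longrightarrow> f \<in> forms b \<Longrightarrow> f \<noteq> 0 \<Longrightarrow> a = b"
  using hcomp_of_form[of f a b] hcomp_of_form[of f b b] by (auto split: if_splits)

lemma coef_forms: assumes "f \<in> forms t" "j \<le> t" shows "coef x j f \<in> forms (t - j)"
  unfolding forms_def
proof (intro CollectI ballI)
  fix m assume "m \<in> kys (coef x j f)"
  then have "lkp f (m + sng x j) \<noteq> 0" by (auto simp: in_keys_iff lookup_coef split: if_splits)
  then have "mon_deg (m + sng x j) = t" using assms by (auto simp: forms_def in_keys_iff)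
  then show "mon_deg m = t - j" by (simp add: mon_deg_add)
qed

lemma deg_in_forms: assumes "f \<in> forms t" shows "deg_in x f \<le> t"
proof (rule deg_in_le)
  fix j assume j: "j > t"
  have "lkp f (m + sng x j) = 0" for m
  proof (rule ccontr)
    assume "lkp f (m + sng x j) \<noteq> 0"
    then have "mon_deg (m + sng x j) = t" using assms by (auto simp: forms_def in_keys_iff)
    then show False using j by (simp add: mon_deg_add)
  qed
  then show "coef x j f = 0" by (intro poly_mapping_eqI) (simp add: lookup_coef)
qed

text \<open>The lowest component of a product is the product of the lowest components, and likewise
  for the highest. If the two agree in the product, they agree in each factor.\<close>

lemma forms_mult_cancel:
  fixes f g :: "('n::finite, 'k::field) mpoly"
  assumes "f * g \<in> forms t" "f * g \<noteq> 0"
  shows "\<exists>a\<le>t. f \<in> forms a \<and> g \<in> forms (t - a)"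
proof -
  have nz: "f \<noteq> 0" "g \<noteq> 0" using assms(2) by auto
  define lo where "lo h = (LEAST i. hcomp i h \<noteq> 0)" for h :: "('n, 'k) mpoly"
  define hi where "hi h = degree (hgen h)" for h :: "('n, 'k) mpoly"
  have hi0: "hcomp (hi h) h \<noteq> 0" if "h \<noteq> 0" for h :: "('n, 'k) mpoly"
    using that by (simp add: hi_def hcomp_def)
  have lo0: "hcomp (lo h) h \<noteq> 0" if "h \<noteq> 0" for h :: "('n, 'k) mpoly"
    unfolding lo_def by (rule LeastI[of "\<lambda>i. hcomp i h \<noteq> 0", OF hi0[OF that]])
  have lol: "hcomp i h = 0" if "i < lo h" for i and h :: "('n, 'k) mpoly"
    using not_less_Least[OF that[unfolded lo_def]] by simp
  have hil: "hcomp i h = 0" if "i > hi h" for i and h :: "('n, 'k) mpoly"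
    using that by (simp add: hi_def hcomp_def coeff_eq_0)
  have "hcomp (hi f + hi g) (f * g) = hcomp (hi f) f * hcomp (hi g) g"
    by (simp add: hcomp_def hgen_mult hi_def coeff_mult_degree_sum)
  then have 1: "hi f + hi g = t" using hi0[OF nz(1)] hi0[OF nz(2)] hcomp_of_form[OF assms(1), of "hi f + hi g"]
    by (auto split: if_splits)
  have "hcomp (lo f + lo g) (f * g) = (\<Sum>i\<le>lo f + lo g. if i = lo f then hcomp (lo f) f * hcomp (lo g) g else 0)"
    unfolding hcomp_mult
  proof (rule sum.cong[OF refl])
    fix i assume "i \<in> {..lo f + lo g}"
    then show "hcomp i f * hcomp (lo f + lo g - i) g = (if i = lo f then hcomp (lo f) f * hcomp (lo g) g else 0)"
      using lol[of i f] lol[of "lo f + lo g - i" g] by (cases i "lo f" rule: linorder_cases) auto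
  qed
  also have "\<dots> = hcomp (lo f) f * hcomp (lo g) g" by simp
  finally have 2: "lo f + lo g = t" using lo0[OF nz(1)] lo0[OF nz(2)] hcomp_of_form[OF assms(1), of "lo f + lo g"]
    by (auto split: if_splits)
  have le: "lo h \<le> hi h" if "h \<noteq> 0" for h :: "('n, 'k) mpoly"
    using hi0[OF that] lol[of "hi h" h] by (meson not_le)
  have eq: "lo f = hi f" "lo g = hi g" using 1 2 le[OF nz(1)] le[OF nz(2)] by auto
  have "h \<in> forms (hi h)" if "lo h = hi h" for h :: "('n, 'k) mpoly"
  proof -
    have "h = (\<Sum>i\<le>hi h. if i = hi h then hcomp (hi h) h else 0)"
      by (subst hcomp_expand[of h, folded hi_def], rule sum.cong) (use lol[of _ h] that in auto)
    then have "h = hcomp (hi h) h" by simp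
    then show ?thesis using hcomp_forms by metis
  qed
  then show ?thesis using eq 1 by (intro exI[of _ "hi f"]) auto
qed

lemma subst_vars_forms:
  assumes h: "\<And>i. h i \<in> forms 1" and f: "f \<in> forms t" shows "subst_vars h f \<in> forms t"
proof (rule pm_sum_induct[of "\<lambda>f. subst_vars h f \<in> forms t"])
  fix m assume "m \<in> kys f"
  then have m: "mon_deg m = t" using f by (auto simp: forms_def)
  have "(\<Prod>i\<in>A. h i ^ lkp m i) \<in> forms (\<Sum>i\<in>A. lkp m i)" for A
  proof (induction A rule: infinite_finite_induct)
    case (insert x A)
    then show ?case using forms_power[OF h, of x "lkp m x"] by auto
  qed auto
  from this[of UNIV] show "subst_vars h (sng m (lkp f m)) \<in> forms t"
    unfolding subst_vars_single m[symmetric] mon_deg_def by auto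
qed (auto simp: subst_vars_add)

lemma evalp_form_scale:
  assumes "f \<in> forms t" shows "evalp (\<lambda>i. c * P i) f = c ^ t * evalp P f"
proof (rule pm_sum_induct[of "\<lambda>f. evalp (\<lambda>i. c * P i) f = c ^ t * evalp P f"])
  fix m assume "m \<in> kys f"
  then have m: "mon_deg m = t" using assms by (auto simp: forms_def)
  have "(\<Prod>i\<in>UNIV. (c * P i) ^ lkp m i) = c ^ t * (\<Prod>i\<in>UNIV. P i ^ lkp m i)"
    by (simp add: m[symmetric] mon_deg_def power_mult_distrib prod.distrib power_sum)
  then show "evalp (\<lambda>i. c * P i) (sng m (lkp f m)) = c ^ t * evalp P (sng m (lkp f m))"
    by (simp add: evalp_single)
qed (auto simp: evalp_add algebra_simps)


section \<open>Unique factorization\<close>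

lemma is_ideal_iff:
  "is_ideal I \<longleftrightarrow> 0 \<in> I \<and> (\<forall>x\<in>I. \<forall>y\<in>I. x + y \<in> I) \<and> (\<forall>c. \<forall>x\<in>I. c * x \<in> I)"
  by (simp add: module.subspace_def[OF module_times])

lemma is_idealD:
  assumes "is_ideal I"
  shows "0 \<in> I" "x \<in> I \<Longrightarrow> y \<in> I \<Longrightarrow> x + y \<in> I" "x \<in> I \<Longrightarrow> c * x \<in> I"
    "x \<in> I \<Longrightarrow> y \<in> I \<Longrightarrow> x - y \<in> I"
proof -
  show "0 \<in> I" "x \<in> I \<Longrightarrow> y \<in> I \<Longrightarrow> x + y \<in> I" "x \<in> I \<Longrightarrow> c * x \<in> I"
    using assms unfolding is_ideal_iff by auto
  assume "x \<in> I" "y \<in> I"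
  then have "x + (- 1) * y \<in> I" using assms unfolding is_ideal_iff by blast
  then show "x - y \<in> I" by simp
qed

lemma is_ideal_sum: "is_ideal I \<Longrightarrow> (\<And>i. i \<in> A \<Longrightarrow> f i \<in> I) \<Longrightarrow> sum f A \<in> I"
  by (induction A rule: infinite_finite_induct) (auto intro: is_idealD)

text \<open>Gauss' argument: take the least indices \<open>i\<close>, \<open>k\<close> of
  coefficients outside \<open>P\<close>; in the coefficient of index \<open>i + k\<close> of the
  product all summands but one lie in \<open>P\<close>. It serves twice, for the multiples of a
  prime element and for prime ideals.\<close>

lemma coef_mult_outside_ideal:
  assumes P: "is_ideal P" and f: "coef x j f \<notin> P" and g: "coef x l g \<notin> P"
    and prod: "\<And>j. coef x j (f * g) \<in> P"
  shows "\<exists>i k. coef x i f \<notin> P \<and> coef x k g \<notin> P \<and> coef x i f * coef x k g \<in> P"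
proof -
  define i where "i = (LEAST j. coef x j f \<notin> P)"
  define k where "k = (LEAST j. coef x j g \<notin> P)"
  have i: "coef x i f \<notin> P" unfolding i_def using f by (rule LeastI)
  have k: "coef x k g \<notin> P" unfolding k_def using g by (rule LeastI)
  have i': "coef x j f \<in> P" if "j < i" for j using not_less_Least[OF that[unfolded i_def]] by simp
  have k': "coef x j g \<in> P" if "j < k" for j using not_less_Least[OF that[unfolded k_def]] by simp
  have e: "coef x (i + k) (f * g) = coef x i f * coef x k g + (\<Sum>j\<in>{..i + k} - {i}. coef x j f * coef x (i + k - j) g)"
    unfolding coef_mult by (subst sum.remove[of _ i]) auto
  have "(\<Sum>j\<in>{..i + k} - {i}. coef x j f * coef x (i + k - j) g) \<in> P"
  proof (rule is_ideal_sum[OF P])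
    fix j assume j: "j \<in> {..i + k} - {i}"
    show "coef x j f * coef x (i + k - j) g \<in> P"
    proof (cases "j < i")
      case True
      show ?thesis by (subst mult.commute) (rule is_idealD(3)[OF P i'[OF True]])
    next
      case False
      then have "i + k - j < k" using j by auto
      then show ?thesis using is_idealD(3)[OF P k'] by simp
    qed
  qed
  then have "coef x i f * coef x k g \<in> P"
    using is_idealD(4)[OF P prod[of "i + k"]] unfolding e by fastforce
  then show ?thesis using i k by blast
qed

text \<open>\<open>range cst\<close> consists of 0 and the units. Divisibility in the whole ring
  agrees with divisibility inside \<open>polys V\<close> by \<open>polys_mult_iff\<close>.\<close>

definition prime_in :: "'n set \<Rightarrow> ('n::finite, 'k::field) mpoly \<Rightarrow> bool" where
  "prime_in V p \<longleftrightarrow> p \<in> polys V \<and> p \<notin> range cst \<and>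
     (\<forall>g\<in>polys V. \<forall>h\<in>polys V. p dvd g * h \<longrightarrow> p dvd g \<or> p dvd h)"

text \<open>Unique factorization is used only as the existence of a factorization into primes;
  uniqueness is implicit, the factors being prime and not merely irreducible.\<close>

inductive prime_prod :: "'n set \<Rightarrow> ('n::finite, 'k::field) mpoly \<Rightarrow> bool" for V where
  cst: "c \<noteq> 0 \<Longrightarrow> prime_prod V (cst c)"
| mult: "prime_in V p \<Longrightarrow> prime_prod V w \<Longrightarrow> prime_prod V (p * w)"

lemma prime_in_nonzero: "prime_in V p \<Longrightarrow> p \<noteq> 0"
  unfolding prime_in_def by (metis cst_simps(1) rangeI)

lemma prime_prod_mult: "prime_prod V a \<Longrightarrow> prime_prod V b \<Longrightarrow> prime_prod V (a * b)"
proof (induction a rule: prime_prod.induct)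
  case (cst c)
  from cst(2) show ?case
  proof (induction b rule: prime_prod.induct)
    case (cst c')
    have "prime_prod V (cst (c * c'))" by (rule prime_prod.cst) (use cst \<open>c \<noteq> 0\<close> in simp)
    then show ?case by simp
  next
    case (mult p w)
    then show ?case using prime_prod.mult[of V p "cst c * w"] by (simp add: mult.left_commute)
  qed
next
  case (mult p w)
  then show ?case using prime_prod.mult[of V p "w * b"] by (simp add: mult.assoc)
qed

lemma dvd_iff_coef:
  fixes p :: "('n::finite, 'k::field) mpoly"
  assumes "p \<in> polys V" "x \<notin> V"
  shows "p dvd g \<longleftrightarrow> (\<forall>j. p dvd coef x j g)"
proof
  assume "p dvd g"
  then obtain h where h: "g = p * h" by (elim dvdE)
  have "coef x j g = p * coef x j h" for j
    unfolding h by (simp add: coef_def upoly_mult upoly_polys[OF assms])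
  then show "\<forall>j. p dvd coef x j g" by simp
next
  assume "\<forall>j. p dvd coef x j g"
  then have "p dvd (\<Sum>j\<le>deg_in x g. coef x j g * var x ^ j)" by (intro dvd_sum dvd_mult2) auto
  then show "p dvd g" using coef_expand[of g x] by simp
qed

lemma prime_in_insert:
  fixes p :: "('n::finite, 'k::field) mpoly"
  assumes p: "prime_in V p" and x: "x \<notin> V"
  shows "prime_in (insert x V) p"
proof -
  have pV: "p \<in> polys V" using p by (simp add: prime_in_def)
  note dv = dvd_iff_coef[OF pV x]
  have c: "coef x j g \<in> polys V" if "g \<in> polys (insert x V)" for j g
    using coef_polys[OF that, of x j] x by simp
  have "p dvd g \<or> p dvd h" if g: "g \<in> polys (insert x V)" and h: "h \<in> polys (insert x V)" and d: "p dvd g * h" for g h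
  proof (rule ccontr)
    assume "\<not> (p dvd g \<or> p dvd h)"
    then obtain j l where jl: "\<not> p dvd coef x j g" "\<not> p dvd coef x l h" using iffD2[OF dv] by blast
    have "is_ideal {q. p dvd q}" unfolding is_ideal_iff by simp
    from coef_mult_outside_ideal[OF this, of x j g l h] jl iffD1[OF dv d]
    obtain i k where "\<not> p dvd coef x i g" "\<not> p dvd coef x k h" "p dvd coef x i g * coef x k h" by auto
    then show False using p c[OF g] c[OF h] unfolding prime_in_def by blast
  qed
  moreover have "p \<in> polys (insert x V)" by (rule subsetD[OF polys_mono pV]) auto
  ultimately show ?thesis using p unfolding prime_in_def by simp
qed

lemma prime_prod_insert: "prime_prod V w \<Longrightarrow> x \<notin> V \<Longrightarrow> prime_prod (insert x V) w"
  by (induction rule: prime_prod.induct) (auto intro: prime_prod.intros prime_in_insert)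

text \<open>The prime factors of \<open>w\<close> are removed one at a time: each divides
  \<open>f * q\<close> but not \<open>f\<close>.\<close>

lemma prime_prod_cancel:
  fixes w :: "('n::finite, 'k::field) mpoly"
  assumes "prime_prod V w" "\<And>p. prime_in V p \<Longrightarrow> p dvd w \<Longrightarrow> \<not> p dvd f"
    and "w dvd f * q" "f \<in> polys V" "q \<in> polys V"
  shows "w dvd q"
  using assms
proof (induction arbitrary: q rule: prime_prod.induct)
  case (cst c)
  have "q = cst c * (cst (1 / c) * q)"
    using cst(1) by (simp flip: mult.assoc cst_simps(4))
  then show ?case by (metis dvd_triv_left)
next
  case (mult p w)
  have pq: "p dvd q"
  proof -
    have "p dvd f * q" using mult.prems(2) dvd_mult_left by blast
    moreover have "\<not> p dvd f" using mult.prems(1)[OF mult.hyps(1)] by simp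
    ultimately show ?thesis using mult.hyps(1) mult.prems(3,4) unfolding prime_in_def by blast
  qed
  then obtain q' where q': "q = p * q'" by (elim dvdE)
  have pn: "p \<noteq> 0" using prime_in_nonzero[OF mult.hyps(1)] .
  show ?case
  proof (cases "q = 0")
    case False
    then have "q' \<in> polys V" using mult.prems(4) polys_mult_iff[of p q' V] pn unfolding q' by auto
    moreover have "w dvd f * q'"
    proof -
      obtain u where "f * q = p * w * u" using mult.prems(2) by (elim dvdE)
      then have "p * (f * q') = p * (w * u)" unfolding q' by (simp only: ac_simps)
      then have "f * q' = w * u" using pn by simp
      then show ?thesis by simp
    qed
    ultimately have "w dvd q'" using mult.IH[of q'] mult.prems(1,3) by (simp add: dvd_mult)
    then show ?thesis unfolding q' by (simp add: mult_dvd_mono)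
  qed simp
qed

text \<open>Each prime of \<open>a\<close> divides \<open>Q\<close> or \<open>w\<close> and is
  cancelled there; \<open>a2\<close> collects the primes taken out of \<open>w\<close>.\<close>

lemma prime_prod_split:
  fixes a :: "('n::finite, 'k::field) mpoly"
  assumes "prime_prod V a" "a * f = Q * w" "Q \<in> polys V" "w \<in> polys V"
  shows "\<exists>a2 Q1 w1. w = a2 * w1 \<and> f = Q1 * w1 \<and> a2 dvd a"
  using assms
proof (induction arbitrary: Q w rule: prime_prod.induct)
  case (cst c)
  have "cst (1 / c) * (cst c * f) = cst (1 / c) * (Q * w)" using cst by simp
  then have "f = (cst (1 / c) * Q) * w"
    using cst(1) by (simp flip: mult.assoc cst_simps(4))
  then have "w = 1 * w \<and> f = (cst (1 / c) * Q) * w \<and> 1 dvd cst c" by simp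
  then show ?case by blast
next
  case (mult p a)
  have pn: "p \<noteq> 0" using prime_in_nonzero[OF mult.hyps(1)] .
  have "p dvd Q * w" using mult.prems(1) by (metis dvd_triv_left mult.assoc)
  then have "p dvd Q \<or> p dvd w" using mult.hyps(1) mult.prems by (auto simp: prime_in_def)
  have pV: "p \<in> polys V" using mult.hyps(1) by (simp add: prime_in_def)
  have div: "h' \<in> polys V" if "h = p * h'" "h \<in> polys V" for h h'
    using that polys_mult_iff[of p h' V] pn by (cases "h' = 0") auto
  from \<open>p dvd Q \<or> p dvd w\<close> show ?case
  proof
    assume "p dvd Q"
    then obtain Q' where Q': "Q = p * Q'" by (elim dvdE)
    have "p * (a * f) = p * (Q' * w)" using mult.prems(1) unfolding Q' by (simp only: ac_simps)
    then have "a * f = Q' * w" using pn by simp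
    from mult.IH[OF this div[OF Q' mult.prems(2)] mult.prems(3)] show ?thesis
      by (metis dvd_mult)
  next
    assume "p dvd w"
    then obtain w' where w': "w = p * w'" by (elim dvdE)
    have "p * (a * f) = p * (Q * w')" using mult.prems(1) unfolding w' by (simp only: ac_simps)
    then have "a * f = Q * w'" using pn by simp
    from mult.IH[OF this mult.prems(2) div[OF w' mult.prems(3)]] obtain a2 Q1 w1 where
      h: "w' = a2 * w1" "f = Q1 * w1" "a2 dvd a" by blast
    have "w = (p * a2) * w1" unfolding w' h(1) by (simp only: ac_simps)
    moreover have "p * a2 dvd p * a" using h(3) by (simp add: mult_dvd_mono)
    ultimately show ?thesis using h(2) by blast
  qed
qed

text \<open>Gauss' theorem that unique factorization passes to one more variable. The usual proof
  takes a gcd over the fraction field of \<open>polys V\<close>; here an element \<open>e\<close> of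
  least degree in \<open>x\<close> of the ideal generated by \<open>w\<close> and \<open>g\<close>
  replaces it, and denominators are elements of \<open>polys V\<close>, removed by
  \<open>cancel\<close>.\<close>

lemma prime_prod_all_aux:
  fixes w :: "('n::finite, 'k::field) mpoly"
  assumes "finite V" "w \<in> polys V" "w \<noteq> 0"
  shows "prime_prod V w"
  using assms
proof (induction V arbitrary: w)
  case empty
  then show ?case by (auto simp: polys_empty intro: prime_prod.intros)
next
  case (insert x V)
  define W where "W = insert x V"
  have sub: "f \<in> polys W" if "f \<in> polys V" for f :: "('n, 'k) mpoly" using that polys_mono[of V W] by (auto simp: W_def)
  have lower: "prime_prod W f" if "f \<in> polys V" "f \<noteq> 0" for f :: "('n, 'k) mpoly"
    unfolding W_def by (rule prime_prod_insert[OF insert.IH[OF that] insert.hyps(2)])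
  have cstI: "f \<in> range cst" if "\<forall>y. deg_in y f = 0" for f :: "('n, 'k) mpoly"
    using that polys_empty[of f] by (auto simp: polys_iff_deg_in)
  have "prime_prod W w" if "w \<in> polys W" "w \<noteq> 0" for w :: "('n, 'k) mpoly"
    using that
  \<comment> \<open>The total of the degrees in all variables is additive on products and vanishes
    only on constants, so proper factors are smaller.\<close>
  proof (induction "\<Sum>y\<in>UNIV. deg_in y w" arbitrary: w rule: less_induct)
    case less
    show ?case
    proof (cases "\<exists>a b. w = a * b \<and> a \<notin> range cst \<and> b \<notin> range cst")
      case True
      then obtain a b where ab: "w = a * b" "a \<notin> range cst" "b \<notin> range cst" by blast
      have nz: "a \<noteq> 0" "b \<noteq> 0" using less.prems ab(1) by auto
      have k: "a \<in> polys W" "b \<in> polys W" using less.prems polys_mult_iff[OF nz] ab(1) by auto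
      have s: "(\<Sum>y\<in>UNIV. deg_in y w) = (\<Sum>y\<in>UNIV. deg_in y a) + (\<Sum>y\<in>UNIV. deg_in y b)"
        by (simp add: ab(1) deg_in_mult[OF nz] sum.distrib)
      have "(\<Sum>y\<in>UNIV. deg_in y a) \<noteq> 0" "(\<Sum>y\<in>UNIV. deg_in y b) \<noteq> 0" using ab cstI[of a] cstI[of b] by auto
      then have lt: "(\<Sum>y\<in>UNIV. deg_in y a) < (\<Sum>y\<in>UNIV. deg_in y w)" "(\<Sum>y\<in>UNIV. deg_in y b) < (\<Sum>y\<in>UNIV. deg_in y w)"
        unfolding s by linarith+
      have "prime_prod W a" "prime_prod W b"
        by (rule less.hyps[OF lt(1) k(1) nz(1)], rule less.hyps[OF lt(2) k(2) nz(2)])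
      then show ?thesis unfolding ab(1) by (rule prime_prod_mult)
    next
      case irr: False
      show ?thesis
      proof (cases "deg_in x w = 0")
        case True
        have "w \<in> polys V" by (rule deg_in_0_polys[OF less.prems(1)[unfolded W_def] True])
        then show ?thesis using lower less.prems(2) by simp
      next
        case wx: False
        have wc: "w \<notin> range cst" using wx by auto
        \<comment> \<open>An irreducible \<open>w\<close> that involves \<open>x\<close> is
          primitive: a nonconstant divisor free of \<open>x\<close> would have a constant
          cofactor.\<close>
        have no_low: "\<not> p dvd w" if "p \<in> polys V" "p \<notin> range cst" for p
        proof
          assume "p dvd w"
          then obtain u where u: "w = p * u" by (elim dvdE)
          have nz: "p \<noteq> 0" "u \<noteq> 0" using less.prems u by auto
          have "\<not> (w = p * u \<and> p \<notin> range cst \<and> u \<notin> range cst)" using irr by blast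
          then have "u \<in> range cst" using u that(2) by simp
          then have "deg_in x w = 0" using deg_in_mult[OF nz, of x] deg_in_polys[OF that(1) insert.hyps(2)] unfolding u by auto
          then show False using wx by simp
        qed
        \<comment> \<open>Primitivity makes denominators harmless: the primes of \<open>c\<close>
          divide \<open>w * u\<close> but not \<open>w\<close>, so \<open>c\<close> divides
          \<open>u\<close> and cancels.\<close>
        have cancel: "w dvd h" if c: "c \<in> polys V" "c \<noteq> 0" and d: "w dvd c * h" and h: "h \<in> polys W" for c h
        proof (cases "h = 0")
          case False
          obtain u where u: "c * h = w * u" using d by (elim dvdE)
          have "c * h \<in> polys W" "c * h \<noteq> 0" using c h False sub[OF c(1)] by auto
          then have uW: "u \<in> polys W" using polys_dvd[of u "c * h" W] u by simp
          have pc: "\<not> p dvd w" if "prime_in W p" "p dvd c" for p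
          proof (rule no_low)
            show "p \<in> polys V" by (rule polys_dvd[OF that(2) c(2,1)])
            show "p \<notin> range cst" using that by (simp add: prime_in_def)
          qed
          have "c dvd w * u" unfolding u[symmetric] by simp
          then have "c dvd u"
            using prime_prod_cancel[OF lower[OF c] pc _ less.prems(1) uW] by blast
          then obtain v where "u = c * v" by (elim dvdE)
          then have "c * h = c * (w * v)" using u by (simp only: ac_simps)
          then have "h = w * v" using c by simp
          then show ?thesis by simp
        qed simp
        have prime: "w dvd g \<or> w dvd h" if g: "g \<in> polys W" and h: "h \<in> polys W" and d: "w dvd g * h" for g h
        proof -
          define I where "I = {u * w + v * g | u v. u \<in> polys W \<and> v \<in> polys W}"
          have Ii: "u * w + v * g \<in> I" if "u \<in> polys W" "v \<in> polys W" for u v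
            unfolding I_def by (intro CollectI exI[of _ u] exI[of _ v]) (simp add: that)
          have wI: "w \<in> I" using Ii[of 1 0] by simp
          have gI: "g \<in> I" using Ii[of 0 1] by simp
          have Ie: "\<exists>u v. i = u * w + v * g \<and> u \<in> polys W \<and> v \<in> polys W" if "i \<in> I" for i
            using that unfolding I_def by simp
          have IW: "i \<in> polys W" if i: "i \<in> I" for i
          proof -
            obtain u v where "i = u * w + v * g" "u \<in> polys W" "v \<in> polys W" using Ie[OF i] by (elim exE conjE)
            then show ?thesis using less.prems(1) g by auto
          qed
          have Icomb: "a * i - b * i' \<in> I" if ii: "i \<in> I" "i' \<in> I" and ab: "a \<in> polys W" "b \<in> polys W" for a b i i'
          proof -
            obtain u v where uv: "i = u * w + v * g" "u \<in> polys W" "v \<in> polys W" using Ie[OF ii(1)] by (elim exE conjE)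
            obtain u' v' where uv': "i' = u' * w + v' * g" "u' \<in> polys W" "v' \<in> polys W" using Ie[OF ii(2)] by (elim exE conjE)
            have "a * i - b * i' = (a * u - b * u') * w + (a * v - b * v') * g"
              unfolding uv uv' by (simp add: algebra_simps)
            moreover have "a * u - b * u' \<in> polys W" "a * v - b * v' \<in> polys W" using uv uv' ab by auto
            ultimately show ?thesis using Ii by simp
          qed
          define e where "e = (ARG_MIN (deg_in x) i. i \<in> I \<and> i \<noteq> 0)"
          have e: "e \<in> I \<and> e \<noteq> 0" unfolding e_def
            by (rule arg_min_natI[of _ w]) (use wI less.prems(2) in simp)
          have emin: "deg_in x e \<le> deg_in x i" if "i \<in> I" "i \<noteq> 0" for i
            unfolding e_def by (rule arg_min_nat_le) (use that in simp)
          have eW: "e \<in> polys W" using e IW by blast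
          \<comment> \<open>Minimality of \<open>e\<close> kills the pseudo-remainder, so up to a
            denominator \<open>c\<close> every element of \<open>I\<close> is a multiple of
            \<open>e\<close>.\<close>
          have div: "\<exists>c Q. c \<in> polys V \<and> c \<noteq> 0 \<and> c * i = Q * e \<and> Q \<in> polys W" if i: "i \<in> I" for i
          proof -
            have xW: "x \<in> W" by (simp add: W_def)
            obtain N Q r where
              r: "coef x (deg_in x e) e ^ N * i = Q * e + r" "r = 0 \<or> deg_in x r < deg_in x e" "Q \<in> polys W"
              using pseudo_division[OF conjunct2[OF e] IW[OF i] eW xW] by (elim exE conjE)
            have cV: "coef x (deg_in x e) e \<in> polys V" using coef_polys[OF eW, of x] insert.hyps(2) by (simp add: W_def)
            have "r = coef x (deg_in x e) e ^ N * i - Q * e" using r(1) by simp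
            then have "r \<in> I" using Icomb[OF i conjunct1[OF e] sub[OF polys_power[OF cV]] r(3)] by simp
            then have "r = 0" using r(2) emin[of r] by linarith
            then have "coef x (deg_in x e) e ^ N \<in> polys V \<and> coef x (deg_in x e) e ^ N \<noteq> 0
                \<and> coef x (deg_in x e) e ^ N * i = Q * e \<and> Q \<in> polys W"
              using r(1,3) polys_power[OF cV] lc_nonzero[OF conjunct2[OF e], of x] by simp
            then show ?thesis by (intro exI)
          qed
          show ?thesis
          proof (cases "deg_in x e = 0")
            \<comment> \<open>Here \<open>w\<close> and \<open>g\<close> are coprime over the
              fraction field, and \<open>e\<close> is the denominator in a Bezout identity, which is
              then multiplied by \<open>h\<close>.\<close>
            case True
            have eV: "e \<in> polys V" by (rule deg_in_0_polys[OF eW[unfolded W_def] True])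
            obtain u v where "e = u * w + v * g" using Ie[OF conjunct1[OF e]] by (elim exE conjE)
            then have "e * h = w * (u * h) + v * (g * h)" by (simp add: algebra_simps)
            then have "w dvd e * h" using d by (simp add: dvd_mult)
            then have "w dvd h" by (rule cancel[OF eV conjunct2[OF e] _ h])
            then show ?thesis ..
          next
            \<comment> \<open>Here \<open>e\<close> is, up to denominators, a common divisor of
              \<open>w\<close> and \<open>g\<close>. Irreducibility of \<open>w\<close> makes
              \<open>e\<close> a multiple of \<open>w\<close>, so \<open>w\<close> divides a
              denominator times \<open>g\<close>.\<close>
            case ex: False
            obtain a Q where a: "a \<in> polys V" "a \<noteq> 0" "a * w = Q * e" "Q \<in> polys W" using div[OF wI] by (elim exE conjE)
            obtain a2 Q1 w1 where
              w1: "e = a2 * w1" "w = Q1 * w1" "a2 dvd a"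
              using prime_prod_split[OF lower[OF a(1,2)] a(3,4) eW] by (elim exE conjE)
            have nz: "a2 \<noteq> 0" "w1 \<noteq> 0" "Q1 \<noteq> 0" using e w1 less.prems by auto
            have a2: "a2 \<in> polys V" by (rule polys_dvd[OF w1(3) a(2,1)])
            have "deg_in x w1 \<noteq> 0"
              using ex deg_in_mult[OF nz(1,2), of x] deg_in_polys[OF a2 insert.hyps(2)] w1 by simp
            then have "w1 \<notin> range cst" by auto
            moreover have "\<not> (w = Q1 * w1 \<and> Q1 \<notin> range cst \<and> w1 \<notin> range cst)" using irr by blast
            ultimately have "Q1 \<in> range cst" using w1(2) by simp
            then obtain c where c: "Q1 = cst c" by blast
            then have "c \<noteq> 0" using nz by auto
            then have "w1 = cst (1 / c) * w" unfolding w1 c by (simp flip: mult.assoc cst_simps(4))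
            then have e': "e = w * (a2 * cst (1 / c))" using w1(1) by (simp only: ac_simps)
            obtain b Q' where b: "b \<in> polys V" "b \<noteq> 0" "b * g = Q' * e" using div[OF gI] by (elim exE conjE)
            have "w dvd b * g" unfolding b(3) e' by simp
            then have "w dvd g" by (rule cancel[OF b(1,2) _ g])
            then show ?thesis ..
          qed
        qed
        have "prime_in W w" using prime wc less.prems(1) by (simp add: prime_in_def)
        then have "prime_prod W (w * cst 1)" by (intro prime_prod.intros) auto
        then show ?thesis by simp
      qed
    qed
  qed
  then show ?case using insert.prems by (simp add: W_def)
qed

theorem prime_prod_all: "(w :: ('n::finite, 'k::field) mpoly) \<noteq> 0 \<Longrightarrow> prime_prod UNIV w"
  by (rule prime_prod_all_aux) auto

lemma prime_in_dvd_mult: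
  "prime_in UNIV p \<Longrightarrow> p dvd a * b \<Longrightarrow> p dvd a \<or> p dvd b"
  by (simp add: prime_in_def)

text \<open>A prime factor of \<open>w\<close> misses some \<open>s j\<close>, so it divides
  \<open>v\<close> and can be cancelled from both: multiplication by a coprime family creates no new
  common divisors.\<close>

lemma coprime_family_dvd:
  fixes w v :: "('n::finite, 'k::field) mpoly"
  assumes "w \<noteq> 0" "\<And>j. j \<in> A \<Longrightarrow> w dvd v * s j"
    and "\<And>p. prime_in UNIV p \<Longrightarrow> \<exists>j\<in>A. \<not> p dvd s j"
  shows "w dvd v"
  using prime_prod_all[OF assms(1)] assms(2)
proof (induction arbitrary: v rule: prime_prod.induct)
  case (cst c)
  have "v = cst c * (cst (1 / c) * v)"
    using cst(1) by (simp flip: mult.assoc cst_simps(4))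
  then show ?case by (metis dvd_triv_left)
next
  case (mult p w)
  obtain j where j: "j \<in> A" "\<not> p dvd s j" using assms(3)[OF mult.hyps(1)] by blast
  have "p dvd v * s j" using mult.prems[OF j(1)] dvd_mult_left by blast
  then have "p dvd v" using prime_in_dvd_mult[OF mult.hyps(1)] j(2) by blast
  then obtain v' where v': "v = p * v'" by (elim dvdE)
  have pn: "p \<noteq> 0" using prime_in_nonzero[OF mult.hyps(1)] .
  have "w dvd v' * s j" if "j \<in> A" for j
  proof -
    obtain u where "v * s j = p * w * u" using mult.prems[OF \<open>j \<in> A\<close>] by (elim dvdE)
    then have "p * (v' * s j) = p * (w * u)" unfolding v' by (simp only: ac_simps)
    then have "v' * s j = w * u" using pn by simp
    then show ?thesis by simp
  qed
  then have "w dvd v'" by (rule mult.IH)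
  then show ?case unfolding v' by (simp add: mult_dvd_mono)
qed

section \<open>Dimensions\<close>

text \<open>The polynomial ring is infinite-dimensional over the field, so finiteness is attached to
  the individual subspaces, here the graded pieces.\<close>

definition fin_span :: "('a::field \<Rightarrow> 'b::ab_group_add \<Rightarrow> 'b) \<Rightarrow> 'b set \<Rightarrow> bool" where
  "fin_span s V \<longleftrightarrow> (\<exists>B. finite B \<and> V \<subseteq> module.span s B)"

context vector_space
begin

lemma fin_span_mono: "fin_span scale W \<Longrightarrow> V \<subseteq> W \<Longrightarrow> fin_span scale V"
  unfolding fin_span_def by (meson subset_trans)

lemma fin_span_independent: "fin_span scale V \<Longrightarrow> B \<subseteq> V \<Longrightarrow> independent B \<Longrightarrow> finite B"
  unfolding fin_span_def using independent_span_bound by blast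

lemma dim_mono_fin_span:
  assumes "fin_span scale W" "V \<subseteq> W" shows "dim V \<le> dim W"
proof -
  obtain B where B: "B \<subseteq> V" "independent B" "V \<subseteq> span B" "card B = dim V"
    by (rule basis_exists)
  obtain C where C: "C \<subseteq> W" "independent C" "W \<subseteq> span C" "card C = dim W"
    by (rule basis_exists)
  have fC: "finite C" using fin_span_independent[OF assms(1) C(1,2)] .
  have "B \<subseteq> span C" using B(1) assms(2) C(3) by blast
  from independent_span_bound[OF fC B(2) this] show ?thesis using B(4) C(4) by simp
qed

lemma independent_span_disjoint:
  assumes "independent B" "A \<subseteq> B" "C \<subseteq> B" "A \<inter> C = {}" "x \<in> span A" "x \<in> span C"
  shows "x = 0"
proof -
  have "representation B x = representation A x" "representation B x = representation C x"
    using assms representation_extend by blast+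
  then have "representation A x b = 0" for b
    using representation_ne_zero[of A x b] representation_ne_zero[of C x b] assms(4) by auto
  moreover have "(\<Sum>b | representation A x b \<noteq> 0. representation A x b *s b) = x"
    using assms independent_mono by (intro sum_nonzero_representation_eq) auto
  ultimately show ?thesis by simp
qed

end

context vector_space_pair
begin

lemma rank_nullity_fin_span:
  assumes f: "Vector_Spaces.linear s1 s2 f" and V: "vs1.subspace V" and fd: "fin_span s1 V"
  shows "vs1.dim V = vs2.dim (f ` V) + vs1.dim {v \<in> V. f v = 0}"
proof -
  let ?K = "{v \<in> V. f v = 0}"
  obtain B where B: "B \<subseteq> ?K" "vs1.independent B" "?K \<subseteq> vs1.span B" "card B = vs1.dim ?K"
    by (rule vs1.basis_exists)
  have BV: "B \<subseteq> V" using B(1) by blast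
  obtain B' where B': "B \<subseteq> B'" "B' \<subseteq> V" "vs1.independent B'" "V \<subseteq> vs1.span B'"
    by (rule vs1.maximal_independent_subset_extend[OF BV B(2)])
  have fB': "finite B'" using vs1.fin_span_independent[OF fd B'(2,3)] .
  have dV: "vs1.dim V = card B'" by (rule vs1.basis_card_eq_dim[OF B'(2,4,3), symmetric])
  have spanV: "vs1.span (B' - B) \<subseteq> V"
    by (rule vs1.span_minimal) (use B'(2) V in auto)
  have inj: "inj_on f (vs1.span (B' - B))"
  proof (rule inj_onI)
    fix x y assume x: "x \<in> vs1.span (B' - B)" "y \<in> vs1.span (B' - B)" "f x = f y"
    have xy: "x - y \<in> vs1.span (B' - B)" using x by (intro vs1.span_diff)
    have "f (x - y) = 0" using x(3) linear_diff[OF f] by simp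
    then have "x - y \<in> vs1.span B" using xy spanV B(3) by blast
    then have "x - y = 0"
      using vs1.independent_span_disjoint[OF B'(3) _ B'(1) _ xy] by blast
    then show "x = y" by simp
  qed
  have ind: "vs2.independent (f ` (B' - B))"
    using linear_independent_injective_image[OF f _ inj] vs1.independent_mono[OF B'(3)] by blast
  have sp: "f ` V \<subseteq> vs2.span (f ` (B' - B))"
  proof -
    have "f ` V \<subseteq> f ` vs1.span B'" using B'(4) by blast
    also have "\<dots> = vs2.span (f ` B')" using linear_span_image[OF f] by simp
    also have "\<dots> \<subseteq> vs2.span (f ` (B' - B))"
    proof (rule vs2.span_minimal)
      show "f ` B' \<subseteq> vs2.span (f ` (B' - B))"
      proof
        fix y assume "y \<in> f ` B'"
        then obtain b where b: "b \<in> B'" "y = f b" by blast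
        show "y \<in> vs2.span (f ` (B' - B))"
        proof (cases "b \<in> B")
          case True
          then have "y = 0" using b B(1) by blast
          then show ?thesis by (simp add: vs2.span_zero)
        next
          case False
          then show ?thesis using b by (intro vs2.span_base) auto
        qed
      qed
    qed auto
    finally show ?thesis .
  qed
  have "vs2.dim (f ` V) = card (f ` (B' - B))"
    by (rule vs2.basis_card_eq_dim[OF _ sp ind, symmetric]) (use B'(2) in auto)
  also have "\<dots> = card (B' - B)"
    by (rule card_image) (rule inj_on_subset[OF inj vs1.span_superset])
  also have "\<dots> = card B' - card B"
    by (rule card_Diff_subset) (use B'(1) fB' finite_subset in auto)
  finally show ?thesis using dV B(4) card_mono[OF fB' B'(1)] by linarith
qed

lemma fin_span_image:
  assumes f: "Vector_Spaces.linear s1 s2 f" and fd: "fin_span s1 V" shows "fin_span s2 (f ` V)"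
proof -
  obtain B where B: "finite B" "V \<subseteq> vs1.span B" using fd unfolding fin_span_def by blast
  have "f ` V \<subseteq> f ` vs1.span B" using B(2) by blast
  also have "\<dots> = vs2.span (f ` B)" using linear_span_image[OF f] by simp
  finally show ?thesis unfolding fin_span_def using B(1) by blast
qed

lemma dim_image_le_fin_span:
  assumes f: "Vector_Spaces.linear s1 s2 f" and V: "vs1.subspace V" and fd: "fin_span s1 V"
  shows "vs2.dim (f ` V) \<le> vs1.dim V"
  using rank_nullity_fin_span[OF assms] by simp

lemma dim_image_inj_fin_span:
  assumes f: "Vector_Spaces.linear s1 s2 f" and V: "vs1.subspace V" and fd: "fin_span s1 V"
    and inj: "\<And>v. v \<in> V \<Longrightarrow> f v = 0 \<Longrightarrow> v = 0"
  shows "vs2.dim (f ` V) = vs1.dim V"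
proof -
  have "{v \<in> V. f v = 0} = {0}"
    using inj vs1.subspace_0[OF V] linear_0[OF f] by auto
  moreover have "vs1.dim {0} = 0"
    using vs1.dim_le_card[of "{0}" "{}"] by simp
  ultimately show ?thesis using rank_nullity_fin_span[OF f V fd] by simp
qed

end

definition scale_prod :: "('k \<Rightarrow> 'a \<Rightarrow> 'a) \<Rightarrow> ('k \<Rightarrow> 'b \<Rightarrow> 'b) \<Rightarrow> 'k \<Rightarrow> 'a \<times> 'b \<Rightarrow> 'a \<times> 'b" where
  "scale_prod s1 s2 c x = (s1 c (fst x), s2 c (snd x))"

lemma vector_space_scale_prod:
  assumes "vector_space s1" "vector_space s2"
  shows "vector_space (scale_prod s1 s2)"
proof -
  interpret a: vector_space s1 by fact
  interpret b: vector_space s2 by fact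
  show ?thesis
    by unfold_locales
      (auto simp: scale_prod_def a.scale_right_distrib b.scale_right_distrib a.scale_left_distrib b.scale_left_distrib)
qed

lemma dim_Times:
  assumes "vector_space s1" "vector_space s2"
    and V: "module.subspace s1 V" "fin_span s1 V"
    and W: "module.subspace s2 W" "fin_span s2 W"
  shows "module.subspace (scale_prod s1 s2) (V \<times> W)"
    "fin_span (scale_prod s1 s2) (V \<times> W)"
    "vector_space.dim (scale_prod s1 s2) (V \<times> W) = vector_space.dim s1 V + vector_space.dim s2 W"
proof -
  interpret a: vector_space s1 by fact
  interpret b: vector_space s2 by fact
  interpret p: vector_space "scale_prod s1 s2" using assms by (intro vector_space_scale_prod)
  interpret pa: vector_space_pair "scale_prod s1 s2" s1 by unfold_locales
  interpret bp: vector_space_pair s2 "scale_prod s1 s2" by unfold_locales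
  interpret ap: vector_space_pair s1 "scale_prod s1 s2" by unfold_locales
  show sub: "p.subspace (V \<times> W)"
    using V(1) W(1)
    unfolding p.subspace_def a.subspace_def b.subspace_def scale_prod_def by (auto simp: zero_prod_def)
  have l1: "Vector_Spaces.linear s1 (scale_prod s1 s2) (\<lambda>x. (x, 0))"
    by unfold_locales (auto simp: scale_prod_def)
  have l2: "Vector_Spaces.linear s2 (scale_prod s1 s2) (\<lambda>x. (0, x))"
    by unfold_locales (auto simp: scale_prod_def)
  have l3: "Vector_Spaces.linear (scale_prod s1 s2) s1 fst"
    by unfold_locales (auto simp: scale_prod_def)
  have "fin_span (scale_prod s1 s2) ((\<lambda>x. (x, 0)) ` V)" by (rule ap.fin_span_image[OF l1 V(2)])
  then obtain A where A: "finite A" "(\<lambda>x. (x, 0)) ` V \<subseteq> p.span A" unfolding fin_span_def by blast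
  have "fin_span (scale_prod s1 s2) ((\<lambda>x. (0, x)) ` W)" by (rule bp.fin_span_image[OF l2 W(2)])
  then obtain B where B: "finite B" "(\<lambda>x. (0, x)) ` W \<subseteq> p.span B" unfolding fin_span_def by blast
  have "V \<times> W \<subseteq> p.span (A \<union> B)"
  proof
    fix x assume "x \<in> V \<times> W"
    then have "(fst x, 0) \<in> (\<lambda>x. (x, 0)) ` V" "(0, snd x) \<in> (\<lambda>x. (0, x)) ` W" by auto
    then have "(fst x, 0) \<in> p.span A" "(0, snd x) \<in> p.span B" using A(2) B(2) by blast+
    then have "(fst x, 0) \<in> p.span (A \<union> B)" "(0, snd x) \<in> p.span (A \<union> B)"
      using p.span_mono[of A "A \<union> B"] p.span_mono[of B "A \<union> B"] by blast+
    from p.span_add[OF this] show "x \<in> p.span (A \<union> B)" by simp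
  qed
  then show fd: "fin_span (scale_prod s1 s2) (V \<times> W)" unfolding fin_span_def using A B by blast
  have "p.dim (V \<times> W) = a.dim (fst ` (V \<times> W)) + p.dim {v \<in> V \<times> W. fst v = 0}"
    by (rule pa.rank_nullity_fin_span[OF l3 sub fd])
  also have "fst ` (V \<times> W) = V" using b.subspace_0[OF W(1)] by force
  also have "{v \<in> V \<times> W. fst v = 0} = (\<lambda>x. (0, x)) ` W" using a.subspace_0[OF V(1)] by auto
  also have "p.dim \<dots> = b.dim W"
    by (rule bp.dim_image_inj_fin_span[OF l2 W]) (simp add: zero_prod_def)
  finally show "p.dim (V \<times> W) = a.dim V + b.dim W" .
qed

interpretation mp: vector_space "pm_scale :: 'k::field \<Rightarrow> ('i \<Rightarrow>\<^sub>0 'k) \<Rightarrow> _"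
  by (rule vector_space_pm_scale)

interpretation mpp: vector_space_pair "pm_scale :: 'k::field \<Rightarrow> ('i \<Rightarrow>\<^sub>0 'k) \<Rightarrow> _" "pm_scale :: 'k::field \<Rightarrow> ('j \<Rightarrow>\<^sub>0 'k) \<Rightarrow> _"
  by unfold_locales

interpretation fld: vector_space "(*) :: 'k::field \<Rightarrow> 'k \<Rightarrow> 'k"
  by unfold_locales (auto simp: algebra_simps)

interpretation mpf: vector_space_pair "pm_scale :: 'k::field \<Rightarrow> ('i \<Rightarrow>\<^sub>0 'k) \<Rightarrow> _" "(*) :: 'k::field \<Rightarrow> 'k \<Rightarrow> 'k"
  by unfold_locales

definition mons :: "'n::finite set \<Rightarrow> nat \<Rightarrow> ('n \<Rightarrow>\<^sub>0 nat) set" where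
  "mons T t = {m. kys m \<subseteq> T \<and> mon_deg m = t}"

lemma lookup_le_mon_deg: "lkp m i \<le> mon_deg m"
  unfolding mon_deg_def by (rule member_le_sum) auto

lemma finite_mons [simp]: "finite (mons T t)"
proof -
  have "finite (PiE (UNIV :: 'a set) (\<lambda>_. {..t}))" by (rule finite_PiE) auto
  moreover have "lkp ` mons T t \<subseteq> PiE (UNIV :: 'a set) (\<lambda>_. {..t})"
    using lookup_le_mon_deg by (auto simp: mons_def)
  ultimately have "finite (lkp ` mons T t)" by (rule finite_subset[rotated])
  moreover have "inj_on lkp (mons T t)" by (auto intro!: inj_onI poly_mapping_eqI)
  ultimately show ?thesis by (rule finite_imageD)
qed

lemma forms_subspace: "mp.subspace (forms t)"
  unfolding mp.subspace_def by (auto simp: pm_scale_cst)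

lemma single_in_span:
  assumes "m \<in> M" shows "sng m c \<in> mp.span ((\<lambda>m. sng m 1) ` M)"
proof -
  have "sng m c = pm_scale c (sng m 1)"
    by (rule poly_mapping_eqI) (simp add: lookup_pm_scale lookup_single when_def)
  then show ?thesis using assms by (auto intro: mp.span_scale mp.span_base)
qed

lemma in_span_singles:
  assumes "kys f \<subseteq> M" shows "f \<in> mp.span ((\<lambda>m. sng m 1) ` M)"
proof -
  have "(\<Sum>m\<in>kys f. sng m (lkp f m)) \<in> mp.span ((\<lambda>m. sng m 1) ` M)"
    by (rule mp.span_sum, rule single_in_span) (use assms in auto)
  then show ?thesis by (simp flip: pm_sum_single)
qed

lemma fin_span_keys:
  assumes "finite M" "\<And>f. f \<in> V \<Longrightarrow> kys f \<subseteq> M" shows "fin_span pm_scale V"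
  unfolding fin_span_def
proof (intro exI[of _ "(\<lambda>m. sng m 1) ` M"] conjI subsetI)
  show "f \<in> mp.span ((\<lambda>m. sng m 1) ` M)" if "f \<in> V" for f
    by (rule in_span_singles[OF assms(2)[OF that]])
qed (use assms(1) in auto)

lemma forms_keys: "f \<in> forms t \<longleftrightarrow> kys f \<subseteq> mons UNIV t"
  by (auto simp: forms_def mons_def)

lemma fin_span_forms [simp]: "fin_span pm_scale (forms t)"
  by (rule fin_span_keys[of "mons UNIV t"]) (auto simp: forms_keys)

lemma fin_span_Int_forms [simp]: "fin_span pm_scale (I \<inter> forms t)"
  using mp.fin_span_mono[OF fin_span_forms] by blast

section \<open>Leading monomials\<close>

definition var_index :: "'n::finite \<Rightarrow> nat" where "var_index = (SOME f. inj f)"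

lemma inj_var_index: "inj (var_index :: 'n::finite \<Rightarrow> nat)"
  unfolding var_index_def
  using finite_imp_inj_to_nat_seg[of "UNIV :: 'n set"] by (metis finite someI_ex)

text \<open>Transports the lexicographic order of \<open>nat \<Rightarrow>\<^sub>0 nat\<close> to monomials.\<close>

definition mkey :: "('n::finite \<Rightarrow>\<^sub>0 nat) \<Rightarrow> (nat \<Rightarrow>\<^sub>0 nat)" where
  "mkey m = (\<Sum>i\<in>UNIV. sng (var_index i) (lkp m i))"

lemma mkey_add: "mkey (m + m') = mkey m + mkey m'"
  by (simp add: mkey_def lookup_add single_add sum.distrib)

lemma lookup_mkey: "lkp (mkey m) (var_index i) = lkp m i"
proof -
  have "lkp (mkey m) (var_index i) = (\<Sum>j\<in>UNIV. if j = i then lkp m i else 0)"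
    unfolding mkey_def lookup_sum
    by (rule sum.cong) (auto simp: lookup_single when_def inj_eq[OF inj_var_index])
  then show ?thesis by simp
qed

lemma inj_mkey: "inj mkey"
  by (rule injI, rule poly_mapping_eqI) (metis lookup_mkey)

lemma ex_max_image:
  fixes f :: "'a \<Rightarrow> 'b::linorder"
  assumes "finite S" "S \<noteq> {}" shows "\<exists>m\<in>S. \<forall>m'\<in>S. f m' \<le> f m"
proof -
  have "Max (f ` S) \<in> f ` S" using assms by (intro Max_in) auto
  then obtain m where m: "m \<in> S" "f m = Max (f ` S)" by auto
  have "f m' \<le> f m" if "m' \<in> S" for m' unfolding m(2) using assms(1) that by (intro Max_ge) auto
  then show ?thesis using m(1) by blast
qed

definition lead_mon :: "('n::finite, 'k::field) mpoly \<Rightarrow> ('n \<Rightarrow>\<^sub>0 nat)" where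
  "lead_mon f = (SOME m. m \<in> kys f \<and> (\<forall>m'\<in>kys f. mkey m' \<le> mkey m))"

lemma lead_mon_works:
  assumes "f \<noteq> 0"
  shows "lead_mon f \<in> kys f" "m \<in> kys f \<Longrightarrow> mkey m \<le> mkey (lead_mon f)"
proof -
  have "\<exists>m. m \<in> kys f \<and> (\<forall>m'\<in>kys f. mkey m' \<le> mkey m)"
    using ex_max_image[of "kys f" mkey] assms by auto
  from someI_ex[OF this] show "lead_mon f \<in> kys f" "m \<in> kys f \<Longrightarrow> mkey m \<le> mkey (lead_mon f)"
    unfolding lead_mon_def[symmetric] by auto
qed

lemma lead_mon_eqI:
  assumes "m \<in> kys f" "\<And>m'. m' \<in> kys f \<Longrightarrow> mkey m' \<le> mkey m" shows "lead_mon f = m"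
proof -
  have "f \<noteq> 0" using assms(1) by auto
  from lead_mon_works[OF this] assms have "mkey (lead_mon f) = mkey m" by (metis antisym)
  then show ?thesis by (rule injD[OF inj_mkey])
qed

text \<open>Let \<mu> be the largest leading monomial. Reading the coefficient at \<mu> is a nonzero
  functional on \<open>V\<close>, and its kernel has exactly the other leading monomials.\<close>

lemma dim_eq_card_lead_mon:
  fixes V :: "('n::finite, 'k::field) mpoly set"
  assumes "mp.subspace V" "finite M" "\<And>f. f \<in> V \<Longrightarrow> kys f \<subseteq> M"
  shows "mp.dim V = card {lead_mon f | f. f \<in> V \<and> f \<noteq> 0}"
  using assms(1,3)
proof (induction "card {lead_mon f | f. f \<in> V \<and> f \<noteq> 0}" arbitrary: V rule: less_induct)
  case less
  let ?L = "{lead_mon f | f. f \<in> V \<and> f \<noteq> 0}"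
  have "?L \<subseteq> M" using less.prems(2) lead_mon_works(1) by blast
  then have fin: "finite ?L" using assms(2) finite_subset by blast
  show ?case
  proof (cases "?L = {}")
    case True
    then have "V \<subseteq> {0}" by blast
    then have "mp.dim V = 0" using mp.dim_le_card[of V "{}"] by simp
    then show ?thesis unfolding True by simp
  next
    case False
    obtain \<mu> where \<mu>: "\<mu> \<in> ?L" and max': "\<forall>m\<in>?L. mkey m \<le> mkey \<mu>"
      by (rule bexE[OF ex_max_image[OF fin False, of mkey]])
    note max = max'[rule_format]
    define V' where "V' = {f \<in> V. lkp f \<mu> = 0}"
    have lin: "Vector_Spaces.linear pm_scale (*) (\<lambda>f :: ('n, 'k) mpoly. lkp f \<mu>)"
      by unfold_locales (auto simp: lookup_add lookup_pm_scale)
    have fd: "fin_span pm_scale V" using fin_span_keys[OF assms(2) less.prems(2)] .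
    have rn: "mp.dim V = fld.dim ((\<lambda>f. lkp f \<mu>) ` V) + mp.dim V'"
      unfolding V'_def by (rule mpf.rank_nullity_fin_span[OF lin less.prems(1) fd])
    obtain f0 where f0: "f0 \<in> V" "f0 \<noteq> 0" "lead_mon f0 = \<mu>" using \<mu> by fast
    have f0m: "lkp f0 \<mu> \<noteq> 0" using lead_mon_works(1)[OF f0(2)] f0(3) by (simp add: in_keys_iff)
    have "(\<lambda>f. lkp f \<mu>) ` V = UNIV"
    proof (rule UNIV_eq_I[symmetric])
      show "c \<in> (\<lambda>f. lkp f \<mu>) ` V" for c
      proof (rule image_eqI)
        show "pm_scale (c / lkp f0 \<mu>) f0 \<in> V" using less.prems(1) f0(1) by (rule mp.subspace_scale)
        show "c = lkp (pm_scale (c / lkp f0 \<mu>) f0) \<mu>" using f0m by (simp add: lookup_pm_scale)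
      qed
    qed
    moreover have "fld.dim (UNIV :: 'k set) = 1"
    proof -
      have "UNIV \<subseteq> fld.span {1 :: 'k}" unfolding fld.span_singleton by simp
      then show ?thesis using fld.dim_unique[of "{1}" UNIV 1] by simp
    qed
    moreover have L': "{lead_mon f | f. f \<in> V' \<and> f \<noteq> 0} = ?L - {\<mu>}"
    proof (intro set_eqI iffI)
      fix m assume "m \<in> {lead_mon f | f. f \<in> V' \<and> f \<noteq> 0}"
      then obtain f where f: "f \<in> V'" "f \<noteq> 0" "m = lead_mon f" by blast
      then have "lead_mon f \<noteq> \<mu>" using lead_mon_works(1)[OF f(2)] by (auto simp: V'_def in_keys_iff)
      then show "m \<in> ?L - {\<mu>}" using f by (auto simp: V'_def)
    next
      fix m assume m: "m \<in> ?L - {\<mu>}"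
      then obtain f where f: "f \<in> V" "f \<noteq> 0" "m = lead_mon f" by blast
      have "lkp f \<mu> = 0"
      proof (rule ccontr)
        assume "lkp f \<mu> \<noteq> 0"
        then have "mkey \<mu> \<le> mkey (lead_mon f)" using lead_mon_works(2)[OF f(2)] by (simp add: in_keys_iff)
        moreover have "mkey (lead_mon f) \<le> mkey \<mu>" using max f by blast
        ultimately have "lead_mon f = \<mu>" by (intro injD[OF inj_mkey]) simp
        then show False using m f by blast
      qed
      then show "m \<in> {lead_mon f | f. f \<in> V' \<and> f \<noteq> 0}" using f by (auto simp: V'_def)
    qed
    moreover have "mp.dim V' = card {lead_mon f | f. f \<in> V' \<and> f \<noteq> 0}"
    proof (rule less.hyps)
      show "card {lead_mon f | f. f \<in> V' \<and> f \<noteq> 0} < card ?L"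
        unfolding L' using fin \<mu> by (rule card_Diff1_less)
      show "mp.subspace V'" using less.prems(1)
        unfolding V'_def mp.subspace_def by (auto simp: lookup_add lookup_pm_scale)
      show "kys f \<subseteq> M" if "f \<in> V'" for f using that less.prems(2) by (simp add: V'_def)
    qed
    ultimately have "mp.dim V = 1 + card (?L - {\<mu>})" using rn by simp
    then show ?thesis using card_Suc_Diff1[OF fin \<mu>] by simp
  qed
qed

lemma lead_mon_single: "c \<noteq> 0 \<Longrightarrow> lead_mon (sng m c) = m"
  by (rule lead_mon_eqI) auto

lemma dim_keys_subset:
  assumes "finite M" shows "mp.dim {f :: ('n::finite, 'k::field) mpoly. kys f \<subseteq> M} = card M"
proof -
  let ?V = "{f :: ('n, 'k) mpoly. kys f \<subseteq> M}"
  have "mp.subspace ?V" unfolding mp.subspace_def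
    by (auto simp: in_keys_iff lookup_add lookup_pm_scale subset_iff) (metis add_0_left)
  then have "mp.dim ?V = card {lead_mon f | f. f \<in> ?V \<and> f \<noteq> 0}"
    by (rule dim_eq_card_lead_mon[OF _ assms]) auto
  also have "{lead_mon f | f. f \<in> ?V \<and> f \<noteq> 0} = M"
  proof (intro set_eqI iffI)
    fix m assume "m \<in> M"
    moreover have "lead_mon (sng m 1 :: ('n, 'k) mpoly) = m" by (simp add: lead_mon_single)
    ultimately show "m \<in> {lead_mon f | f. f \<in> ?V \<and> f \<noteq> 0}"
      by (intro CollectI exI[of _ "sng m 1"]) (auto, metis lookup_single_eq lookup_zero zero_neq_one)
  qed (use lead_mon_works(1) in blast)
  finally show ?thesis .
qed

lemma dim_forms: "mp.dim (forms t :: ('n::finite, 'k::field) mpoly set) = card (mons (UNIV :: 'n set) t)"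
proof -
  have "(forms t :: ('n, 'k) mpoly set) = {f. kys f \<subseteq> mons UNIV t}" by (auto simp: forms_keys)
  then show ?thesis using dim_keys_subset[of "mons (UNIV :: 'n set) t"] by simp
qed

text \<open>Deleting the terms in \<open>M\<close> is injective on \<open>C\<close>, which thus
  embeds into the span of the remaining monomials. Read backwards, a large \<open>C\<close> contains
  a nonzero element supported on \<open>M\<close>; both directions are used.\<close>

lemma dim_disjoint_monomials:
  fixes C :: "('n::finite, 'k::field) mpoly set"
  assumes C: "mp.subspace C" "C \<subseteq> forms t" and M: "M \<subseteq> mons UNIV t"
    and disj: "\<And>f. f \<in> C \<Longrightarrow> kys f \<subseteq> M \<Longrightarrow> f = 0"
  shows "mp.dim C + card M \<le> card (mons (UNIV :: 'n set) t)"
proof -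
  define \<pi> :: "('n, 'k) mpoly \<Rightarrow> ('n, 'k) mpoly" where
    "\<pi> = additive_ext (\<lambda>m c. if m \<in> M then 0 else sng m c)"
  have lk: "lkp (\<pi> f) m = (if m \<in> M then 0 else lkp f m)" for f m
  proof (induction f rule: pm_induct)
    case (single m' c)
    then show ?case unfolding \<pi>_def by (subst additive_ext_single) (auto simp: lookup_single when_def)
  next
    case (add f g)
    have "\<pi> (f + g) = \<pi> f + \<pi> g" unfolding \<pi>_def by (rule additive_ext_add) (auto simp: single_add)
    then show ?case using add by (auto simp: lookup_add)
  qed
  have lin: "Vector_Spaces.linear pm_scale pm_scale \<pi>"
    by unfold_locales (auto intro!: poly_mapping_eqI simp: lk lookup_add lookup_pm_scale)
  have "mp.dim C = mp.dim (\<pi> ` C)"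
  proof (rule mpp.dim_image_inj_fin_span[symmetric, OF lin C(1)])
    show "fin_span pm_scale C" using mp.fin_span_mono[OF fin_span_forms C(2)] .
    fix v assume v: "v \<in> C" "\<pi> v = 0"
    then have "kys v \<subseteq> M" using lk[of v] by (auto simp: in_keys_iff split: if_splits) (metis)
    then show "v = 0" using disj v by blast
  qed
  also have "\<dots> \<le> mp.dim {f :: ('n, 'k) mpoly. kys f \<subseteq> mons UNIV t - M}"
  proof (rule mp.dim_mono_fin_span)
    show "fin_span pm_scale {f :: ('n, 'k) mpoly. kys f \<subseteq> mons UNIV t - M}"
      by (rule fin_span_keys[of "mons UNIV t - M"]) auto
    show "\<pi> ` C \<subseteq> {f. kys f \<subseteq> mons UNIV t - M}"
    proof (rule subsetI, elim imageE, rule CollectI, rule subsetI)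
      fix x f m assume h: "x = \<pi> f" "f \<in> C" "m \<in> kys x"
      then have "m \<notin> M" "m \<in> kys f" using lk[of f m] by (auto simp: in_keys_iff split: if_splits)
      then show "m \<in> mons UNIV t - M" using C(2) h(2) forms_keys by blast
    qed
  qed
  also have "\<dots> = card (mons UNIV t - M)" by (rule dim_keys_subset) simp
  also have "\<dots> = card (mons (UNIV :: 'n set) t) - card M"
    by (rule card_Diff_subset[OF finite_subset[OF M finite_mons] M])
  finally show ?thesis using card_mono[OF finite_mons M] by linarith
qed

section \<open>Hilbert functions\<close>

lemma ideal_forms_subspace: "is_ideal I \<Longrightarrow> mp.subspace (I \<inter> forms t)"
  unfolding is_ideal_iff mp.subspace_def by (auto simp: pm_scale_cst)

text \<open>Slices by the exponent of \<open>x\<close>. The predicate lets one lemma count all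
  monomials, those outside a monomial ideal, and those with a bounded exponent.\<close>

lemma card_mons_slices:
  assumes "x \<notin> T"
  shows "card {m \<in> mons (insert x T) t. P m} = (\<Sum>j\<le>t. card {m \<in> mons T (t - j). P (m + sng x j)})"
proof -
  define A where "A j = (\<lambda>m. m + sng x j) ` {m \<in> mons T (t - j). P (m + sng x j)}" for j
  have x0: "lkp m x = 0" if "kys m \<subseteq> T" for m :: "'a \<Rightarrow>\<^sub>0 nat"
    using that assms by (auto simp: in_keys_iff subset_iff)
  have "{m \<in> mons (insert x T) t. P m} = (\<Union>j\<in>{..t}. A j)"
  proof (intro set_eqI iffI)
    fix m assume m: "m \<in> {m \<in> mons (insert x T) t. P m}"
    define m' where "m' = m - sng x (lkp m x)"
    have mm: "m = m' + sng x (lkp m x)"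
      by (rule poly_mapping_eqI) (auto simp: m'_def lookup_add lookup_minus lookup_single when_def)
    have "kys m' \<subseteq> T"
    proof
      fix i assume "i \<in> kys m'"
      then have "lkp m i \<noteq> 0" "i \<noteq> x" by (auto simp: m'_def in_keys_iff lookup_minus lookup_single when_def split: if_splits)
      moreover have "kys m \<subseteq> insert x T" using m by (simp add: mons_def)
      ultimately show "i \<in> T" using subsetD[of "kys m" "insert x T" i] by (simp add: in_keys_iff)
    qed
    moreover have d: "mon_deg m' + lkp m x = t"
      using m mm by (metis (mono_tags, lifting) mem_Collect_eq mon_deg_add mon_deg_single mons_def)
    ultimately have "m' \<in> mons T (t - lkp m x)" by (auto simp: mons_def)
    then have "m \<in> A (lkp m x)" unfolding A_def using m mm by (intro image_eqI[of _ _ m']) auto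
    then show "m \<in> (\<Union>j\<in>{..t}. A j)" using d by auto
  next
    fix m assume "m \<in> (\<Union>j\<in>{..t}. A j)"
    then obtain j m' where j: "j \<le> t" "m = m' + sng x j" "m' \<in> mons T (t - j)" "P m" unfolding A_def by auto
    have "kys m \<subseteq> insert x T"
      using j(3) keys_add[of m' "sng x j"] unfolding j(2) mons_def by (auto split: if_splits)
    then show "m \<in> {m \<in> mons (insert x T) t. P m}" using j by (auto simp: mons_def mon_deg_add)
  qed
  moreover have "card (\<Union>j\<in>{..t}. A j) = (\<Sum>j\<le>t. card (A j))"
  proof (rule card_UN_disjoint)
    show "\<forall>i\<in>{..t}. finite (A i)" unfolding A_def by auto
    have "lkp m x = j" if "m \<in> A j" for m j
      using that x0 unfolding A_def mons_def by (auto simp: lookup_add)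
    then show "\<forall>i\<in>{..t}. \<forall>j\<in>{..t}. i \<noteq> j \<longrightarrow> A i \<inter> A j = {}" by blast
  qed simp
  moreover have "card (A j) = card {m \<in> mons T (t - j). P (m + sng x j)}" for j
    unfolding A_def by (rule card_image) (auto intro!: inj_onI)
  ultimately show ?thesis by simp
qed

text \<open>The Hilbert function of a polynomial ring in \<open>N + 1\<close> variables. With
  \<open>N + 3\<close> variables in total, \<open>bin (N + 2)\<close> belongs to the whole ring and
  \<open>bin N\<close> to codimension two.\<close>

definition bin :: "nat \<Rightarrow> nat \<Rightarrow> nat" where "bin N t = (t + N) choose N"

lemma bin_Suc: "bin (Suc N) (Suc t) = bin (Suc N) t + bin N (Suc t)"
  by (simp add: bin_def)
lemma bin_0 [simp]: "bin 0 t = 1" "bin N 0 = 1"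
  by (auto simp: bin_def)

lemma sum_bin: "(\<Sum>j\<le>t. bin N (t - j)) = bin (Suc N) t"
proof -
  have "(\<Sum>j\<le>t. bin N (t - j)) = (\<Sum>j\<le>t. bin N j)"
    by (rule sum.reindex_bij_witness[of _ "\<lambda>j. t - j" "\<lambda>j. t - j"]) auto
  also have "\<dots> = bin (Suc N) t" by (induction t) (auto simp: bin_Suc)
  finally show ?thesis .
qed

lemma card_mons: "card T = Suc N \<Longrightarrow> card (mons T t) = bin N t"
proof (induction N arbitrary: T t)
  case 0
  then obtain x where T: "T = {x}" by (metis card_1_singletonE One_nat_def)
  have "mons T t = {sng x t}"
  proof (intro set_eqI iffI)
    fix m assume m: "m \<in> mons T t"
    have z: "lkp m i = 0" if "i \<noteq> x" for i using m that unfolding T mons_def by (auto simp: in_keys_iff subset_iff)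
    have "mon_deg m = (\<Sum>i\<in>UNIV. if i = x then lkp m x else 0)"
      unfolding mon_deg_def by (rule sum.cong) (auto simp: z)
    then have "lkp m x = t" using m by (simp add: mons_def)
    then have "m = sng x t" by (intro poly_mapping_eqI) (auto simp: lookup_single when_def z)
    then show "m \<in> {sng x t}" by simp
  qed (auto simp: T mons_def)
  then show ?case by simp
next
  case (Suc N)
  then obtain x T' where T: "T = insert x T'" "x \<notin> T'" "card T' = Suc N"
    by (metis card_Suc_eq)
  have "card (mons T t) = card {m \<in> mons (insert x T') t. True}" by (simp add: T(1))
  also have "\<dots> = (\<Sum>j\<le>t. card (mons T' (t - j)))"
    using card_mons_slices[OF T(2), of t "\<lambda>_. True"] by simp
  also have "\<dots> = bin (Suc N) t" using Suc.IH[OF T(3)] sum_bin by simp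
  finally show ?case .
qed

section \<open>Functions that eventually agree with a polynomial\<close>

definition eventually_poly :: "(nat \<Rightarrow> nat) \<Rightarrow> bool" where
  "eventually_poly g \<longleftrightarrow> (\<exists>p :: rat poly. \<forall>\<^sub>F t in sequentially. poly p (of_nat t) = of_nat (g t))"

lemma eventually_poly_const: "eventually_poly (\<lambda>_. c)"
  unfolding eventually_poly_def by (intro exI[of _ "[:of_nat c:]"]) simp

lemma eventually_poly_add: "eventually_poly f \<Longrightarrow> eventually_poly g \<Longrightarrow> eventually_poly (\<lambda>t. f t + g t)"
proof -
  assume "eventually_poly f" "eventually_poly g"
  then obtain p q :: "rat poly" where
    "\<forall>\<^sub>F t in sequentially. poly p (of_nat t) = of_nat (f t)"
    "\<forall>\<^sub>F t in sequentially. poly q (of_nat t) = of_nat (g t)" unfolding eventually_poly_def by blast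
  then have "\<forall>\<^sub>F t in sequentially. poly (p + q) (of_nat t) = of_nat (f t + g t)"
    by eventually_elim simp
  then show ?thesis unfolding eventually_poly_def by blast
qed

lemma eventually_poly_sum: "(\<And>i. i \<in> A \<Longrightarrow> eventually_poly (f i)) \<Longrightarrow> eventually_poly (\<lambda>t. \<Sum>i\<in>A. f i t)"
  by (induction A rule: infinite_finite_induct) (auto intro: eventually_poly_add eventually_poly_const)

lemma eventually_poly_cong: "eventually_poly f \<Longrightarrow> \<forall>\<^sub>F t in sequentially. f t = g t \<Longrightarrow> eventually_poly g"
  unfolding eventually_poly_def by (elim exE, rule exI, erule (1) eventually_elim2) simp

lemma eventually_poly_shift: assumes "eventually_poly f" shows "eventually_poly (\<lambda>t. f (t - j))"
proof -
  obtain p :: "rat poly" where p: "\<forall>\<^sub>F t in sequentially. poly p (of_nat t) = of_nat (f t)"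
    using assms unfolding eventually_poly_def by blast
  have "filterlim (\<lambda>t. t - j) sequentially sequentially" by (rule filterlim_minus_const_nat_at_top)
  then have "\<forall>\<^sub>F t in sequentially. poly p (of_nat (t - j)) = of_nat (f (t - j))"
    using p by (rule eventually_compose_filterlim[rotated])
  moreover have "\<forall>\<^sub>F t in sequentially. t \<ge> j" by (rule eventually_ge_at_top)
  ultimately have "\<forall>\<^sub>F t in sequentially. poly (pcompose p [:- of_nat j, 1:]) (of_nat t) = of_nat (f (t - j))"
    by eventually_elim (simp add: poly_pcompose of_nat_diff)
  then show ?thesis unfolding eventually_poly_def by blast
qed

lemma antidifference: "\<exists>S :: rat poly. \<forall>x. poly S (x + 1) - poly S x = poly p x"
proof (induction "degree p" arbitrary: p rule: less_induct)
  case less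
  show ?case
  proof (cases "p = 0")
    case True
    then show ?thesis by (intro exI[of _ 0]) simp
  next
    case False
    define n where "n = degree p"
    \<comment> \<open>Chosen so that the difference of \<open>monom c (Suc n)\<close> has the
      leading coefficient of \<open>p\<close>; subtracting it lowers the degree.\<close>
    define c where "c = lead_coeff p / of_nat (Suc n)"
    define m where "m = Suc n"
    define D where "D = pcompose (monom c m) [:1, 1:] - monom c m"
    have D: "poly D x = c * (x + 1) ^ m - c * x ^ m" for x
      by (simp add: D_def poly_pcompose poly_monom add.commute)
    have Deq: "D = smult c ([:1, 1:] ^ m - monom 1 m)"
      by (rule poly_eq_poly_eq_iff[THEN iffD1], rule ext)
        (simp add: D poly_monom right_diff_distrib add.commute)
    have coeffs: "coeff ([:1, 1:] ^ m :: rat poly) i = of_nat (m choose i)" for i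
    proof (cases "i \<le> m")
      case True
      then show ?thesis using coeff_linear_poly_power[of i m 1 1] by simp
    next
      case False
      have "degree ([:1, 1:] ^ m :: rat poly) \<le> m"
        by (rule order.trans[OF degree_power_le]) simp
      then show ?thesis using False by (simp add: coeff_eq_0)
    qed
    have Dc: "coeff D i = c * (of_nat (m choose i) - (if i = m then 1 else 0))" for i
      unfolding Deq by (simp add: coeffs)
    have dz: "coeff (p - D) i = 0" if "i \<ge> n" for i
    proof (cases "i = n")
      case True
      then show ?thesis by (simp add: Dc c_def n_def m_def del: of_nat_Suc)
    next
      case False
      then have "i > n" using that by simp
      then show ?thesis by (cases "i = m") (auto simp: Dc m_def n_def coeff_eq_0)
    qed
    have "\<exists>S :: rat poly. \<forall>x. poly S (x + 1) - poly S x = poly (p - D) x"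
    proof (cases "p - D = 0")
      case True
      then show ?thesis by (intro exI[of _ 0]) simp
    next
      case False
      then have "coeff (p - D) (degree (p - D)) \<noteq> 0" by (rule leading_coeff_neq_0)
      then have "degree (p - D) < degree p" using dz unfolding n_def by (meson not_le)
      then show ?thesis by (rule less)
    qed
    then obtain S where S: "\<And>x. poly S (x + 1) - poly S x = poly (p - D) x" by blast
    have "poly (S + monom c m) (x + 1) - poly (S + monom c m) x = poly p x" for x
      using S[of x] by (simp add: poly_monom D algebra_simps)
    then show ?thesis by blast
  qed
qed

lemma eventually_poly_partial_sums: assumes "eventually_poly g" shows "eventually_poly (\<lambda>s. \<Sum>i\<le>s. g i)"
proof -
  obtain p :: "rat poly" where "\<forall>\<^sub>F t in sequentially. poly p (of_nat t) = of_nat (g t)"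
    using assms unfolding eventually_poly_def by blast
  then obtain t0 where t0: "\<And>t. t \<ge> t0 \<Longrightarrow> poly p (of_nat t) = of_nat (g t)"
    unfolding eventually_sequentially by blast
  obtain S :: "rat poly" where S: "\<And>x. poly S (x + 1) - poly S x = poly p x"
    using antidifference[of p] by blast
  \<comment> \<open>The shift by one accounts for the inclusive upper limit: the step of
    \<open>S'\<close> from \<open>t\<close> to \<open>t + 1\<close> has to be
    \<open>g (t + 1)\<close>.\<close>
  define S' where "S' = pcompose S [:1, 1:]"
  have S': "poly S' (of_nat t) = poly S (of_nat t + 1)" for t
    by (simp add: S'_def poly_pcompose add.commute)
  define C where "C = of_nat (\<Sum>i\<le>t0. g i) - poly S' (of_nat t0)"
  have "of_nat (\<Sum>i\<le>t0 + k. g i) = poly (S' + [:C:]) (of_nat (t0 + k))" for k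
  proof (induction k)
    case 0
    then show ?case by (simp add: C_def)
  next
    case (Suc k)
    have "poly S' (of_nat (Suc (t0 + k))) - poly S' (of_nat (t0 + k)) = of_nat (g (Suc (t0 + k)))"
      unfolding S' using S[of "of_nat (t0 + k) + 1"] t0[of "Suc (t0 + k)"] by (simp add: algebra_simps)
    then show ?case using Suc by simp
  qed
  then have "\<forall>t\<ge>t0. poly (S' + [:C:]) (of_nat t) = of_nat (\<Sum>i\<le>t. g i)"
    by (metis le_add_diff_inverse)
  then show ?thesis unfolding eventually_poly_def eventually_sequentially by blast
qed

section \<open>Dickson's lemma and monomial ideals\<close>

lemma nondecreasing_subseq:
  fixes s :: "nat \<Rightarrow> nat"
  shows "\<exists>r :: nat \<Rightarrow> nat. strict_mono r \<and> mono (\<lambda>k. s (r k))"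
proof -
  \<comment> \<open>A position beyond \<open>a\<close> at which \<open>s\<close> is least among all
    later positions; iterating, the values cannot decrease.\<close>
  define nxt where "nxt a = arg_min s (\<lambda>j. j > a)" for a
  have n1: "nxt a > a" for a unfolding nxt_def by (rule arg_min_natI[of _ "Suc a"]) simp
  have n2: "s (nxt a) \<le> s j" if "j > a" for a j unfolding nxt_def by (rule arg_min_nat_le) (rule that)
  define r where "r = rec_nat (nxt 0) (\<lambda>_. nxt)"
  have r: "r (Suc k) = nxt (r k)" for k by (simp add: r_def)
  have sm: "strict_mono r" by (rule strict_mono_Suc_iff[THEN iffD2]) (simp add: r n1)
  have "s (r k) \<le> s (r (Suc k))" for k
  proof (cases k)
    case 0
    have "r 0 = nxt 0" by (simp add: r_def)
    then show ?thesis using n2[of 0 "r (Suc k)"] n1 0 r by (metis less_trans)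
  next
    case (Suc l)
    have "r (Suc k) > r l" using sm Suc by (simp add: strict_mono_def)
    then show ?thesis using n2[of "r l" "r (Suc k)"] unfolding Suc r by simp
  qed
  then have "mono (\<lambda>k. s (r k))" by (simp add: mono_iff_le_Suc)
  then show ?thesis using sm by blast
qed

lemma dickson_subseq:
  fixes s :: "nat \<Rightarrow> 'i \<Rightarrow> nat"
  assumes "finite A" shows "\<exists>r :: nat \<Rightarrow> nat. strict_mono r \<and> (\<forall>i\<in>A. mono (\<lambda>k. s (r k) i))"
  using assms
proof (induction A)
  case empty
  show ?case by (intro exI[of _ id]) (simp add: strict_mono_def)
next
  case (insert a A)
  then obtain r :: "nat \<Rightarrow> nat" where r: "strict_mono r" "\<forall>i\<in>A. mono (\<lambda>k. s (r k) i)" by blast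
  obtain q :: "nat \<Rightarrow> nat" where q: "strict_mono q" "mono (\<lambda>k. s (r (q k)) a)"
    using nondecreasing_subseq[of "\<lambda>k. s (r k) a"] by blast
  have "strict_mono (\<lambda>k. r (q k))" using r(1) q(1) by (simp add: strict_mono_def)
  moreover have "mono (\<lambda>k. s (r (q k)) i)" if "i \<in> A" for i
    using r(2) that strict_mono_mono[OF q(1)] by (auto simp: mono_def)
  ultimately show ?case using q(2) by (intro exI[of _ "\<lambda>k. r (q k)"]) auto
qed

text \<open>The exponent sets of monomial ideals.\<close>

definition up_closed :: "('n \<Rightarrow>\<^sub>0 nat) set \<Rightarrow> bool" where
  "up_closed U \<longleftrightarrow> (\<forall>m\<in>U. \<forall>c. m + c \<in> U)"

text \<open>Otherwise monomials keep entering the chain. By Dickson's lemma an earlier one divides a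
  later one, which therefore belonged to the chain before the stage at which it was chosen as
  new.\<close>

lemma up_closed_chain:
  fixes U :: "nat \<Rightarrow> ('n::finite \<Rightarrow>\<^sub>0 nat) set"
  assumes up: "\<And>j. up_closed (U j)" and mn: "\<And>j. U j \<subseteq> U (Suc j)"
  shows "\<exists>j0. \<forall>j\<ge>j0. U j = U j0"
proof (rule ccontr)
  assume "\<not> ?thesis"
  then have ex: "\<exists>j\<ge>j0. U j \<noteq> U j0" for j0 by blast
  have mono: "U i \<subseteq> U j" if "i \<le> j" for i j using mn that by (rule lift_Suc_mono_le)
  have "\<exists>j m. j > j0 \<and> m \<in> U j \<and> m \<notin> U j0" for j0
  proof -
    obtain j where j: "j \<ge> j0" "U j \<noteq> U j0" using ex by blast
    then have "U j0 \<subset> U j" using mono by blast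
    then obtain m where "m \<in> U j" "m \<notin> U j0" by blast
    moreover have "j > j0" using j by (cases "j = j0") auto
    ultimately show ?thesis by blast
  qed
  then obtain J M where JM: "\<And>j. J j > j" "\<And>j. M j \<in> U (J j)" "\<And>j. M j \<notin> U j" by metis
  define idx where "idx k = (J ^^ k) 0" for k
  have idx: "idx (Suc k) = J (idx k)" for k by (simp add: idx_def)
  have im: "strict_mono idx" by (rule strict_mono_Suc_iff[THEN iffD2]) (simp add: idx JM(1))
  obtain r :: "nat \<Rightarrow> nat" where r: "strict_mono r" "\<And>i. mono (\<lambda>k. lkp (M (idx (r k))) i)"
    using dickson_subseq[of "UNIV :: 'n set" "\<lambda>k. lkp (M (idx k))"] by auto
  define a where "a = M (idx (r 0))"
  define b where "b = M (idx (r 1))"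
  have le: "lkp a i \<le> lkp b i" for i using r(2)[of i] by (simp add: mono_def a_def b_def)
  have ba: "b = a + (b - a)"
    by (rule poly_mapping_eqI) (simp add: lookup_add lookup_minus le)
  have "a \<in> U (idx (Suc (r 0)))" unfolding a_def idx by (rule JM(2))
  moreover have "idx (Suc (r 0)) \<le> idx (r 1)"
    using strict_monoD[OF r(1), of 0 1] strict_mono_mono[OF im] by (simp add: mono_def)
  ultimately have "a \<in> U (idx (r 1))" using mono by blast
  then have "a + (b - a) \<in> U (idx (r 1))" using up by (simp add: up_closed_def)
  then have "b \<in> U (idx (r 1))" using ba by simp
  then show False using JM(3) by (simp add: b_def)
qed

text \<open>The slices by the exponent of \<open>x\<close> are monomial ideals in the other
  variables and form an ascending chain. Once it is stationary, the count is a partial sum of one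
  function that is eventually polynomial, plus finitely many shifted ones.\<close>

lemma eventually_poly_complement_up_closed:
  fixes U :: "('n::finite \<Rightarrow>\<^sub>0 nat) set"
  assumes "finite T" "up_closed U"
  shows "eventually_poly (\<lambda>t. card {m \<in> mons T t. m \<notin> U})"
  using assms
proof (induction T arbitrary: U)
  case empty
  have "\<forall>\<^sub>F t in sequentially. 0 = card {m \<in> mons {} t. m \<notin> U}"
    using eventually_gt_at_top[of "0 :: nat"]
  proof eventually_elim
    case (elim t)
    then have "mons ({} :: 'n set) t = {}" by (auto simp: mons_def)
    then show ?case by simp
  qed
  then show ?case by (rule eventually_poly_cong[OF eventually_poly_const])
next
  case (insert x T)
  define V where "V j = {m. m + sng x j \<in> U}" for j
  have up: "up_closed (V j)" for j
    unfolding up_closed_def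
  proof (intro ballI allI)
    fix m c assume "m \<in> V j"
    then have "(m + sng x j) + c \<in> U" using insert.prems by (simp add: V_def up_closed_def)
    then show "m + c \<in> V j" by (simp add: V_def add.assoc add.commute add.left_commute)
  qed
  have mn: "V j \<subseteq> V (Suc j)" for j
  proof
    fix m assume "m \<in> V j"
    then have "(m + sng x j) + sng x 1 \<in> U" using insert.prems unfolding V_def up_closed_def by blast
    moreover have "(m + sng x j) + sng x 1 = m + sng x (Suc j)" by (simp add: add.assoc flip: single_add)
    ultimately show "m \<in> V (Suc j)" by (simp add: V_def)
  qed
  obtain j0 where j0: "\<And>j. j \<ge> j0 \<Longrightarrow> V j = V j0" using up_closed_chain[of V, OF up mn] by blast
  define g where "g j t = card {m \<in> mons T t. m \<notin> V j}" for j t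
  have g: "eventually_poly (g j)" for j unfolding g_def by (rule insert.IH[OF up])
  have "card {m \<in> mons (insert x T) t. m \<notin> U} = (\<Sum>j<j0. g j (t - j)) + (\<Sum>i\<le>t - j0. g j0 i)" if t: "t \<ge> j0" for t
  proof -
    have "card {m \<in> mons (insert x T) t. m \<notin> U} = (\<Sum>j\<le>t. g j (t - j))"
      using card_mons_slices[OF insert.hyps(2), of t "\<lambda>m. m \<notin> U"] by (simp add: g_def V_def)
    also have "{..t} = {..<j0} \<union> {j0..t}" using t by auto
    also have "(\<Sum>j\<in>{..<j0} \<union> {j0..t}. g j (t - j)) = (\<Sum>j<j0. g j (t - j)) + (\<Sum>j\<in>{j0..t}. g j (t - j))"
      by (rule sum.union_disjoint) auto
    also have "(\<Sum>j\<in>{j0..t}. g j (t - j)) = (\<Sum>j\<in>{j0..t}. g j0 (t - j))"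
    proof (rule sum.cong[OF refl])
      fix j assume "j \<in> {j0..t}"
      then have "V j = V j0" using j0[of j] by simp
      then show "g j (t - j) = g j0 (t - j)" unfolding g_def by (simp only:)
    qed
    also have "\<dots> = (\<Sum>i\<le>t - j0. g j0 i)"
      by (rule sum.reindex_bij_witness[of _ "\<lambda>i. t - i" "\<lambda>j. t - j"]) (use t in auto)
    finally show ?thesis .
  qed
  then have "\<forall>\<^sub>F t in sequentially. (\<Sum>j<j0. g j (t - j)) + (\<Sum>i\<le>t - j0. g j0 i) = card {m \<in> mons (insert x T) t. m \<notin> U}"
    by (intro eventually_sequentiallyI[of j0]) simp
  moreover have "eventually_poly (\<lambda>t. (\<Sum>j<j0. g j (t - j)) + (\<Sum>i\<le>t - j0. g j0 i))"
    using eventually_poly_shift[OF eventually_poly_partial_sums[OF g[of j0]], of j0] eventually_poly_shift[OF g]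
    by (intro eventually_poly_add eventually_poly_sum) auto
  ultimately show ?case by (rule eventually_poly_cong[rotated])
qed

section \<open>Initial ideals and Hilbert polynomials\<close>

definition lead_mons :: "('n::finite, 'k::field) mpoly set \<Rightarrow> ('n \<Rightarrow>\<^sub>0 nat) set" where
  "lead_mons I = {lead_mon f | f t. f \<in> I \<and> f \<noteq> 0 \<and> f \<in> forms t}"

lemma lookup_mult_single:
  "lkp (f * sng c (1 :: 'k::field)) (m + c) = lkp f (m :: 'n::finite \<Rightarrow>\<^sub>0 nat)"
  "kys (f * sng c (1 :: 'k::field)) = (\<lambda>m. m + c) ` kys f"
proof -
  have 1: "lkp (f * sng c (1 :: 'k::field)) (m + c) = lkp f m" for m
  proof (induction f rule: pm_induct)
    case (single m' a)
    then show ?case by (simp add: mult_single lookup_single when_def)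
  next
    case (add f g)
    then show ?case by (simp add: distrib_right lookup_add)
  qed
  show "lkp (f * sng c (1 :: 'k::field)) (m + c) = lkp f m" by (rule 1)
  show "kys (f * sng c (1 :: 'k::field)) = (\<lambda>m. m + c) ` kys f"
  proof (intro set_eqI iffI)
    fix k assume k: "k \<in> kys (f * sng c (1 :: 'k))"
    then obtain a where "k = a + c" using subsetD[OF keys_mult k] by (auto split: if_splits)
    then show "k \<in> (\<lambda>m. m + c) ` kys f" using k 1[of a] by (auto simp: in_keys_iff)
  qed (auto simp: in_keys_iff 1)
qed

lemma lead_mons_up_closed:
  assumes "is_ideal I" shows "up_closed (lead_mons I)"
  unfolding up_closed_def
proof (intro ballI allI)
  fix m c assume "m \<in> lead_mons I"
  then obtain f t where f: "m = lead_mon f" "f \<in> I" "f \<noteq> 0" "f \<in> forms t" unfolding lead_mons_def by blast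
  define g where "g = f * sng c 1"
  have "lead_mon g = lead_mon f + c"
  proof (rule lead_mon_eqI)
    show "lead_mon f + c \<in> kys g" unfolding g_def lookup_mult_single(2) using lead_mon_works(1)[OF f(3)] by blast
    fix m' assume "m' \<in> kys g"
    then obtain a where a: "m' = a + c" "a \<in> kys f" unfolding g_def lookup_mult_single(2) by blast
    show "mkey m' \<le> mkey (lead_mon f + c)"
      unfolding a(1) mkey_add using lead_mon_works(2)[OF f(3) a(2)] by (rule add_right_mono)
  qed
  moreover have "g \<in> I" unfolding g_def using is_idealD(3)[OF assms f(2), of "sng c 1"] by (simp add: mult.commute)
  moreover have "g \<noteq> 0" using f(3) lookup_mult_single(2)[of f c] unfolding g_def
    by (metis image_is_empty keys_eq_empty)
  moreover have "g \<in> forms (t + mon_deg c)" unfolding g_def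
    by (rule forms_mult[OF f(4)]) (auto simp: forms_def)
  ultimately show "m + c \<in> lead_mons I" unfolding lead_mons_def f(1) by (metis (mono_tags, lifting) mem_Collect_eq)
qed

text \<open>Macaulay's comparison of an ideal with its initial ideal. As \<open>lead_mons\<close>
  uses homogeneous elements only, its monomials of degree \<open>t\<close> are the leading monomials
  of \<open>I \<inter> forms t\<close>.\<close>

lemma dim_ideal_eq_card:
  fixes I :: "('n::finite, 'k::field) mpoly set"
  assumes "is_ideal I"
  shows "mp.dim (I \<inter> forms t) = card {m \<in> mons UNIV t. m \<in> lead_mons I}"
proof -
  have "mp.dim (I \<inter> forms t) = card {lead_mon f | f. f \<in> I \<inter> forms t \<and> f \<noteq> 0}"
    by (rule dim_eq_card_lead_mon[OF ideal_forms_subspace[OF assms] finite_mons[of UNIV t]]) (auto simp: forms_keys)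
  also have "{lead_mon f | f. f \<in> I \<inter> forms t \<and> f \<noteq> 0} = {m \<in> mons UNIV t. m \<in> lead_mons I}"
  proof (intro set_eqI iffI)
    fix m assume "m \<in> {lead_mon f | f. f \<in> I \<inter> forms t \<and> f \<noteq> 0}"
    then obtain f where f: "m = lead_mon f" "f \<in> I" "f \<in> forms t" "f \<noteq> 0" by blast
    then have "m \<in> mons UNIV t" using lead_mon_works(1)[OF f(4)] forms_keys by blast
    then show "m \<in> {m \<in> mons UNIV t. m \<in> lead_mons I}" using f unfolding lead_mons_def by blast
  next
    fix m assume m: "m \<in> {m \<in> mons UNIV t. m \<in> lead_mons I}"
    then obtain f t' where f: "m = lead_mon f" "f \<in> I" "f \<noteq> 0" "f \<in> forms t'" unfolding lead_mons_def by blast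
    then have "m \<in> mons UNIV t'" using lead_mon_works(1)[OF f(3)] forms_keys by blast
    then have "t' = t" using m by (simp add: mons_def)
    then show "m \<in> {lead_mon f | f. f \<in> I \<inter> forms t \<and> f \<noteq> 0}" using f by blast
  qed
  finally show ?thesis .
qed

lemma dim_ideal_le:
  fixes I :: "('n::finite, 'k::field) mpoly set"
  shows "mp.dim (I \<inter> forms t) \<le> mp.dim (forms t :: ('n, 'k) mpoly set)"
  by (rule mp.dim_mono_fin_span) auto

lemma hilbert_fun_eq_card:
  fixes I :: "('n::finite, 'k::field) mpoly set"
  assumes "is_ideal I"
  shows "hilbert_fun I t = card {m \<in> mons UNIV t. m \<notin> lead_mons I}"
proof -
  have "{m \<in> mons UNIV t. m \<notin> lead_mons I} = mons UNIV t - {m \<in> mons UNIV t. m \<in> lead_mons I}" by blast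
  then have "card {m \<in> mons UNIV t. m \<notin> lead_mons I} = card (mons (UNIV :: 'n set) t) - card {m \<in> mons UNIV t. m \<in> lead_mons I}"
    by (simp add: card_Diff_subset)
  then show ?thesis unfolding hilbert_fun_def dim_forms dim_ideal_eq_card[OF assms] by simp
qed

lemma eventually_poly_hilbert_fun:
  fixes I :: "('n::finite, 'k::field) mpoly set"
  assumes "is_ideal I" shows "eventually_poly (hilbert_fun I)"
  using eventually_poly_complement_up_closed[OF _ lead_mons_up_closed[OF assms], of UNIV]
  by (simp add: hilbert_fun_eq_card[OF assms, abs_def])

lemma rat_poly_eqI:
  fixes p q :: "rat poly"
  assumes "\<forall>\<^sub>F t in sequentially. poly p (of_nat t) = poly q (of_nat t)" shows "p = q"
proof (rule ccontr)
  assume "p \<noteq> q"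
  then have fin: "finite {x. poly (p - q) x = 0}" by (intro poly_roots_finite) simp
  obtain t0 where t0: "\<And>t. t \<ge> t0 \<Longrightarrow> poly p (of_nat t) = poly q (of_nat t)"
    using assms unfolding eventually_sequentially by blast
  have "of_nat ` {t0..} \<subseteq> {x. poly (p - q) x = 0}" using t0 by auto
  then have "finite ((of_nat :: nat \<Rightarrow> rat) ` {t0..})" using fin finite_subset by blast
  then have "finite {t0..}" by (rule finite_imageD) (simp add: inj_on_def)
  then show False using infinite_Ici by blast
qed

lemma hilbert_poly_works:
  fixes I :: "('n::finite, 'k::field) mpoly set"
  assumes "is_ideal I"
  shows "\<forall>\<^sub>F t in sequentially. poly (hilbert_poly I) (of_nat t) = of_nat (hilbert_fun I t)"
proof -
  obtain p :: "rat poly" where p: "\<forall>\<^sub>F t in sequentially. poly p (of_nat t) = of_nat (hilbert_fun I t)"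
    using eventually_poly_hilbert_fun[OF assms] unfolding eventually_poly_def by blast
  show ?thesis unfolding hilbert_poly_def
  proof (rule theI2)
    show "\<forall>\<^sub>F t in sequentially. poly p (of_nat t) = of_nat (hilbert_fun I t)" by (rule p)
    fix q :: "rat poly" assume "\<forall>\<^sub>F t in sequentially. poly q (of_nat t) = of_nat (hilbert_fun I t)"
    then show "q = p" using p by (intro rat_poly_eqI) (erule (1) eventually_elim2, simp)
  qed
qed

section \<open>Heights of prime ideals\<close>

text \<open>For an ideal \<open>P\<close>, the extension to the whole ring of the contraction of
  \<open>P\<close> to the polynomials free of \<open>x\<close>.\<close>

definition ext_ideal :: "'n \<Rightarrow> ('n::finite, 'k::field) mpoly set \<Rightarrow> ('n, 'k) mpoly set" where
  "ext_ideal x P = {f. \<forall>j. coef x j f \<in> P}"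

lemma prime_idealD:
  assumes "prime_ideal P"
  shows "is_ideal P" "1 \<notin> P" "x * y \<in> P \<Longrightarrow> x \<in> P \<or> y \<in> P"
proof -
  show i: "is_ideal P" using assms by (simp add: prime_ideal_def)
  show "x * y \<in> P \<Longrightarrow> x \<in> P \<or> y \<in> P" using assms by (simp add: prime_ideal_def)
  show "1 \<notin> P"
  proof
    assume "1 \<in> P"
    then have "c * 1 \<in> P" for c using is_idealD(3)[OF i] by blast
    then have "P = UNIV" by (intro UNIV_eq_I[symmetric]) simp
    then show False using assms by (simp add: prime_ideal_def)
  qed
qed

lemma ext_ideal_subset: assumes "is_ideal P" shows "ext_ideal x P \<subseteq> P"
proof
  fix f assume f: "f \<in> ext_ideal x P"
  have "(\<Sum>j\<le>deg_in x f. var x ^ j * coef x j f) \<in> P"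
    using f by (intro is_ideal_sum[OF assms] is_idealD(3)[OF assms]) (simp add: ext_ideal_def)
  then show "f \<in> P" using coef_expand[of f x] by (simp add: mult.commute)
qed

lemma prime_ext_ideal:
  assumes P: "prime_ideal P" shows "prime_ideal (ext_ideal x P)"
  unfolding prime_ideal_def
proof (intro conjI allI impI)
  note iP = prime_idealD(1)[OF P]
  show "is_ideal (ext_ideal x P)"
    unfolding is_ideal_iff
  proof (intro conjI ballI allI)
    show "0 \<in> ext_ideal x P" using is_idealD(1)[OF iP] by (simp add: ext_ideal_def)
    fix f assume f: "f \<in> ext_ideal x P"
    have "coef x j (c * f) \<in> P" for j c
      unfolding coef_mult
    proof (rule is_ideal_sum[OF iP])
      show "coef x i c * coef x (j - i) f \<in> P" for i
        using f by (intro is_idealD(3)[OF iP]) (simp add: ext_ideal_def)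
    qed
    then show "c * f \<in> ext_ideal x P" for c by (simp add: ext_ideal_def)
    fix g assume "g \<in> ext_ideal x P"
    then show "f + g \<in> ext_ideal x P" using f is_idealD(2)[OF iP] by (simp add: ext_ideal_def coef_add)
  qed
  show "ext_ideal x P \<noteq> UNIV"
  proof
    assume "ext_ideal x P = UNIV"
    then have "1 \<in> ext_ideal x P" by simp
    then have "coef x 0 1 \<in> P" by (simp add: ext_ideal_def)
    then show False using prime_idealD(2)[OF P] by (simp add: coef_def)
  qed
  fix f g assume fg: "f * g \<in> ext_ideal x P"
  show "f \<in> ext_ideal x P \<or> g \<in> ext_ideal x P"
  proof (rule ccontr)
    assume "\<not> ?thesis"
    then obtain j l where "coef x j f \<notin> P" "coef x l g \<notin> P" by (auto simp: ext_ideal_def)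
    moreover have "coef x j (f * g) \<in> P" for j using fg by (simp add: ext_ideal_def)
    ultimately obtain i k where "coef x i f \<notin> P" "coef x k g \<notin> P" "coef x i f * coef x k g \<in> P"
      using coef_mult_outside_ideal[OF iP] by blast
    then show False using prime_idealD(3)[OF P] by blast
  qed
qed

text \<open>The variables in \<open>T\<close> are independent modulo \<open>P\<close> and each one
  in \<open>S\<close> is algebraic over them. Passing to \<open>ext_ideal x P\<close> is a strict
  step: it loses the relation of \<open>x\<close>, whose leading coefficient would otherwise lie in
  \<open>P\<close> and in \<open>polys T\<close>. The relations of the remaining variables are free
  of \<open>x\<close> and survive, so each element of \<open>S\<close> yields one step.\<close>

lemma prime_chain_exists:
  fixes P :: "('n::finite, 'k::field) mpoly set"
  assumes "finite S" "S \<inter> T = {}" "prime_ideal P" "\<And>f. f \<in> P \<Longrightarrow> f \<in> polys T \<Longrightarrow> f = 0"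
    and "\<And>x. x \<in> S \<Longrightarrow> \<exists>g\<in>P. g \<in> polys (insert x T) \<and> g \<noteq> 0"
  shows "\<exists>Q. (\<forall>i\<le>card S. prime_ideal (Q i)) \<and> (\<forall>i<card S. Q i \<subset> Q (Suc i)) \<and> Q (card S) = P"
  using assms
proof (induction S arbitrary: P)
  case empty
  then show ?case by (intro exI[of _ "\<lambda>_. P"]) simp
next
  case (insert x S)
  define P' where "P' = ext_ideal x P"
  note iP = prime_idealD(1)[OF insert.prems(2)]
  have P': "prime_ideal P'" unfolding P'_def by (rule prime_ext_ideal[OF insert.prems(2)])
  have sub: "P' \<subseteq> P" unfolding P'_def by (rule ext_ideal_subset[OF iP])
  have xT: "x \<notin> T" using insert.prems(1) by blast
  have "\<exists>Q. (\<forall>i\<le>card S. prime_ideal (Q i)) \<and> (\<forall>i<card S. Q i \<subset> Q (Suc i)) \<and> Q (card S) = P'"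
  proof (rule insert.IH[OF _ P'])
    show "S \<inter> T = {}" using insert.prems(1) by blast
    show "f = 0" if "f \<in> P'" "f \<in> polys T" for f using that sub insert.prems(3) by blast
    fix y assume y: "y \<in> S"
    obtain g where g: "g \<in> P" "g \<in> polys (insert y T)" "g \<noteq> 0" using insert.prems(4)[of y] y by blast
    have "x \<notin> insert y T" using xT y insert.hyps(2) by blast
    then have "upoly x g = [:g:]" by (rule upoly_polys[OF g(2)])
    then have "g \<in> P'" using g(1) is_idealD(1)[OF iP]
      by (auto simp: P'_def ext_ideal_def coef_def coeff_pCons split: nat.splits)
    then show "\<exists>g\<in>P'. g \<in> polys (insert y T) \<and> g \<noteq> 0" using g by blast
  qed
  then obtain Q where Q: "\<And>i. i \<le> card S \<Longrightarrow> prime_ideal (Q i)" "\<And>i. i < card S \<Longrightarrow> Q i \<subset> Q (Suc i)"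
    "Q (card S) = P'" by blast
  obtain g where g: "g \<in> P" "g \<in> polys (insert x T)" "g \<noteq> 0" using insert.prems(4)[of x] by blast
  have "g \<notin> P'"
  proof
    assume "g \<in> P'"
    then have "coef x (deg_in x g) g \<in> P" by (simp add: P'_def ext_ideal_def)
    moreover have "coef x (deg_in x g) g \<in> polys T" using coef_polys[OF g(2), of x] xT by simp
    ultimately show False using insert.prems(3) lc_nonzero[OF g(3)] by blast
  qed
  then have ss: "P' \<subset> P" using sub g(1) by blast
  define Q' where "Q' i = (if i \<le> card S then Q i else P)" for i
  have cS: "card (insert x S) = Suc (card S)" using insert.hyps by simp
  have "\<forall>i\<le>card (insert x S). prime_ideal (Q' i)"
    using Q(1) insert.prems(2) by (simp add: Q'_def)
  moreover have "\<forall>i<card (insert x S). Q' i \<subset> Q' (Suc i)"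
  proof (intro allI impI)
    fix i assume "i < card (insert x S)"
    then consider "i < card S" | "i = card S" unfolding cS by linarith
    then show "Q' i \<subset> Q' (Suc i)"
      by cases (use Q(2,3) ss in \<open>simp_all add: Q'_def\<close>)
  qed
  moreover have "Q' (card (insert x S)) = P" by (simp add: Q'_def cS)
  ultimately show ?case by blast
qed

text \<open>The height is attained at some prime \<open>P\<close>. A largest set \<open>T\<close> of
  variables independent modulo \<open>P\<close> leaves out at most \<open>h\<close> variables, since
  each of them gives a step in a chain below \<open>P\<close>. Such a \<open>T\<close> later bounds
  the Hilbert function of \<open>J\<close> from below.\<close>

lemma ideal_height_transversal:
  fixes J :: "('n::finite, 'k::field) mpoly set"
  assumes "ideal_height J = enat h"
  shows "\<exists>T. card T + h \<ge> CARD('n) \<and> (\<forall>f\<in>J. f \<in> polys T \<longrightarrow> f = 0)"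
proof -
  let ?A = "{prime_height P | P. prime_ideal P \<and> J \<subseteq> P}"
  have "?A \<noteq> {}"
  proof
    assume "?A = {}"
    then have "ideal_height J = \<infinity>" unfolding ideal_height_def by (simp only: Inf_enat_def) simp
    then show False using assms by simp
  qed
  then obtain a where "a \<in> ?A" by blast
  then have "Inf ?A \<in> ?A" unfolding Inf_enat_def using LeastI[of "\<lambda>x. x \<in> ?A"] by auto
  then obtain P where P: "prime_ideal P" "J \<subseteq> P" "prime_height P = enat h"
    using assms unfolding ideal_height_def by auto
  define F where "F = {T :: 'n set. \<forall>f\<in>P. f \<in> polys T \<longrightarrow> f = 0}"
  have "{} \<in> F"
  proof -
    have "f = 0" if f: "f \<in> P" "f \<in> polys {}" for f
    proof (rule ccontr)
      assume "f \<noteq> 0"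
      moreover obtain c where c: "f = cst c" using f(2) polys_empty by blast
      ultimately have "cst (1 / c) * f = 1" by (simp flip: cst_simps(4))
      then show False using is_idealD(3)[OF prime_idealD(1)[OF P(1)] f(1), of "cst (1 / c)"] prime_idealD(2)[OF P(1)] by simp
    qed
    then show ?thesis by (simp add: F_def)
  qed
  then obtain T where T: "T \<in> F" "\<And>T'. T' \<in> F \<Longrightarrow> card T' \<le> card T"
    using ex_max_image[of F card] by (metis empty_iff finite_code)
  have "\<exists>Q. (\<forall>i\<le>card (- T). prime_ideal (Q i)) \<and> (\<forall>i<card (- T). Q i \<subset> Q (Suc i)) \<and> Q (card (- T)) = P"
  proof (rule prime_chain_exists[OF _ _ P(1)])
    show "f = 0" if "f \<in> P" "f \<in> polys T" for f using T(1) that by (simp add: F_def)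
    fix x assume "x \<in> - T"
    then have "card (insert x T) > card T" by simp
    then have "insert x T \<notin> F" using T(2) by (meson not_le)
    then show "\<exists>g\<in>P. g \<in> polys (insert x T) \<and> g \<noteq> 0" by (auto simp: F_def)
  qed auto
  then have "enat (card (- T)) \<le> prime_height P"
    unfolding prime_height_def by (intro Sup_upper) blast
  then have "card (- T) \<le> h" using P(3) by simp
  moreover have "card (- T) = CARD('n) - card T" by (simp add: Compl_eq_Diff_UNIV card_Diff_subset)
  ultimately have "card T + h \<ge> CARD('n)" by linarith
  moreover have "\<forall>f\<in>J. f \<in> polys T \<longrightarrow> f = 0" using T(1) P(2) by (auto simp: F_def)
  ultimately show ?thesis by blast
qed

text \<open>In a nonzero prime ideal strictly below the multiples of \<open>p\<close>, an element of
  least total degree is \<open>p * v\<close>; as \<open>p\<close> is outside, \<open>v\<close> is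
  inside and has smaller degree, which is absurd.\<close>

lemma prime_height_principal:
  fixes p :: "('n::finite, 'k::field) mpoly"
  assumes p: "prime_in UNIV p"
  shows "prime_ideal (range ((*) p))" "prime_height (range ((*) p)) \<le> 1"
proof -
  let ?P = "range ((*) p)"
  have p0: "p \<noteq> 0" by (rule prime_in_nonzero[OF p])
  have pc: "p \<notin> range cst" using p by (simp add: prime_in_def)
  have memP: "f \<in> ?P \<longleftrightarrow> p dvd f" for f by (auto simp: dvd_def)
  have "is_ideal ?P" unfolding is_ideal_iff memP Ball_def by simp
  moreover have "1 \<notin> ?P"
  proof
    assume "1 \<in> ?P"
    then have "p \<in> polys {}" unfolding memP by (intro polys_dvd[of p 1]) auto
    then show False using pc by (auto simp: polys_empty)
  qed
  then have "?P \<noteq> UNIV" by blast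
  ultimately show "prime_ideal ?P"
    unfolding prime_ideal_def memP using prime_in_dvd_mult[OF p] by blast
  show "prime_height ?P \<le> 1"
    unfolding prime_height_def
  proof (rule Sup_least, elim CollectE exE conjE)
    fix e m and Q :: "nat \<Rightarrow> ('n, 'k) mpoly set"
    assume e: "e = enat m" and Q: "\<forall>i\<le>m. prime_ideal (Q i)" "\<forall>i<m. Q i \<subset> Q (Suc i)" "Q m = ?P"
    have "m \<le> 1"
    proof (rule ccontr)
      assume "\<not> m \<le> 1"
      then obtain l where m: "m = Suc (Suc l)" by (metis One_nat_def not0_implies_Suc le_eq_less_or_eq less_one not_less zero_le)
      have pr: "prime_ideal (Q (Suc l))" "prime_ideal (Q l)" using Q(1) m by auto
      have s: "Q l \<subset> Q (Suc l)" "Q (Suc l) \<subset> ?P" using Q(2,3) m by auto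
      have iQ: "is_ideal (Q (Suc l))" by (rule prime_idealD(1)[OF pr(1)])
      have pQ: "p \<notin> Q (Suc l)"
      proof
        assume "p \<in> Q (Suc l)"
        then have "?P \<subseteq> Q (Suc l)" using is_idealD(3)[OF iQ] by (auto simp: mult.commute[of p])
        then show False using s(2) by blast
      qed
      obtain u0 where "u0 \<in> Q (Suc l)" "u0 \<noteq> 0"
        using s(1) is_idealD(1)[OF prime_idealD(1)[OF pr(2)]] by blast
      define td where "td f = (\<Sum>x\<in>UNIV. deg_in x f)" for f :: "('n, 'k) mpoly"
      define u where "u = arg_min td (\<lambda>u. u \<in> Q (Suc l) \<and> u \<noteq> 0)"
      have u: "u \<in> Q (Suc l) \<and> u \<noteq> 0" unfolding u_def
        by (rule arg_min_natI[of _ u0]) (use \<open>u0 \<in> Q (Suc l)\<close> \<open>u0 \<noteq> 0\<close> in simp)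
      have umin: "td u \<le> td v" if "v \<in> Q (Suc l)" "v \<noteq> 0" for v
        unfolding u_def by (rule arg_min_nat_le) (use that in simp)
      obtain v where v: "u = p * v" using u s(2) by blast
      have v0: "v \<noteq> 0" using u v by auto
      have "v \<in> Q (Suc l)" using prime_idealD(3)[OF pr(1), of p v] u v pQ by blast
      then have "td u \<le> td v" using umin v0 by blast
      moreover have "td u = td p + td v" unfolding v td_def by (simp add: deg_in_mult[OF p0 v0] sum.distrib)
      ultimately have "td p = 0" by simp
      then have "p \<in> polys {}" unfolding polys_iff_deg_in by (simp add: td_def)
      then show False using pc by (auto simp: polys_empty)
    qed
    then show "e \<le> 1" using e by (simp add: one_enat_def)
  qed
qed

lemma ideal_height_common_prime:
  fixes p :: "('n::finite, 'k::field) mpoly"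
  assumes "prime_in UNIV p" "\<And>f. f \<in> J \<Longrightarrow> p dvd f"
  shows "ideal_height J \<le> 1"
proof -
  have "J \<subseteq> range ((*) p)" using assms(2) by (auto simp: dvd_def)
  then have "ideal_height J \<le> prime_height (range ((*) p))"
    unfolding ideal_height_def using prime_height_principal(1)[OF assms(1)] by (intro Inf_lower) blast
  then show ?thesis using prime_height_principal(2)[OF assms(1)] by (rule order_trans)
qed

section \<open>Linear changes of coordinates and forms monic in a variable\<close>

definition graded_aut :: "(('n::finite, 'k::field) mpoly \<Rightarrow> ('n, 'k) mpoly) \<Rightarrow> bool" where
  "graded_aut \<theta> \<longleftrightarrow> (\<forall>f g. \<theta> (f + g) = \<theta> f + \<theta> g) \<and> (\<forall>f g. \<theta> (f * g) = \<theta> f * \<theta> g) \<and>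
     (\<forall>c. \<theta> (cst c) = cst c) \<and> bij \<theta> \<and> (\<forall>t f. \<theta> f \<in> forms t \<longleftrightarrow> f \<in> forms t)"

lemma gautD:
  assumes "graded_aut \<theta>"
  shows "\<theta> (f + g) = \<theta> f + \<theta> g" "\<theta> (f * g) = \<theta> f * \<theta> g" "\<theta> (cst c) = cst c" "bij \<theta>"
    "\<theta> f \<in> forms t \<longleftrightarrow> f \<in> forms t" "\<theta> 0 = 0" "\<theta> f = \<theta> g \<longleftrightarrow> f = g" "\<theta> f = 0 \<longleftrightarrow> f = 0"
    "\<exists>g. f = \<theta> g"
proof -
  show "\<theta> (f + g) = \<theta> f + \<theta> g" "\<theta> (f * g) = \<theta> f * \<theta> g" "\<theta> f \<in> forms t \<longleftrightarrow> f \<in> forms t"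
    using assms unfolding graded_aut_def by blast+
  show b: "bij \<theta>" using assms unfolding graded_aut_def by blast
  show c: "\<theta> (cst c) = cst c" for c using assms unfolding graded_aut_def by blast
  show z: "\<theta> 0 = 0" using c[of 0] by simp
  show i: "\<theta> f = \<theta> g \<longleftrightarrow> f = g" for f g using b by (simp add: bij_def inj_eq)
  show "\<theta> f = 0 \<longleftrightarrow> f = 0" using i[of f 0] z by simp
  show "\<exists>g. f = \<theta> g" using b by (metis bij_pointE)
qed

lemma graded_aut_comp: "graded_aut \<theta> \<Longrightarrow> graded_aut \<theta>' \<Longrightarrow> graded_aut (\<lambda>f. \<theta> (\<theta>' f))"
  using bij_comp[of \<theta>' \<theta>] unfolding graded_aut_def comp_def by simp

lemma graded_aut_dvd: assumes "graded_aut \<theta>" shows "\<theta> f dvd \<theta> g \<longleftrightarrow> f dvd g"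
proof
  assume "\<theta> f dvd \<theta> g"
  then obtain h where h: "\<theta> g = \<theta> f * h" by (elim dvdE)
  obtain h' where "h = \<theta> h'" using gautD(9)[OF assms] by blast
  then have "\<theta> g = \<theta> (f * h')" using h gautD(2)[OF assms] by simp
  then have "g = f * h'" using gautD(7)[OF assms] by blast
  then show "f dvd g" by simp
qed (auto elim!: dvdE simp: gautD(2)[OF assms])

lemma graded_aut_ideal: assumes "graded_aut \<theta>" "is_ideal C" shows "is_ideal (\<theta> ` C)"
  unfolding is_ideal_iff
proof (intro conjI ballI allI)
  show "0 \<in> \<theta> ` C" using gautD(6)[OF assms(1)] is_idealD(1)[OF assms(2)] by (metis imageI)
  fix x assume "x \<in> \<theta> ` C"
  then obtain x' where x: "x = \<theta> x'" "x' \<in> C" by blast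
  show "c * x \<in> \<theta> ` C" for c
  proof -
    obtain c' where "c = \<theta> c'" using gautD(9)[OF assms(1)] by blast
    then have "c * x = \<theta> (c' * x')" using x gautD(2)[OF assms(1)] by simp
    then show ?thesis using is_idealD(3)[OF assms(2) x(2)] by blast
  qed
  fix y assume "y \<in> \<theta> ` C"
  then obtain y' where y: "y = \<theta> y'" "y' \<in> C" by blast
  then have "x + y = \<theta> (x' + y')" using x gautD(1)[OF assms(1)] by simp
  then show "x + y \<in> \<theta> ` C" using is_idealD(2)[OF assms(2) x(2) y(2)] by blast
qed

lemma graded_aut_dim:
  fixes C :: "('n::finite, 'k::field) mpoly set"
  assumes "graded_aut \<theta>" "is_ideal C" shows "mp.dim (\<theta> ` C \<inter> forms t) = mp.dim (C \<inter> forms t)"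
proof -
  have e: "\<theta> ` C \<inter> forms t = \<theta> ` (C \<inter> forms t)" using gautD(5)[OF assms(1)] by auto
  have lin: "Vector_Spaces.linear pm_scale pm_scale \<theta>"
    by unfold_locales (simp_all add: gautD(1-3)[OF assms(1)] pm_scale_cst)
  show ?thesis unfolding e
    by (rule mpp.dim_image_inj_fin_span[OF lin ideal_forms_subspace[OF assms(2)]])
      (auto simp: gautD(8)[OF assms(1)])
qed

text \<open>When \<open>a y = 0\<close> the variable \<open>y\<close> is fixed, and the shear with
  the negated \<open>a\<close> is the inverse.\<close>

definition shear :: "'n \<Rightarrow> ('n \<Rightarrow> 'k) \<Rightarrow> ('n::finite, 'k::field) mpoly \<Rightarrow> ('n, 'k) mpoly" where
  "shear y a = subst_vars (\<lambda>i. var i + cst (a i) * var y)"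

lemma shear_shear: assumes "a y = 0" shows "shear y (\<lambda>i. - a i) (shear y a f) = f"
  unfolding shear_def subst_vars_subst_vars by (simp add: subst_vars_add subst_vars_mult assms subst_vars_id add.assoc)

lemma shear_forms: "f \<in> forms t \<Longrightarrow> shear y a f \<in> forms t"
  unfolding shear_def by (rule subst_vars_forms) (rule forms_add forms_cst_mult forms_var)+

lemma graded_aut_shear: assumes "a y = 0" shows "graded_aut (shear y a)"
  unfolding graded_aut_def
proof (intro conjI allI iffI)
  have inv: "shear y (\<lambda>i. - a i) (shear y a f) = f" "shear y a (shear y (\<lambda>i. - a i) f) = f" for f
    using shear_shear[of a y f] shear_shear[of "\<lambda>i. - a i" y f] assms by simp_all
  show "bij (shear y a)" by (rule bij_betwI[of _ _ _ "shear y (\<lambda>i. - a i)"]) (auto simp: inv)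
  show "f \<in> forms t" if "shear y a f \<in> forms t" for f t
    using shear_forms[OF that, of y "\<lambda>i. - a i"] inv by simp
qed (auto simp: shear_def subst_vars_add subst_vars_mult intro: shear_forms[unfolded shear_def])

text \<open>The value of a form of degree \<open>e\<close> at \<open>unit_pt y\<close> is its
  coefficient at the \<open>e\<close>-th power of \<open>y\<close>, so nonvanishing there means
  being monic in \<open>y\<close> up to a constant.\<close>

definition unit_pt :: "'n \<Rightarrow> 'n \<Rightarrow> 'k::field" where "unit_pt y i = (if i = y then 1 else 0)"

text \<open>Coordinates are moved so that \<open>unit_pt y\<close> goes to a point off the zero set
  of \<open>f\<close>. Leaving the variables outside \<open>V\<close> alone preserves what was
  arranged for them before.\<close>

lemma make_monic:
  fixes f :: "('n::finite, 'k::field_char_0) mpoly"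
  assumes f: "f \<in> forms t" "f \<noteq> 0" "f \<in> polys V" and y: "y \<in> V"
  shows "\<exists>a. a y = 0 \<and> (\<forall>i. i \<notin> V \<longrightarrow> a i = 0) \<and> evalp (unit_pt y) (shear y a f) \<noteq> 0"
proof -
  \<comment> \<open>The factor \<open>var y\<close> forces the \<open>y\<close> coordinate of the
    chosen point to be nonzero, so that it can be scaled to 1.\<close>
  have "f * var y \<noteq> 0" using f(2) by (auto simp: var_def) (metis lookup_single_eq lookup_zero zero_neq_one)
  then obtain P where P: "evalp P (f * var y) \<noteq> 0" using exists_nonroot by blast
  then have Py: "P y \<noteq> 0" "evalp P f \<noteq> 0" by (auto simp: evalp_mult)
  define a where "a i = (if i \<in> V \<and> i \<noteq> y then 1 / P y * P i else 0)" for i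
  have "evalp (unit_pt y) (shear y a f) = evalp (\<lambda>i. unit_pt y i + a i) f"
    unfolding shear_def evalp_subst_vars by (simp add: evalp_add evalp_mult unit_pt_def)
  also have "\<dots> = evalp (\<lambda>i. 1 / P y * P i) f"
    by (rule evalp_cong_polys[OF f(3)]) (use Py in \<open>simp add: unit_pt_def a_def\<close>)
  also have "\<dots> = (1 / P y) ^ t * evalp P f" by (rule evalp_form_scale[OF f(1)])
  finally have "evalp (unit_pt y) (shear y a f) \<noteq> 0" using Py by simp
  then show ?thesis by (intro exI[of _ a]) (simp add: a_def)
qed

text \<open>A shear along \<open>y\<close> that leaves \<open>z\<close> alone fixes the point
  \<open>unit_pt z\<close>, so forms monic in \<open>z\<close> stay so.\<close>

lemma evalp_unit_shear:
  assumes "z \<noteq> y" "a z = 0" shows "evalp (unit_pt z) (shear y a f) = evalp (unit_pt z) f"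
proof -
  have "(\<lambda>i. evalp (unit_pt z) (var i + cst (a i) * var y)) = unit_pt z"
    using assms by (auto simp: evalp_add evalp_mult unit_pt_def)
  then show ?thesis unfolding shear_def evalp_subst_vars by simp
qed

lemma shear_polys: "f \<in> polys V \<Longrightarrow> y \<in> V \<Longrightarrow> shear y a f \<in> polys V"
  unfolding shear_def by (rule subst_vars_polys) (auto intro!: polys_add polys_mult)

lemma monic_form:
  fixes f :: "('n::finite, 'k::field) mpoly"
  assumes f: "f \<in> forms e" and m: "evalp (unit_pt x) f \<noteq> 0"
  shows "deg_in x f = e" "\<exists>c. c \<noteq> 0 \<and> coef x e f = cst c"
proof -
  obtain c where c: "coef x e f = cst c"
    using coef_forms[OF f order_refl, of x] by (auto simp: forms_0_cst)
  have low: "evalp (unit_pt x) (coef x j f) = 0" if j: "j < e" for j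
  proof -
    have k: "coef x j f \<in> polys (UNIV - {x})" by (rule coef_polys) simp
    \<comment> \<open>The coefficient is free of \<open>x\<close>, so the point may be replaced by
      the origin, where a form of positive degree vanishes.\<close>
    have "evalp (unit_pt x) (coef x j f) = evalp (\<lambda>i. 0 * unit_pt x i) (coef x j f)"
      by (rule evalp_cong_polys[OF k]) (simp add: unit_pt_def)
    also have "\<dots> = 0 ^ (e - j) * evalp (unit_pt x) (coef x j f)"
      by (rule evalp_form_scale[OF coef_forms[OF f]]) (use j in simp)
    also have "(0 :: 'k) ^ (e - j) = 0" using j by simp
    finally show ?thesis by simp
  qed
  have le: "deg_in x f \<le> e" by (rule deg_in_forms[OF f])
  have "c \<noteq> 0"
  proof
    assume "c = 0"
    then have z: "evalp (unit_pt x) (coef x j f) = 0" if "j \<le> deg_in x f" for j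
      using low[of j] c that le by (cases "j = e") auto
    have "evalp (unit_pt x) f = (\<Sum>j\<le>deg_in x f. evalp (unit_pt x) (coef x j f) * evalp (unit_pt x) (var x) ^ j)"
      by (subst coef_expand[of f x]) (simp only: evalp_sum evalp_mult evalp_power)
    also have "\<dots> = 0" by (rule sum.neutral) (simp add: z)
    finally show False using m by simp
  qed
  then show "\<exists>c. c \<noteq> 0 \<and> coef x e f = cst c" using c by blast
  show "deg_in x f = e" using le coef_beyond[of x f e] c \<open>c \<noteq> 0\<close> by (metis cst_eq_0_iff le_neq_implies_less)
qed

definition monic_in :: "'n \<Rightarrow> ('n::finite, 'k::field) mpoly \<Rightarrow> bool" where
  "monic_in x f \<longleftrightarrow> (\<exists>c. c \<noteq> 0 \<and> coef x (deg_in x f) f = cst c)"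

lemma monic_in_form: "f \<in> forms e \<Longrightarrow> evalp (unit_pt x) f \<noteq> 0 \<Longrightarrow> monic_in x f"
  using monic_form unfolding monic_in_def by blast

lemma monic_nonzero: "monic_in x f \<Longrightarrow> f \<noteq> 0"
  unfolding monic_in_def by auto

lemma monic_division:
  fixes f g :: "('n::finite, 'k::field) mpoly"
  assumes "monic_in x f" shows "\<exists>q r. g = f * q + r \<and> (r = 0 \<or> deg_in x r < deg_in x f)"
proof -
  obtain c where c: "c \<noteq> 0" "coef x (deg_in x f) f = cst c" using assms unfolding monic_in_def by blast
  obtain N q r where h: "cst c ^ N * g = q * f + r" "r = 0 \<or> deg_in x r < deg_in x f"
    using pseudo_division[OF monic_nonzero[OF assms], of g UNIV x] c(2) by auto
  have pw: "cst c ^ N = cst (c ^ N)" by (induction N) auto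
  define b :: "('n, 'k) mpoly" where "b = cst (1 / c ^ N)"
  have "b * cst c ^ N = 1" unfolding b_def pw using c(1) by (simp flip: cst_simps(4))
  then have "g = b * (cst c ^ N * g)" by (simp flip: mult.assoc)
  also have "\<dots> = f * (b * q) + b * r" unfolding h(1) by (simp add: algebra_simps)
  finally have "g = f * (b * q) + b * r" .
  moreover have "b \<noteq> 0" using c(1) by (simp add: b_def)
  then have "b * r = 0 \<or> deg_in x (b * r) < deg_in x f"
    using h(2) deg_in_mult[of b r x] by (cases "r = 0") (auto simp: b_def)
  ultimately show ?thesis by blast
qed

text \<open>Multiplying the remainder of \<open>u\<close> by \<open>b\<close>, which is free of
  \<open>x\<close>, does not raise its degree in \<open>x\<close>; a multiple of \<open>f\<close> of
  degree below that of \<open>f\<close> is zero.\<close>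

lemma monic_dvd_cancel:
  fixes f :: "('n::finite, 'k::field) mpoly"
  assumes f: "monic_in x f" and b: "b \<in> polys (- {x})" "b \<noteq> 0" and d: "f dvd b * u"
  shows "f dvd u"
proof -
  obtain q r where u: "u = f * q + r" "r = 0 \<or> deg_in x r < deg_in x f" using monic_division[OF f] by blast
  obtain h where h: "b * u = f * h" using d by (elim dvdE)
  have br: "b * r = f * (h - b * q)" using h unfolding u(1) by (simp add: algebra_simps)
  have "r = 0"
  proof (rule ccontr)
    assume r: "r \<noteq> 0"
    then have "b * r \<noteq> 0" using b by simp
    then have "h - b * q \<noteq> 0" using br by auto
    then have "deg_in x (b * r) \<ge> deg_in x f" unfolding br using monic_nonzero[OF f] by (simp add: deg_in_mult)
    moreover have "deg_in x (b * r) = deg_in x r" using deg_in_mult[OF b(2) r] deg_in_polys[OF b(1), of x] by simp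
    ultimately show False using u(2) r by simp
  qed
  then show ?thesis using u(1) by simp
qed

text \<open>Reduce \<open>w\<close> and \<open>v\<close> modulo \<open>a\<close> with respect to
  \<open>z\<close>. As \<open>b\<close> and \<open>c\<close> are free of \<open>z\<close>, the
  relation becomes an exact equation between the remainders, and division by \<open>b\<close> with
  respect to \<open>y\<close> finishes because \<open>c\<close> is free of \<open>y\<close>.\<close>

lemma monic_regular_sequence:
  fixes a b c :: "('n::finite, 'k::field) mpoly"
  assumes a: "monic_in z a" and b: "monic_in y b" "b \<in> polys (- {z})" and c: "c \<in> polys (- {y, z})" "c \<noteq> 0"
    and e: "c * w = a * u + b * v"
  shows "\<exists>u' v'. w = a * u' + b * v'"
proof -
  obtain w1 w0 where w: "w = a * w1 + w0" "w0 = 0 \<or> deg_in z w0 < deg_in z a" using monic_division[OF a] by blast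
  obtain v1 v0 where v: "v = a * v1 + v0" "v0 = 0 \<or> deg_in z v0 < deg_in z a" using monic_division[OF a] by blast
  have cz: "deg_in z c = 0" "deg_in y c = 0" "deg_in z b = 0" using deg_in_polys[OF c(1)] deg_in_polys[OF b(2)] by auto
  have small: "c * w0 = 0 \<or> deg_in z (c * w0) < deg_in z a" "b * v0 = 0 \<or> deg_in z (b * v0) < deg_in z a"
    using w(2) v(2) deg_in_mult[OF c(2), of w0 z] deg_in_mult[OF monic_nonzero[OF b(1)], of v0 z] cz
    by (cases "w0 = 0"; cases "v0 = 0"; simp)+
  have ea: "c * w0 - b * v0 = a * (u + b * v1 - c * w1)"
    using e unfolding w(1) v(1) by (simp add: algebra_simps)
  have "c * w0 - b * v0 = 0"
  proof (rule ccontr)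
    assume n: "c * w0 - b * v0 \<noteq> 0"
    then have n': "u + b * v1 - c * w1 \<noteq> 0" using ea by auto
    have ge: "deg_in z (c * w0 - b * v0) \<ge> deg_in z a" unfolding ea using deg_in_mult[OF monic_nonzero[OF a] n'] by simp
    have "deg_in z (c * w0) \<le> deg_in z a - 1" "deg_in z (b * v0) \<le> deg_in z a - 1"
      using small by auto
    from deg_in_diff_le[OF this] ge have "deg_in z a = 0" by simp
    then have h: "c * w0 = 0" "b * v0 = 0" using small by (simp_all only: not_less0 simp_thms)
    show False using n unfolding h by simp
  qed
  then have cb: "c * w0 = b * v0" by simp
  obtain w2 w3 where w0: "w0 = b * w2 + w3" "w3 = 0 \<or> deg_in y w3 < deg_in y b" using monic_division[OF b(1)] by blast
  have eb: "c * w3 = b * (v0 - c * w2)" using cb unfolding w0(1) by (simp add: algebra_simps)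
  have "w3 = 0"
  proof (rule ccontr)
    assume n: "w3 \<noteq> 0"
    then have "c * w3 \<noteq> 0" using c(2) by simp
    then have "v0 - c * w2 \<noteq> 0" using eb by auto
    then have "deg_in y (c * w3) \<ge> deg_in y b" unfolding eb using deg_in_mult[OF monic_nonzero[OF b(1)]] by simp
    moreover have "deg_in y (c * w3) = deg_in y w3" using deg_in_mult[OF c(2) n] cz by simp
    ultimately show False using w0(2) n by simp
  qed
  then have "w = a * w1 + b * w2" using w(1) w0(1) by simp
  then show ?thesis by blast
qed

section \<open>Regular sequences and saturation from Hilbert function bounds\<close>

lemma keys_mons_iff: "kys f \<subseteq> mons T t \<longleftrightarrow> f \<in> forms t \<and> f \<in> polys T"
  by (auto simp: mons_def forms_def polys_def)

lemma mons_subset: "mons T t \<subseteq> mons UNIV t"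
  by (auto simp: mons_def)

lemma meets_coordinate_subring:
  fixes C :: "('n::finite, 'k::field) mpoly set"
  assumes "is_ideal C" "mp.dim (C \<inter> forms t) + card (mons T t) > card (mons (UNIV :: 'n set) t)"
  shows "\<exists>f\<in>C. f \<in> forms t \<and> f \<in> polys T \<and> f \<noteq> 0"
proof (rule ccontr)
  assume n: "\<not> ?thesis"
  have "mp.dim (C \<inter> forms t) + card (mons T t) \<le> card (mons (UNIV :: 'n set) t)"
  proof (rule dim_disjoint_monomials[OF ideal_forms_subspace[OF assms(1)] _ mons_subset])
    show "f = 0" if "f \<in> C \<inter> forms t" "kys f \<subseteq> mons T t" for f
      using n that by (auto simp: keys_mons_iff)
  qed blast
  then show False using assms(2) by simp
qed

text \<open>A regular sequence of length three, allowed to generate the unit ideal.\<close>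

definition regular_triple :: "'a::comm_ring_1 \<Rightarrow> 'a \<Rightarrow> 'a \<Rightarrow> bool" where
  "regular_triple a b c \<longleftrightarrow> a \<noteq> 0 \<and> (\<forall>v. a dvd b * v \<longrightarrow> a dvd v) \<and>
     (\<forall>w u v. c * w = a * u + b * v \<longrightarrow> (\<exists>u' v'. w = a * u' + b * v'))"

lemma graded_aut_regular_triple:
  assumes "graded_aut \<theta>" "regular_triple (\<theta> a) (\<theta> b) (\<theta> c)" shows "regular_triple a b c"
  unfolding regular_triple_def
proof (intro conjI allI impI)
  note D = gautD[OF assms(1)]
  note dv = graded_aut_dvd[OF assms(1)]
  show "a \<noteq> 0" using assms(2) D(6) unfolding regular_triple_def by auto
  show "a dvd v" if "a dvd b * v" for v
  proof -
    have "\<theta> a dvd \<theta> b * \<theta> v" using that dv[of a "b * v"] D(2) by simp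
    then have "\<theta> a dvd \<theta> v" using assms(2) unfolding regular_triple_def by blast
    then show ?thesis using dv by simp
  qed
  fix w u v assume "c * w = a * u + b * v"
  then have "\<theta> (c * w) = \<theta> (a * u + b * v)" by simp
  then have "\<theta> c * \<theta> w = \<theta> a * \<theta> u + \<theta> b * \<theta> v" by (simp add: D(1,2))
  then obtain u' v' where uv: "\<theta> w = \<theta> a * u' + \<theta> b * v'"
    using assms(2) unfolding regular_triple_def by blast
  obtain u0 v0 where uv0: "u' = \<theta> u0" "v' = \<theta> v0" using D(9) by metis
  have "\<theta> w = \<theta> (a * u0 + b * v0)" using uv unfolding uv0 by (simp add: D(1,2))
  then have "w = a * u0 + b * v0" using D(7) by blast
  then show "\<exists>u' v'. w = a * u' + b * v'" by blast
qed

lemma two_distinct: assumes "CARD('n::finite) \<ge> 2" shows "\<exists>y z :: 'n. y \<noteq> z"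
proof (rule ccontr)
  assume "\<nexists>y z :: 'n. y \<noteq> z"
  then have "UNIV = {undefined :: 'n}" by auto
  then have "CARD('n) = 1" by (metis card_1_singleton_iff One_nat_def)
  then show False using assms by simp
qed

lemma card_Compl_two: "y \<noteq> z \<Longrightarrow> card (- {y, z :: 'n::finite}) = CARD('n) - 2"
  by (simp add: Compl_eq_Diff_UNIV card_Diff_subset)

text \<open>The hypothesis is invariant under graded automorphisms, so \<open>C\<close> contains a
  form in the variables \<open>T\<close> in any linear coordinates. Between the three choices the
  coordinates are changed to make the elements found so far monic; the third is chosen in the final
  coordinates.\<close>

lemma regular_triple_exists:
  fixes C :: "('n::finite, 'k::field_char_0) mpoly set"
  assumes C: "is_ideal C" and n: "CARD('n) = N + 3"
    and big: "mp.dim (C \<inter> forms t) + bin N t > card (mons (UNIV :: 'n set) t)"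
  shows "\<exists>a\<in>C. \<exists>b\<in>C. \<exists>c\<in>C. regular_triple a b c"
proof -
  obtain y z :: 'n where yz: "y \<noteq> z" using two_distinct[where 'n='n] n by auto
  define T where "T = - {y, z}"
  have cT: "card (mons T t) = bin N t" using card_mons[of T N t] card_Compl_two[OF yz] n by (simp add: T_def)
  have meet: "\<exists>f\<in>\<theta> ` C. f \<in> forms t \<and> f \<in> polys T \<and> f \<noteq> 0" if g: "graded_aut \<theta>" for \<theta>
    by (rule meets_coordinate_subring[OF graded_aut_ideal[OF g C]]) (use big cT graded_aut_dim[OF g C] in simp)
  have TV: "polys T \<subseteq> polys (- {z} :: 'n set)" by (rule polys_mono) (auto simp: T_def)
  have "graded_aut (\<lambda>f :: ('n, 'k) mpoly. f)" unfolding graded_aut_def by (simp add: bij_def surj_def)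
  from meet[OF this] obtain a0 where a0: "a0 \<in> C" "a0 \<in> forms t" "a0 \<noteq> 0" by auto
  obtain p where p: "p z = 0" "evalp (unit_pt z) (shear z p a0) \<noteq> 0"
    using make_monic[OF a0(2,3), of UNIV z] by auto
  have g1: "graded_aut (shear z p)" by (rule graded_aut_shear) (rule p(1))
  obtain b0 where b0: "b0 \<in> C" "shear z p b0 \<in> forms t" "shear z p b0 \<in> polys T" "shear z p b0 \<noteq> 0"
    using meet[OF g1] by auto
  have b0V: "shear z p b0 \<in> polys (- {z})" using b0(3) TV by blast
  have yV: "y \<in> - {z}" using yz by simp
  obtain q where q: "q y = 0" "\<forall>i. i \<notin> - {z} \<longrightarrow> q i = 0" "evalp (unit_pt y) (shear y q (shear z p b0)) \<noteq> 0"
    using make_monic[OF b0(2,4) b0V yV] by blast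
  \<comment> \<open>The second shear leaves \<open>z\<close> alone, so the image of
    \<open>a0\<close> remains monic in \<open>z\<close>.\<close>
  have qz: "q z = 0" using q(2) by simp
  define \<theta> where "\<theta> f = shear y q (shear z p f)" for f
  have g2: "graded_aut (shear y q)" by (rule graded_aut_shear) (rule q(1))
  have g: "graded_aut \<theta>" unfolding \<theta>_def by (rule graded_aut_comp[OF g2 g1])
  obtain c0 where c0: "c0 \<in> C" "\<theta> c0 \<in> polys T" "\<theta> c0 \<noteq> 0" using meet[OF g] by auto
  have af: "\<theta> a0 \<in> forms t" using a0(2) gautD(5)[OF g] by blast
  have bf: "\<theta> b0 \<in> forms t" unfolding \<theta>_def by (rule shear_forms[OF b0(2)])
  have ma: "monic_in z (\<theta> a0)"
    by (rule monic_in_form[OF af]) (use p(2) evalp_unit_shear[of z y q] yz qz in \<open>simp add: \<theta>_def\<close>)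
  have mb: "monic_in y (\<theta> b0)" by (rule monic_in_form[OF bf]) (use q(3) in \<open>simp add: \<theta>_def\<close>)
  have bV: "\<theta> b0 \<in> polys (- {z})" unfolding \<theta>_def by (rule shear_polys[OF b0V yV])
  have "regular_triple (\<theta> a0) (\<theta> b0) (\<theta> c0)"
    unfolding regular_triple_def
  proof (intro conjI allI impI)
    show "\<theta> a0 \<noteq> 0" by (rule monic_nonzero[OF ma])
    show "\<theta> a0 dvd v" if "\<theta> a0 dvd \<theta> b0 * v" for v
      by (rule monic_dvd_cancel[OF ma bV monic_nonzero[OF mb] that])
    show "\<exists>u' v'. w = \<theta> a0 * u' + \<theta> b0 * v'" if "\<theta> c0 * w = \<theta> a0 * u + \<theta> b0 * v" for w u v
      by (rule monic_regular_sequence[OF ma mb bV c0(2)[unfolded T_def] c0(3) that])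
  qed
  then have "regular_triple a0 b0 c0" by (rule graded_aut_regular_triple[OF g])
  then show ?thesis using a0(1) b0(1) c0(1) by blast
qed

section \<open>Complete intersections of two forms and their colon ideals\<close>

lemma bin_mono: "s \<le> t \<Longrightarrow> bin N s \<le> bin N t"
proof (induction N arbitrary: s t)
  case (Suc N)
  show ?case using Suc.prems
  proof (induction t)
    case (Suc t)
    then show ?case by (cases "s = Suc t") (auto simp: bin_Suc)
  qed simp
qed simp

lemma bin_diff: "j \<le> t \<Longrightarrow> bin (Suc N) t = bin (Suc N) (t - j) + (\<Sum>i<j. bin N (t - i))"
proof (induction j)
  case (Suc j)
  then have "t - j = Suc (t - Suc j)" by simp
  then have "bin (Suc N) (t - j) = bin (Suc N) (t - Suc j) + bin N (t - j)" using bin_Suc[of N "t - Suc j"] by simp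
  then show ?case using Suc by simp
qed simp

lemma bin_absorb: "Suc N * bin (Suc N) t = (t + Suc N) * bin N t"
  using Suc_times_binomial_eq[of "t + N" N] by (simp add: bin_def mult.commute)

text \<open>Regularity of \<open>q\<close> modulo \<open>p\<close> leaves only Koszul syzygies,
  parametrized by \<open>forms (t - 2 * d)\<close>. The bound makes the ideal \<open>(p, q)\<close>
  large enough to contain a form free of one variable.\<close>

lemma dim_two_generators:
  fixes p q :: "('n::finite, 'k::field) mpoly"
  assumes p: "p \<in> forms d" "p \<noteq> 0" and q: "q \<in> forms d" and reg: "\<And>v. p dvd q * v \<Longrightarrow> p dvd v" and t: "2 * d \<le> t"
  shows "2 * card (mons (UNIV :: 'n set) (t - d)) \<le>
    mp.dim ({p * u + q * v | u v. True} \<inter> forms t) + card (mons (UNIV :: 'n set) (t - 2 * d))"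
proof -
  let ?R = "forms (t - d) :: ('n, 'k) mpoly set"
  let ?sc = "scale_prod pm_scale pm_scale :: 'k \<Rightarrow> ('n, 'k) mpoly \<times> ('n, 'k) mpoly \<Rightarrow> _"
  interpret pr: vector_space ?sc by (rule vector_space_scale_prod[OF vector_space_pm_scale vector_space_pm_scale])
  interpret f: vector_space_pair ?sc "pm_scale :: 'k \<Rightarrow> ('n, 'k) mpoly \<Rightarrow> _" by unfold_locales
  interpret b: vector_space_pair "pm_scale :: 'k \<Rightarrow> ('n, 'k) mpoly \<Rightarrow> _" ?sc by unfold_locales
  have T: "pr.subspace (?R \<times> ?R)" "fin_span ?sc (?R \<times> ?R)" "pr.dim (?R \<times> ?R) = mp.dim ?R + mp.dim ?R"
    by (rule dim_Times[OF vector_space_pm_scale vector_space_pm_scale forms_subspace fin_span_forms forms_subspace fin_span_forms])+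
  define \<phi> where "\<phi> x = p * fst x + q * snd x" for x :: "('n, 'k) mpoly \<times> ('n, 'k) mpoly"
  define \<psi> where "\<psi> h = (- q * h, p * h)" for h :: "('n, 'k) mpoly"
  have l1: "Vector_Spaces.linear ?sc pm_scale \<phi>"
    by unfold_locales (auto simp: \<phi>_def scale_prod_def pm_scale_cst algebra_simps)
  have l2: "Vector_Spaces.linear pm_scale ?sc \<psi>"
    by unfold_locales (auto simp: \<psi>_def scale_prod_def pm_scale_cst algebra_simps)
  have td: "d + (t - d) = t" using t by simp
  have "pr.dim (?R \<times> ?R) = mp.dim (\<phi> ` (?R \<times> ?R)) + pr.dim {x \<in> ?R \<times> ?R. \<phi> x = 0}"
    by (rule f.rank_nullity_fin_span[OF l1 T(1,2)])
  moreover have "mp.dim (\<phi> ` (?R \<times> ?R)) \<le> mp.dim ({p * u + q * v | u v. True} \<inter> forms t)"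
  proof (rule mp.dim_mono_fin_span)
    show "\<phi> ` (?R \<times> ?R) \<subseteq> {p * u + q * v | u v. True} \<inter> forms t"
    proof (rule subsetI, elim imageE)
      fix x y assume x: "x = \<phi> y" "y \<in> ?R \<times> ?R"
      have "p * fst y \<in> forms t" using forms_mult[OF p(1), of "fst y" "t - d"] x(2) td by auto
      moreover have "q * snd y \<in> forms t" using forms_mult[OF q, of "snd y" "t - d"] x(2) td by auto
      ultimately show "x \<in> {p * u + q * v | u v. True} \<inter> forms t" unfolding x(1) \<phi>_def by blast
    qed
  qed simp
  moreover have "pr.dim {x \<in> ?R \<times> ?R. \<phi> x = 0} \<le> card (mons (UNIV :: 'n set) (t - 2 * d))"
  proof -
    have "{x \<in> ?R \<times> ?R. \<phi> x = 0} \<subseteq> \<psi> ` forms (t - 2 * d)"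
    proof
      fix x assume x: "x \<in> {x \<in> ?R \<times> ?R. \<phi> x = 0}"
      then have e: "p * fst x = - (q * snd x)" by (simp add: \<phi>_def eq_neg_iff_add_eq_0)
      then have "q * snd x = p * (- fst x)" by simp
      then have "p dvd q * snd x" by (rule dvdI)
      then obtain h where h: "snd x = p * h" using reg by (elim dvdE[OF reg])
      have "p * fst x = p * (- q * h)" using e unfolding h by (simp add: algebra_simps)
      then have fx: "fst x = - q * h" using p(2) by (simp only: mpoly_mult_left_cancel simp_thms)
      have "h \<in> forms (t - 2 * d)"
      proof (cases "h = 0")
        case False
        have "p * h \<in> forms (t - d)" using x h by auto
        from forms_mult_cancel[OF this] False p(2) obtain a where a: "p \<in> forms a" "h \<in> forms (t - d - a)" by auto
        have "a = d" by (rule forms_unique[OF a(1) p])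
        then show ?thesis using a(2) by (simp add: mult_2)
      qed simp
      then show "x \<in> \<psi> ` forms (t - 2 * d)"
        by (intro image_eqI[of _ _ h]) (simp_all add: \<psi>_def prod_eq_iff h fx)
    qed
    then have "pr.dim {x \<in> ?R \<times> ?R. \<phi> x = 0} \<le> pr.dim (\<psi> ` forms (t - 2 * d))"
      by (rule pr.dim_mono_fin_span[OF b.fin_span_image[OF l2 fin_span_forms]])
    also have "\<dots> \<le> mp.dim (forms (t - 2 * d) :: ('n, 'k) mpoly set)"
      by (rule b.dim_image_le_fin_span[OF l2 forms_subspace fin_span_forms])
    finally show ?thesis by (simp add: dim_forms)
  qed
  ultimately show ?thesis using T(3) by (simp add: dim_forms)
qed

text \<open>A complete intersection of two forms of degree \<open>d\<close> has multiplicity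
  \<open>d ^ 2\<close>: the second difference of step \<open>d\<close> is a sum of
  \<open>d * d\<close> values of \<open>bin N\<close>, each at most \<open>bin N t\<close>.\<close>

lemma second_difference_bin:
  assumes "2 * d \<le> t"
  shows "bin (N + 2) t + bin (N + 2) (t - 2 * d) \<le> 2 * bin (N + 2) (t - d) + d ^ 2 * bin N t"
proof -
  have 1: "bin (N + 2) t = bin (N + 2) (t - d) + (\<Sum>i<d. bin (N + 1) (t - i))"
    using bin_diff[of d t "N + 1"] assms by simp
  have 2: "bin (N + 2) (t - d) = bin (N + 2) (t - 2 * d) + (\<Sum>i<d. bin (N + 1) (t - d - i))"
    using bin_diff[of d "t - d" "N + 1"] assms by (simp add: mult_2)
  have "bin (N + 1) (t - i) \<le> bin (N + 1) (t - d - i) + d * bin N t" if "i < d" for i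
  proof -
    have "bin (N + 1) (t - i) = bin (N + 1) (t - i - d) + (\<Sum>l<d. bin N (t - i - l))"
      using bin_diff[of d "t - i" N] assms that by simp
    also have "(\<Sum>l<d. bin N (t - i - l)) \<le> (\<Sum>l<d. bin N t)"
      by (intro sum_mono bin_mono) simp
    finally show ?thesis by (simp add: add.commute diff_diff_left)
  qed
  then have "(\<Sum>i<d. bin (N + 1) (t - i)) \<le> (\<Sum>i<d. bin (N + 1) (t - d - i) + d * bin N t)"
    by (intro sum_mono) simp
  also have "\<dots> = (\<Sum>i<d. bin (N + 1) (t - d - i)) + d ^ 2 * bin N t"
    by (simp add: sum.distrib power2_eq_square)
  finally show ?thesis using 1 2 by linarith
qed

text \<open>Unmixedness of \<open>(p, q)\<close> by linkage. The element \<open>\<rho>\<close> acts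
  as a resultant with respect to \<open>z\<close>, and \<open>p\<close>, \<open>\<rho>\<close>,
  \<open>c\<close> are in triangular position. Since \<open>q * \<beta>\<close> is
  \<open>\<rho>\<close> modulo \<open>p\<close>, an element lies in \<open>(p, q)\<close> as soon as
  its product with \<open>\<beta>\<close> lies in \<open>(p, \<rho>)\<close>.\<close>

lemma colon_saturated:
  fixes p q f \<rho> :: "('n::finite, 'k::field) mpoly"
  assumes p: "monic_in z p" and \<rho>: "monic_in y \<rho>" "\<rho> \<in> polys (- {z})" "\<rho> = p * \<alpha> + q * \<beta>"
    and c: "c \<in> polys (- {y, z})" "c \<noteq> 0" and cw: "f * (c * w) = p * u + q * v"
  shows "\<exists>u v. f * w = p * u + q * v"
proof -
  have qb: "q * \<beta> = \<rho> - p * \<alpha>" using \<rho>(3) by simp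
  have "c * (f * w * \<beta>) = (f * (c * w)) * \<beta>" by (simp add: ac_simps)
  also have "\<dots> = p * (u * \<beta>) + (q * \<beta>) * v" unfolding cw by (simp add: algebra_simps)
  also have "\<dots> = p * (u * \<beta> - \<alpha> * v) + \<rho> * v" unfolding qb by (simp add: algebra_simps)
  finally obtain u' v' where uv: "f * w * \<beta> = p * u' + \<rho> * v'"
    using monic_regular_sequence[OF p \<rho>(1,2) c] by blast
  define X where "X = f * w - q * v'"
  have bX: "\<beta> * X = p * (u' + \<alpha> * v')"
  proof -
    have "\<beta> * X = f * w * \<beta> - (q * \<beta>) * v'" unfolding X_def by (simp add: algebra_simps)
    also have "\<dots> = p * (u' + \<alpha> * v')" unfolding uv qb by (simp add: algebra_simps)
    finally show ?thesis .
  qed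
  \<comment> \<open>The factor \<open>\<beta>\<close> is cancelled modulo \<open>p\<close> by
    completing it to \<open>\<rho>\<close>, which is regular modulo \<open>p\<close>.\<close>
  have "\<rho> * X = p * (\<alpha> * X) + q * (\<beta> * X)" unfolding \<rho>(3) by (simp add: algebra_simps)
  also have "\<dots> = p * (\<alpha> * X + q * (u' + \<alpha> * v'))" unfolding bX by (simp add: algebra_simps)
  finally have "p dvd \<rho> * X" by (rule dvdI)
  then have "p dvd X" by (rule monic_dvd_cancel[OF p \<rho>(2) monic_nonzero[OF \<rho>(1)]])
  then obtain h where "X = p * h" by (elim dvdE)
  then have "f * w = p * h + q * v'" by (simp add: X_def algebra_simps)
  then show ?thesis by blast
qed

definition colon_ideal :: "'a::comm_ring_1 \<Rightarrow> 'a \<Rightarrow> 'a \<Rightarrow> 'a set" where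
  "colon_ideal p q f = {w. \<exists>u v. f * w = p * u + q * v}"

lemma is_ideal_colon: "is_ideal (colon_ideal p q f)"
  unfolding is_ideal_iff
proof (intro conjI ballI allI)
  have "f * 0 = p * 0 + q * 0" by simp
  then show "0 \<in> colon_ideal p q f" unfolding colon_ideal_def by blast
  fix w assume "w \<in> colon_ideal p q f"
  then obtain u v where uv: "f * w = p * u + q * v" unfolding colon_ideal_def by blast
  have "f * (c * w) = p * (c * u) + q * (c * v)" for c
  proof -
    have "f * (c * w) = c * (f * w)" by (simp add: ac_simps)
    then show ?thesis unfolding uv by (simp add: algebra_simps)
  qed
  then show "c * w \<in> colon_ideal p q f" for c unfolding colon_ideal_def by blast
  fix w' assume "w' \<in> colon_ideal p q f"
  then obtain u' v' where uv': "f * w' = p * u' + q * v'" unfolding colon_ideal_def by blast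
  have "f * (w + w') = p * (u + u') + q * (v + v')" using uv uv' by (simp add: algebra_simps)
  then show "w + w' \<in> colon_ideal p q f" unfolding colon_ideal_def by blast
qed

text \<open>Among the nonzero elements of the colon ideal free of \<open>z\<close>, a suitable
  \<open>u\<close> of least degree in \<open>y\<close> divides \<open>\<rho>\<close>. A divisor of a
  form monic in \<open>y\<close> is again a form monic in \<open>y\<close>, so the degree of
  \<open>u\<close> in \<open>y\<close> is its degree as a form, to which \<open>low\<close>
  applies.\<close>

lemma colon_degree_bound:
  fixes p q f \<rho> :: "('n::finite, 'k::field) mpoly"
  assumes yz: "y \<noteq> z" and p: "monic_in z p"
    and \<rho>: "\<rho> \<in> forms e" "evalp (unit_pt y) \<rho> \<noteq> 0" "\<rho> \<in> polys (- {z})" "\<rho> = p * \<alpha> + q * \<beta>"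
    and low: "\<And>g t. g \<in> colon_ideal p q f \<Longrightarrow> g \<in> forms t \<Longrightarrow> g \<noteq> 0 \<Longrightarrow> d \<le> t"
    and u0: "u0 \<in> colon_ideal p q f" "u0 \<in> polys (- {z})" "u0 \<noteq> 0"
  shows "d \<le> deg_in y u0"
proof (rule ccontr)
  assume lt: "\<not> d \<le> deg_in y u0"
  let ?C = "colon_ideal p q f"
  note iC = is_ideal_colon[of p q f]
  have m\<rho>: "monic_in y \<rho>" by (rule monic_in_form[OF \<rho>(1,2)])
  have sat: "w \<in> ?C" if c: "c \<in> polys (- {y, z})" "c \<noteq> 0" and w: "c * w \<in> ?C" for c w
  proof -
    obtain u v where "f * (c * w) = p * u + q * v" using w unfolding colon_ideal_def by blast
    from colon_saturated[OF p m\<rho> \<rho>(3,4) c this] show ?thesis unfolding colon_ideal_def by simp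
  qed
  define S where "S u \<longleftrightarrow> u \<in> ?C \<and> u \<in> polys (- {z}) \<and> u \<noteq> 0" for u
  define e0 where "e0 = arg_min (deg_in y) S"
  have e0: "S e0" unfolding e0_def by (rule arg_min_natI[of S u0]) (use u0 in \<open>simp add: S_def\<close>)
  have e0min: "deg_in y e0 \<le> deg_in y v" if "S v" for v unfolding e0_def by (rule arg_min_nat_le[of S v, OF that])
  define td where "td g = (\<Sum>x\<in>UNIV. deg_in x g)" for g :: "('n, 'k) mpoly"
  \<comment> \<open>A second minimization: least total degree among the elements of least degree in
    \<open>y\<close> excludes prime factors free of \<open>y\<close> and \<open>z\<close>, since
    \<open>sat\<close> allows dividing them out.\<close>
  define S' where "S' u \<longleftrightarrow> S u \<and> deg_in y u = deg_in y e0" for u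
  define u where "u = arg_min td S'"
  have u': "S' u" unfolding u_def by (rule arg_min_natI[of S' e0]) (use e0 in \<open>simp add: S'_def\<close>)
  have umin: "td u \<le> td v" if "S' v" for v unfolding u_def by (rule arg_min_nat_le[of S' v, OF that])
  have u: "u \<in> ?C" "u \<in> polys (- {z})" "u \<noteq> 0" "deg_in y u = deg_in y e0" using u' by (auto simp: S'_def S_def)
  define a where "a = coef y (deg_in y u) u"
  have "a \<in> polys (- {z} - {y})" unfolding a_def by (rule coef_polys[OF u(2)])
  moreover have "- {z} - {y} = - {y, z}" by auto
  ultimately have aV: "a \<in> polys (- {y, z})" by simp
  have a0: "a \<noteq> 0" unfolding a_def by (rule lc_nonzero[OF u(3)])
  have yV: "y \<in> - {z}" using yz by simp
  obtain M Q r where Q: "a ^ M * \<rho> = Q * u + r" "r = 0 \<or> deg_in y r < deg_in y u" "r \<in> polys (- {z})"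
    using pseudo_division[OF u(3) \<rho>(3) u(2) yV] unfolding a_def by blast
  have "f * \<rho> = p * (f * \<alpha>) + q * (f * \<beta>)" unfolding \<rho>(4) by (simp add: algebra_simps)
  then have "\<rho> \<in> ?C" unfolding colon_ideal_def by blast
  then have "a ^ M * \<rho> - Q * u \<in> ?C" using is_idealD(3,4)[OF iC] u(1) by blast
  then have rC: "r \<in> ?C" using Q(1) by simp
  have r0: "r = 0"
  proof (rule ccontr)
    assume "r \<noteq> 0"
    then have "S r" using rC Q(3) by (simp add: S_def)
    then show False using e0min Q(2) \<open>r \<noteq> 0\<close> u(4) by fastforce
  qed
  have aM: "a ^ M \<in> polys (- {y, z})" "a ^ M \<noteq> 0" using polys_power[OF aV] a0 by simp_all
  \<comment> \<open>Gauss' lemma: \<open>u\<close> is primitive over the polynomials free of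
    \<open>y\<close> and \<open>z\<close>, so the denominator \<open>a ^ M\<close> must divide the
    cofactor \<open>Q\<close>.\<close>
  have "a ^ M dvd Q"
  proof (rule prime_prod_cancel[OF prime_prod_all[OF aM(2)], of u])
    fix p0 assume p0: "prime_in UNIV p0" "p0 dvd a ^ M"
    have p0V: "p0 \<in> polys (- {y, z})" by (rule polys_dvd[OF p0(2) aM(2,1)])
    have p0n: "p0 \<noteq> 0" by (rule prime_in_nonzero[OF p0(1)])
    show "\<not> p0 dvd u"
    proof
      assume "p0 dvd u"
      then obtain v where v: "u = p0 * v" by (elim dvdE)
      have v0: "v \<noteq> 0" using u(3) v by auto
      have "v \<in> ?C" by (rule sat[OF p0V p0n]) (use u(1) v in simp)
      moreover have "v \<in> polys (- {z})" using u(2) polys_mult_iff[OF p0n v0] unfolding v by blast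
      moreover have "deg_in y v = deg_in y u" unfolding v deg_in_mult[OF p0n v0] using deg_in_polys[OF p0V, of y] by simp
      ultimately have "S' v" using v0 u(4) by (simp add: S'_def S_def)
      then have "td u \<le> td v" by (rule umin)
      moreover have "td u = td p0 + td v" unfolding v td_def by (simp add: deg_in_mult[OF p0n v0] sum.distrib)
      ultimately have "td p0 = 0" by simp
      then have "p0 \<in> polys {}" unfolding polys_iff_deg_in by (simp add: td_def)
      then show False using p0(1) by (auto simp: polys_empty prime_in_def)
    qed
  next
    show "a ^ M dvd u * Q" using Q(1) unfolding r0 by (metis add.right_neutral dvd_triv_left mult.commute)
  qed auto
  then obtain Q' where "Q = a ^ M * Q'" by (elim dvdE)
  then have "a ^ M * \<rho> = a ^ M * (Q' * u)" using Q(1) r0 by (simp add: mult.assoc)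
  then have \<rho>u: "\<rho> = Q' * u" using aM(2) by (simp only: mpoly_mult_left_cancel simp_thms)
  have "\<rho> \<noteq> 0" by (rule monic_nonzero[OF m\<rho>])
  then obtain t where ut: "u \<in> forms t" using forms_mult_cancel[of Q' u e] \<rho>(1) unfolding \<rho>u by blast
  have "d \<le> t" by (rule low[OF u(1) ut u(3)])
  moreover have "evalp (unit_pt y) u \<noteq> 0" using \<rho>(2) unfolding \<rho>u by (auto simp: evalp_mult)
  then have "deg_in y u = t" by (rule monic_form(1)[OF ut])
  moreover have "deg_in y u \<le> deg_in y u0" unfolding u(4) using u0 by (intro e0min) (simp add: S_def)
  ultimately show False using lt by simp
qed

text \<open>In suitable coordinates no nonzero element of the colon ideal is supported on the
  monomials free of \<open>z\<close> whose exponent of \<open>y\<close> is below \<open>d\<close>.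
  Their number, counted by the exponent \<open>j\<close> of \<open>y\<close>, is the sum.\<close>

lemma colon_hilbert_bound:
  fixes p q f :: "('n::finite, 'k::field_char_0) mpoly"
  assumes n: "CARD('n) = N + 3" and p: "p \<in> forms d" "p \<noteq> 0" and q: "q \<in> forms d"
    and reg: "\<And>v. p dvd q * v \<Longrightarrow> p dvd v"
    and low: "\<And>g t. g \<in> colon_ideal p q f \<Longrightarrow> g \<in> forms t \<Longrightarrow> g \<noteq> 0 \<Longrightarrow> d \<le> t"
    and t: "d \<le> t"
  shows "mp.dim (colon_ideal p q f \<inter> forms t) + (\<Sum>j<d. bin N (t - j)) \<le> card (mons (UNIV :: 'n set) t)"
proof -
  obtain y z :: 'n where yz: "y \<noteq> z" using two_distinct[where 'n='n] n by auto
  have yV: "y \<in> - {z}" using yz by simp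
  obtain a where a: "a z = 0" "evalp (unit_pt z) (shear z a p) \<noteq> 0"
    using make_monic[OF p, of UNIV z] by auto
  have g1: "graded_aut (shear z a)" by (rule graded_aut_shear) (rule a(1))
  define p1 where "p1 = shear z a p"
  define q1 where "q1 = shear z a q"
  have p1: "p1 \<in> forms d" "p1 \<noteq> 0" and q1: "q1 \<in> forms d"
    using p q gautD(5,8)[OF g1] by (simp_all add: p1_def q1_def)
  have reg1: "p1 dvd v" if "p1 dvd q1 * v" for v
  proof -
    obtain v' where v': "v = shear z a v'" using gautD(9)[OF g1] by blast
    have "shear z a p dvd shear z a (q * v')" using that gautD(2)[OF g1, of q v'] by (simp add: p1_def q1_def v')
    then have "p dvd q * v'" by (rule iffD1[OF graded_aut_dvd[OF g1]])
    then have "p dvd v'" by (rule reg)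
    then show ?thesis using graded_aut_dvd[OF g1] by (simp add: p1_def v')
  qed
  \<comment> \<open>With 1 as the third argument the colon ideal is the ideal
    \<open>(p1, q1)\<close> itself.\<close>
  define I where "I = colon_ideal p1 q1 1"
  have iI: "is_ideal I" unfolding I_def by (rule is_ideal_colon)
  \<comment> \<open>The first summand gives \<open>d ^ 2 * bin N t0 < bin (N + 1) t0\<close> by
    \<open>bin_absorb\<close>, so that \<open>(p1, q1)\<close> contains a form of degree
    \<open>t0\<close> free of \<open>z\<close>; the second makes room for the Koszul count.\<close>
  define t0 where "t0 = Suc N * d ^ 2 + 2 * d"
  have t0: "2 * d \<le> t0" by (simp add: t0_def)
  have cU: "card (mons (UNIV :: 'n set) s) = bin (N + 2) s" for s by (rule card_mons) (simp add: n)
  have cz: "card (mons (- {z} :: 'n set) s) = bin (N + 1) s" for s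
    by (rule card_mons) (simp add: n Compl_eq_Diff_UNIV card_Diff_subset)
  have "{p1 * u + q1 * v | u v. True} = I" unfolding I_def colon_ideal_def by auto
  then have dI: "2 * bin (N + 2) (t0 - d) \<le> mp.dim (I \<inter> forms t0) + bin (N + 2) (t0 - 2 * d)"
    using dim_two_generators[OF p1 q1 reg1 t0] by (simp add: cU)
  have "Suc N * (d ^ 2 * bin N t0) < Suc N * bin (Suc N) t0"
  proof -
    have "Suc N * d ^ 2 < t0 + Suc N" by (simp add: t0_def)
    moreover have "bin N t0 > 0" by (simp add: bin_def)
    ultimately have "(Suc N * d ^ 2) * bin N t0 < (t0 + Suc N) * bin N t0" by (rule mult_strict_right_mono)
    then show ?thesis unfolding bin_absorb by (simp only: mult.assoc)
  qed
  then have "d ^ 2 * bin N t0 < bin (N + 1) t0" unfolding Suc_mult_less_cancel1 by simp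
  then have "mp.dim (I \<inter> forms t0) + card (mons (- {z} :: 'n set) t0) > card (mons (UNIV :: 'n set) t0)"
    using dI second_difference_bin[OF t0, of N] by (simp add: cU cz)
  from meets_coordinate_subring[OF iI this] obtain \<rho>0 where
    \<rho>0: "\<rho>0 \<in> I" "\<rho>0 \<in> forms t0" "\<rho>0 \<in> polys (- {z})" "\<rho>0 \<noteq> 0" by blast
  obtain b where b: "b y = 0" "\<forall>i. i \<notin> - {z} \<longrightarrow> b i = 0" "evalp (unit_pt y) (shear y b \<rho>0) \<noteq> 0"
    using make_monic[OF \<rho>0(2,4,3) yV] by blast
  have bz: "b z = 0" using b(2) by simp
  have g2: "graded_aut (shear y b)" by (rule graded_aut_shear) (rule b(1))
  define \<theta> where "\<theta> g = shear y b (shear z a g)" for g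
  have g: "graded_aut \<theta>" unfolding \<theta>_def by (rule graded_aut_comp[OF g2 g1])
  note D = gautD[OF g]
  obtain \<alpha>0 \<beta>0 where ab: "\<rho>0 = p1 * \<alpha>0 + q1 * \<beta>0" using \<rho>0(1) unfolding I_def colon_ideal_def by auto
  define \<rho> where "\<rho> = shear y b \<rho>0"
  have \<rho>4: "\<rho> = \<theta> p * shear y b \<alpha>0 + \<theta> q * shear y b \<beta>0"
    unfolding \<rho>_def ab \<theta>_def p1_def q1_def by (simp add: gautD(1,2)[OF g2])
  have \<rho>: "\<rho> \<in> forms t0" "evalp (unit_pt y) \<rho> \<noteq> 0" "\<rho> \<in> polys (- {z})"
    unfolding \<rho>_def by (rule shear_forms[OF \<rho>0(2)], rule b(3), rule shear_polys[OF \<rho>0(3) yV])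
  note \<rho> = \<rho> \<rho>4
  have "\<theta> p \<in> forms d" using p(1) D(5) by simp
  then have mp: "monic_in z (\<theta> p)"
    by (rule monic_in_form) (use a(2) evalp_unit_shear[of z y b] yz bz in \<open>simp add: \<theta>_def\<close>)
  have img: "\<theta> ` colon_ideal p q f = colon_ideal (\<theta> p) (\<theta> q) (\<theta> f)"
  proof (intro set_eqI iffI)
    fix w assume "w \<in> \<theta> ` colon_ideal p q f"
    then obtain w' u v where w': "w = \<theta> w'" "f * w' = p * u + q * v" unfolding colon_ideal_def by blast
    from arg_cong[OF w'(2), of \<theta>] show "w \<in> colon_ideal (\<theta> p) (\<theta> q) (\<theta> f)"
      unfolding colon_ideal_def w'(1) D(1) D(2) by blast
  next
    fix w assume "w \<in> colon_ideal (\<theta> p) (\<theta> q) (\<theta> f)"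
    then obtain u v where uv: "\<theta> f * w = \<theta> p * u + \<theta> q * v" unfolding colon_ideal_def by blast
    obtain w' u' v' where pre: "w = \<theta> w'" "u = \<theta> u'" "v = \<theta> v'" using D(9) by metis
    have "\<theta> (f * w') = \<theta> (p * u' + q * v')" using uv unfolding pre by (simp add: D(1) D(2))
    then have "f * w' = p * u' + q * v'" using D(7) by blast
    then show "w \<in> \<theta> ` colon_ideal p q f" unfolding pre colon_ideal_def by blast
  qed
  have low': "d \<le> s" if gg: "g \<in> colon_ideal (\<theta> p) (\<theta> q) (\<theta> f)" "g \<in> forms s" "g \<noteq> 0" for g s
  proof -
    obtain g' where g': "g = \<theta> g'" "g' \<in> colon_ideal p q f" using gg(1) img by blast
    show ?thesis by (rule low[OF g'(2)]) (use gg(2,3) g'(1) D(5,6) in auto)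
  qed
  define M where "M = {m \<in> mons (- {z} :: 'n set) t. lkp m y < d}"
  have "mp.dim (\<theta> ` colon_ideal p q f \<inter> forms t) + card M \<le> card (mons (UNIV :: 'n set) t)"
  proof (rule dim_disjoint_monomials)
    show "mp.subspace (\<theta> ` colon_ideal p q f \<inter> forms t)"
      by (rule ideal_forms_subspace[OF graded_aut_ideal[OF g is_ideal_colon]])
    show "M \<subseteq> mons UNIV t" using mons_subset unfolding M_def by blast
    fix g assume gC: "g \<in> \<theta> ` colon_ideal p q f \<inter> forms t" and gM: "kys g \<subseteq> M"
    show "g = 0"
    proof (rule ccontr)
      assume g0: "g \<noteq> 0"
      have "kys g \<subseteq> mons (- {z}) t" using gM unfolding M_def by blast
      then have gV: "g \<in> polys (- {z})" by (simp add: keys_mons_iff)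
      have "d \<le> deg_in y g"
        by (rule colon_degree_bound[OF yz mp \<rho> low' _ gV g0]) (use gC img in auto)
      moreover obtain m where "lkp (coef y (deg_in y g) g) m \<noteq> 0"
        using lc_nonzero[OF g0, of y] by (metis lookup_zero poly_mapping_eqI)
      then have m: "lkp m y = 0" "lkp g (m + sng y (deg_in y g)) \<noteq> 0" by (auto simp: lookup_coef split: if_splits)
      then have "m + sng y (deg_in y g) \<in> M" using gM by (auto simp: in_keys_iff)
      then have "deg_in y g < d" using m(1) by (simp add: M_def lookup_add)
      ultimately show False by simp
    qed
  qed blast
  moreover have "card M = (\<Sum>j<d. bin N (t - j))"
  proof -
    have V: "- {z} = insert y (- {y, z})" using yz by auto
    have "card M = (\<Sum>j\<le>t. card {m \<in> mons (- {y, z}) (t - j). lkp (m + sng y j) y < d})"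
      unfolding M_def V by (rule card_mons_slices) simp
    also have "\<dots> = (\<Sum>j\<le>t. if j < d then bin N (t - j) else 0)"
    proof (rule sum.cong[OF refl])
      fix j
      have "lkp (m + sng y j) y = j" if "m \<in> mons (- {y, z}) (t - j)" for m
      proof -
        have "y \<notin> kys m" using that by (auto simp: mons_def)
        then show ?thesis by (simp add: lookup_add in_keys_iff)
      qed
      then have "{m \<in> mons (- {y, z}) (t - j). lkp (m + sng y j) y < d} = (if j < d then mons (- {y, z}) (t - j) else {})"
        by auto
      moreover have "card (mons (- {y, z}) (t - j)) = bin N (t - j)"
        by (rule card_mons) (simp add: card_Compl_two[OF yz] n)
      ultimately show "card {m \<in> mons (- {y, z}) (t - j). lkp (m + sng y j) y < d} = (if j < d then bin N (t - j) else 0)"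
        by simp
    qed
    also have "\<dots> = (\<Sum>j\<in>{..t} \<inter> {j. j < d}. bin N (t - j))" by (subst sum.inter_restrict) auto
    also have "{..t} \<inter> {j. j < d} = {..<d}" using t by auto
    finally show ?thesis .
  qed
  ultimately show ?thesis using graded_aut_dim[OF g is_ideal_colon, of p q f t] by simp
qed

section \<open>Syzygies of three forms\<close>

lemma coprime_triple_dvd:
  fixes w v :: "('n::finite, 'k::field) mpoly"
  assumes "w \<noteq> 0" "w dvd v * s1" "w dvd v * s2" "w dvd v * s3"
    and "\<And>p. prime_in UNIV p \<Longrightarrow> \<not> (p dvd s1 \<and> p dvd s2 \<and> p dvd s3)"
  shows "w dvd v"
proof (rule coprime_family_dvd[of w "{0, 1, 2 :: nat}" v "\<lambda>j. if j = 0 then s1 else if j = 1 then s2 else s3"])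
  fix p :: "('n, 'k) mpoly" assume "prime_in UNIV p"
  then show "\<exists>j\<in>{0, 1, 2 :: nat}. \<not> p dvd (if j = 0 then s1 else if j = 1 then s2 else s3)"
    using assms(5)[of p] by auto
qed (use assms(1-4) in auto)

text \<open>As \<open>s1\<close> divides \<open>t1 * s2\<close> and \<open>t1 * s3\<close>, and
  trivially \<open>t1 * s1\<close>, coprimality makes it divide \<open>t1\<close>; the quotient is
  \<open>h\<close>.\<close>

lemma proportional_to_coprime_triple:
  fixes s1 :: "('n::finite, 'k::field) mpoly"
  assumes "s1 \<noteq> 0" "s1 * t2 = s2 * t1" "s1 * t3 = s3 * t1"
    and "\<And>p. prime_in UNIV p \<Longrightarrow> \<not> (p dvd s1 \<and> p dvd s2 \<and> p dvd s3)"
  shows "\<exists>h. t1 = h * s1 \<and> t2 = h * s2 \<and> t3 = h * s3"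
proof -
  have "t1 * s2 = s1 * t2" "t1 * s3 = s1 * t3" unfolding assms(2,3) by (rule mult.commute)+
  then have "s1 dvd t1 * s2" "s1 dvd t1 * s3" by (auto intro: dvdI)
  then have "s1 dvd t1" by (rule coprime_triple_dvd[OF assms(1) dvd_triv_right _ _ assms(4)])
  then obtain h where h: "t1 = s1 * h" by (elim dvdE)
  have "s1 * t2 = s1 * (h * s2)" "s1 * t3 = s1 * (h * s3)"
    using assms(2,3) unfolding h by (simp_all only: ac_simps)
  then have "t2 = h * s2" "t3 = h * s3" using assms(1) by (simp_all only: mpoly_mult_left_cancel simp_thms)
  then show ?thesis using h by (intro exI[of _ h]) (simp add: mult.commute)
qed

locale three_forms =
  fixes f1 f2 f3 :: "('n::finite, 'k::field_char_0) mpoly" and d :: nat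
  assumes forms_f: "f1 \<in> forms d" "f2 \<in> forms d" "f3 \<in> forms d"
    and nonzero_f: "f1 \<noteq> 0" "f2 \<noteq> 0" "f3 \<noteq> 0"
    and coprime_f: "\<And>p. prime_in UNIV p \<Longrightarrow> \<not> (p dvd f1 \<and> p dvd f2 \<and> p dvd f3)"
begin

definition syz where "syz t1 t2 t3 \<longleftrightarrow> t1 * f1 + t2 * f2 + t3 * f3 = 0"

definition J where "J = {a * f1 + b * f2 + c * f3 | a b c. True}"

definition cross where
  "cross s1 s2 s3 t1 t2 t3 c \<longleftrightarrow>
     s2 * t3 - s3 * t2 = c * f1 \<and> s3 * t1 - s1 * t3 = c * f2 \<and> s1 * t2 - s2 * t1 = c * f3"

lemma cross_exists:
  assumes "syz s1 s2 s3" "syz t1 t2 t3"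
  shows "\<exists>c. cross s1 s2 s3 t1 t2 t3 c"
proof -
  let ?m1 = "s2 * t3 - s3 * t2" and ?m2 = "s3 * t1 - s1 * t3" and ?m3 = "s1 * t2 - s2 * t1"
  \<comment> \<open>A component of the identity that expands
    \<open>f \<times> (s \<times> t)\<close> through the inner products of \<open>f\<close> with
    \<open>s\<close> and \<open>t\<close>, both of which vanish.\<close>
  have "f1 * ?m2 - f2 * ?m1 = s3 * (t1 * f1 + t2 * f2 + t3 * f3) - t3 * (s1 * f1 + s2 * f2 + s3 * f3)"
    by (simp add: algebra_simps)
  then have 1: "f1 * ?m2 = f2 * ?m1" using assms by (simp add: syz_def)
  have "f1 * ?m3 - f3 * ?m1 = t2 * (s1 * f1 + s2 * f2 + s3 * f3) - s2 * (t1 * f1 + t2 * f2 + t3 * f3)"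
    by (simp add: algebra_simps)
  then have 2: "f1 * ?m3 = f3 * ?m1" using assms by (simp add: syz_def)
  from proportional_to_coprime_triple[OF nonzero_f(1) 1 2 coprime_f]
  show ?thesis unfolding cross_def .
qed

end

locale minimal_syzygy = three_forms f1 f2 f3 d
  for f1 f2 f3 :: "('n::finite, 'k::field_char_0) mpoly" and d :: nat +
  fixes s1 s2 s3 :: "('n, 'k) mpoly" and r :: nat
  assumes syz_s: "syz s1 s2 s3" and forms_s: "s1 \<in> forms r" "s2 \<in> forms r" "s3 \<in> forms r"
    and nonzero_s: "s1 \<noteq> 0 \<or> s2 \<noteq> 0 \<or> s3 \<noteq> 0"
    and minimal: "\<And>r' t1 t2 t3. r' < r \<Longrightarrow> t1 \<in> forms r' \<Longrightarrow> t2 \<in> forms r' \<Longrightarrow> t3 \<in> forms r' \<Longrightarrow>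
      syz t1 t2 t3 \<Longrightarrow> t1 = 0 \<and> t2 = 0 \<and> t3 = 0"
    and r_le: "r \<le> d"
begin

text \<open>A common prime factor has positive degree, and dividing it out would leave a nonzero
  syzygy of degree below \<open>r\<close>.\<close>

lemma coprime_s: assumes p: "prime_in UNIV p" shows "\<not> (p dvd s1 \<and> p dvd s2 \<and> p dvd s3)"
proof
  assume "p dvd s1 \<and> p dvd s2 \<and> p dvd s3"
  then obtain u1 u2 u3 where u: "s1 = p * u1" "s2 = p * u2" "s3 = p * u3" by (auto elim!: dvdE)
  have p0: "p \<noteq> 0" by (rule prime_in_nonzero[OF p])
  have cancel: "\<exists>a\<le>r. p \<in> forms a \<and> g \<in> forms (r - a)" if "p * g \<in> forms r" "g \<noteq> 0" for g
    using forms_mult_cancel[OF that(1)] that(2) p0 by simp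
  have "\<exists>g. p * g \<in> forms r \<and> g \<noteq> 0" using nonzero_s forms_s u by auto
  then obtain a where a: "a \<le> r" "p \<in> forms a" using cancel by blast
  have "a \<noteq> 0"
  proof
    assume "a = 0"
    then have "p \<in> range cst" using a(2) by (auto simp: forms_0_cst)
    then show False using p by (simp add: prime_in_def)
  qed
  have uf: "g \<in> forms (r - a)" if g: "p * g \<in> forms r" for g
  proof (cases "g = 0")
    case False
    obtain a' where "p \<in> forms a'" "g \<in> forms (r - a')" using cancel[OF g False] by blast
    then show ?thesis using forms_unique[OF a(2) _ p0] by blast
  qed simp
  have "p * (u1 * f1 + u2 * f2 + u3 * f3) = 0"
    using syz_s unfolding syz_def u by (simp only: distrib_left mult.assoc)
  then have "syz u1 u2 u3" using p0 unfolding syz_def by simp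
  then have "u1 = 0 \<and> u2 = 0 \<and> u3 = 0"
    using minimal[of "r - a" u1 u2 u3] uf forms_s u a \<open>a \<noteq> 0\<close> by simp
  then show False using nonzero_s u by simp
qed

lemma cross_zero:
  assumes "cross s1 s2 s3 t1 t2 t3 0"
  shows "\<exists>h. t1 = h * s1 \<and> t2 = h * s2 \<and> t3 = h * s3"
proof -
  have e: "s2 * t3 = s3 * t2" "s3 * t1 = s1 * t3" "s1 * t2 = s2 * t1" using assms by (simp_all add: cross_def)
  consider "s1 \<noteq> 0" | "s2 \<noteq> 0" | "s3 \<noteq> 0" using nonzero_s by blast
  then show ?thesis
  proof cases
    case 1
    show ?thesis by (rule proportional_to_coprime_triple[OF 1 e(3) e(2)[symmetric] coprime_s])
  next
    case 2
    have "\<exists>h. t2 = h * s2 \<and> t3 = h * s3 \<and> t1 = h * s1"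
      by (rule proportional_to_coprime_triple[OF 2 e(1) e(3)[symmetric]]) (use coprime_s in blast)
    then show ?thesis by blast
  next
    case 3
    have "\<exists>h. t3 = h * s3 \<and> t1 = h * s1 \<and> t2 = h * s2"
      by (rule proportional_to_coprime_triple[OF 3 e(2) e(1)[symmetric]]) (use coprime_s in blast)
    then show ?thesis by blast
  qed
qed

text \<open>The ideal of an exact sequence \<open>0 \<rightarrow> R \<rightarrow> Syz(J) \<rightarrow> C \<rightarrow> 0\<close> in which \<open>1\<close> maps to \<open>s\<close>.\<close>

definition C where "C = {c. \<exists>t1 t2 t3. syz t1 t2 t3 \<and> cross s1 s2 s3 t1 t2 t3 c}"

lemma cross_add: "cross s1 s2 s3 t1 t2 t3 c \<Longrightarrow> cross s1 s2 s3 t1' t2' t3' c' \<Longrightarrow>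
    cross s1 s2 s3 (t1 + t1') (t2 + t2') (t3 + t3') (c + c')"
proof -
  assume h: "cross s1 s2 s3 t1 t2 t3 c" "cross s1 s2 s3 t1' t2' t3' c'"
  have "s2 * (t3 + t3') - s3 * (t2 + t2') = (s2 * t3 - s3 * t2) + (s2 * t3' - s3 * t2')"
    "s3 * (t1 + t1') - s1 * (t3 + t3') = (s3 * t1 - s1 * t3) + (s3 * t1' - s1 * t3')"
    "s1 * (t2 + t2') - s2 * (t1 + t1') = (s1 * t2 - s2 * t1) + (s1 * t2' - s2 * t1')"
    by (simp_all add: algebra_simps)
  then show ?thesis using h unfolding cross_def by (simp add: distrib_right)
qed

lemma cross_mult: "cross s1 s2 s3 t1 t2 t3 c \<Longrightarrow> cross s1 s2 s3 (a * t1) (a * t2) (a * t3) (a * c)"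
proof -
  assume h: "cross s1 s2 s3 t1 t2 t3 c"
  have "s2 * (a * t3) - s3 * (a * t2) = a * (s2 * t3 - s3 * t2)"
    "s3 * (a * t1) - s1 * (a * t3) = a * (s3 * t1 - s1 * t3)"
    "s1 * (a * t2) - s2 * (a * t1) = a * (s1 * t2 - s2 * t1)"
    by (simp_all add: algebra_simps)
  then show ?thesis using h unfolding cross_def by (simp add: mult.assoc)
qed

lemma cross_s: "cross s1 s2 s3 s1 s2 s3 0"
  by (simp add: cross_def mult.commute)

lemma syz_add: "syz t1 t2 t3 \<Longrightarrow> syz t1' t2' t3' \<Longrightarrow> syz (t1 + t1') (t2 + t2') (t3 + t3')"
proof -
  assume h: "syz t1 t2 t3" "syz t1' t2' t3'"
  have "(t1 + t1') * f1 + (t2 + t2') * f2 + (t3 + t3') * f3 = (t1 * f1 + t2 * f2 + t3 * f3) + (t1' * f1 + t2' * f2 + t3' * f3)"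
    by (simp add: algebra_simps)
  then show ?thesis using h by (simp add: syz_def)
qed

lemma syz_mult: "syz t1 t2 t3 \<Longrightarrow> syz (a * t1) (a * t2) (a * t3)"
proof -
  assume h: "syz t1 t2 t3"
  have "(a * t1) * f1 + (a * t2) * f2 + (a * t3) * f3 = a * (t1 * f1 + t2 * f2 + t3 * f3)"
    by (simp add: algebra_simps)
  then show ?thesis using h by (simp add: syz_def)
qed

lemma ideal_C: "is_ideal C"
  unfolding is_ideal_iff
proof (intro conjI ballI allI)
  have "syz 0 0 0" "cross s1 s2 s3 0 0 0 0" by (simp_all add: syz_def cross_def)
  then show "0 \<in> C" unfolding C_def by blast
  fix c assume "c \<in> C"
  then obtain t1 t2 t3 where t: "syz t1 t2 t3" "cross s1 s2 s3 t1 t2 t3 c" unfolding C_def by blast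
  show "a * c \<in> C" for a using syz_mult[OF t(1)] cross_mult[OF t(2)] unfolding C_def by blast
  fix c' assume "c' \<in> C"
  then obtain t1' t2' t3' where t': "syz t1' t2' t3'" "cross s1 s2 s3 t1' t2' t3' c'" unfolding C_def by blast
  show "c + c' \<in> C" using syz_add[OF t(1) t'(1)] cross_add[OF t(2) t'(2)] unfolding C_def by blast
qed

text \<open>If two elements \<open>a, b\<close> of \<open>C\<close> lift to syzygies \<open>ta, tb\<close>, then \<open>b ta - a tb = w s\<close>, and a third
  element \<open>c\<close> of \<open>C\<close> multiplies \<open>w\<close> into \<open>(a, b)\<close>. For a regular triple \<open>w\<close> itself is in \<open>(a, b)\<close>,
  and the lifts can be corrected by multiples of \<open>s\<close> until \<open>b ta = a tb\<close>; then \<open>ta / a\<close> lifts \<open>1\<close>.\<close>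

lemma regular_triple_imp_one:
  assumes abc: "a \<in> C" "b \<in> C" "c \<in> C" and reg: "regular_triple a b c"
  shows "1 \<in> C"
proof -
  obtain x1 x2 x3 where x: "syz x1 x2 x3" "cross s1 s2 s3 x1 x2 x3 a" using abc(1) unfolding C_def by blast
  obtain y1 y2 y3 where y: "syz y1 y2 y3" "cross s1 s2 s3 y1 y2 y3 b" using abc(2) unfolding C_def by blast
  obtain z1 z2 z3 where z: "syz z1 z2 z3" "cross s1 s2 s3 z1 z2 z3 c" using abc(3) unfolding C_def by blast
  have rel: "\<exists>w. g * t1 - h * t1' = w * s1 \<and> g * t2 - h * t2' = w * s2 \<and> g * t3 - h * t3' = w * s3"
    if "cross s1 s2 s3 t1 t2 t3 h" "cross s1 s2 s3 t1' t2' t3' g" for g h t1 t2 t3 t1' t2' t3'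
  proof -
    have "cross s1 s2 s3 (g * t1 + - h * t1') (g * t2 + - h * t2') (g * t3 + - h * t3') (g * h + - h * g)"
      by (rule cross_add[OF cross_mult[OF that(1)] cross_mult[OF that(2)]])
    then have "cross s1 s2 s3 (g * t1 - h * t1') (g * t2 - h * t2') (g * t3 - h * t3') 0"
      by (simp add: mult.commute)
    then show ?thesis by (rule cross_zero)
  qed
  obtain w where w: "b * x1 - a * y1 = w * s1" "b * x2 - a * y2 = w * s2" "b * x3 - a * y3 = w * s3"
    using rel[OF x(2) y(2)] by blast
  obtain w' where w': "c * y1 - b * z1 = w' * s1" "c * y2 - b * z2 = w' * s2" "c * y3 - b * z3 = w' * s3"
    using rel[OF y(2) z(2)] by blast
  obtain w'' where w'': "a * z1 - c * x1 = w'' * s1" "a * z2 - c * x2 = w'' * s2" "a * z3 - c * x3 = w'' * s3"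
    using rel[OF z(2) x(2)] by blast
  \<comment> \<open>Weighted by \<open>c\<close>, \<open>a\<close> and \<open>b\<close>, the three
    relations cancel cyclically; one component at a time suffices, as some entry of \<open>s\<close>
    is nonzero.\<close>
  have key: "(c * w + a * w' + b * w'') * s = 0"
    if "b * x - a * y = w * s" "c * y - b * z = w' * s" "a * z - c * x = w'' * s" for x y z s
  proof -
    have "(c * w + a * w' + b * w'') * s = c * (w * s) + a * (w' * s) + b * (w'' * s)"
      by (simp add: algebra_simps)
    also have "\<dots> = 0" unfolding that[symmetric] by (simp add: algebra_simps)
    finally show ?thesis .
  qed
  have "c * w + a * w' + b * w'' = 0"
    using key[OF w(1) w'(1) w''(1)] key[OF w(2) w'(2) w''(2)] key[OF w(3) w'(3) w''(3)] nonzero_s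
    by (auto simp only: mpoly_mult_eq_0_iff)
  then have "c * w = a * (- w') + b * (- w'')" by (simp add: algebra_simps eq_neg_iff_add_eq_0)
  then obtain u v where uv: "w = a * u + b * v" using reg unfolding regular_triple_def by blast
  have a0: "a \<noteq> 0" and ab: "\<And>v. a dvd b * v \<Longrightarrow> a dvd v" using reg unfolding regular_triple_def by blast+
  have quot: "\<exists>t. x - v * s = a * t" if "b * x - a * y = w * s" for x y s
  proof -
    have "b * (x - v * s) = (b * x - a * y) + a * y - b * v * s" by (simp add: algebra_simps)
    also have "\<dots> = a * (y + u * s)" unfolding that uv by (simp add: algebra_simps)
    finally have "a dvd b * (x - v * s)" by (rule dvdI)
    then have "a dvd x - v * s" by (rule ab)
    then show ?thesis by (elim dvdE) blast
  qed
  obtain t1 t2 t3 where t: "x1 - v * s1 = a * t1" "x2 - v * s2 = a * t2" "x3 - v * s3 = a * t3"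
    using quot[OF w(1)] quot[OF w(2)] quot[OF w(3)] by blast
  have "syz (x1 + - v * s1) (x2 + - v * s2) (x3 + - v * s3)"
    by (rule syz_add[OF x(1) syz_mult[OF syz_s]])
  then have "syz (a * t1) (a * t2) (a * t3)" by (simp flip: t)
  then have "a * (t1 * f1 + t2 * f2 + t3 * f3) = 0" unfolding syz_def by (simp only: distrib_left mult.assoc)
  then have st: "syz t1 t2 t3" using a0 by (simp add: syz_def)
  have "cross s1 s2 s3 (x1 + - v * s1) (x2 + - v * s2) (x3 + - v * s3) (a + - v * 0)"
    by (rule cross_add[OF x(2) cross_mult[OF cross_s]])
  then have ct: "cross s1 s2 s3 (a * t1) (a * t2) (a * t3) a" by (simp flip: t)
  have "cross s1 s2 s3 t1 t2 t3 1"
  proof -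
    have "a * (s2 * t3 - s3 * t2) = a * (1 * f1)" "a * (s3 * t1 - s1 * t3) = a * (1 * f2)"
      "a * (s1 * t2 - s2 * t1) = a * (1 * f3)"
      using ct unfolding cross_def by (simp_all add: algebra_simps)
    then show ?thesis unfolding cross_def using a0 by (simp only: mpoly_mult_left_cancel simp_thms)
  qed
  then show ?thesis using st unfolding C_def by blast
qed

text \<open>A syzygy \<open>t\<close> with factor 1 splits the exact sequence: subtracting
  \<open>c\<close> times \<open>t\<close> from a syzygy with factor \<open>c\<close> leaves factor
  0, that is, a multiple of \<open>s\<close>.\<close>

lemma syzygies_free:
  assumes "1 \<in> C"
  shows "\<exists>t1 t2 t3. syz t1 t2 t3 \<and>
    (\<forall>x1 x2 x3. syz x1 x2 x3 \<longrightarrow> (\<exists>g h. x1 = g * s1 + h * t1 \<and> x2 = g * s2 + h * t2 \<and> x3 = g * s3 + h * t3)) \<and>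
    (\<forall>g h. g * s1 + h * t1 = 0 \<and> g * s2 + h * t2 = 0 \<and> g * s3 + h * t3 = 0 \<longrightarrow> g = 0 \<and> h = 0)"
proof -
  obtain t1 t2 t3 where t: "syz t1 t2 t3" "cross s1 s2 s3 t1 t2 t3 1" using assms unfolding C_def by blast
  have "\<exists>g h. x1 = g * s1 + h * t1 \<and> x2 = g * s2 + h * t2 \<and> x3 = g * s3 + h * t3" if x: "syz x1 x2 x3" for x1 x2 x3
  proof -
    obtain c where c: "cross s1 s2 s3 x1 x2 x3 c" using cross_exists[OF syz_s x] by blast
    have "cross s1 s2 s3 (x1 + - c * t1) (x2 + - c * t2) (x3 + - c * t3) (c + - c * 1)"
      by (rule cross_add[OF c cross_mult[OF t(2)]])
    then obtain h where "x1 + - c * t1 = h * s1" "x2 + - c * t2 = h * s2" "x3 + - c * t3 = h * s3"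
      using cross_zero[of "x1 + - c * t1" "x2 + - c * t2" "x3 + - c * t3"] by auto
    then have "x1 = h * s1 + c * t1 \<and> x2 = h * s2 + c * t2 \<and> x3 = h * s3 + c * t3"
      by (simp add: algebra_simps)
    then show ?thesis by blast
  qed
  moreover have "g = 0 \<and> h = 0"
    if z: "g * s1 + h * t1 = 0 \<and> g * s2 + h * t2 = 0 \<and> g * s3 + h * t3 = 0" for g h
  proof -
    have "cross s1 s2 s3 (g * s1 + h * t1) (g * s2 + h * t2) (g * s3 + h * t3) (g * 0 + h * 1)"
      by (rule cross_add[OF cross_mult[OF cross_s] cross_mult[OF t(2)]])
    then have "cross s1 s2 s3 0 0 0 h" using z by simp
    then have "h * f1 = 0" by (simp add: cross_def)
    then have "h = 0" using nonzero_f by simp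
    then have "g * s1 = 0" "g * s2 = 0" "g * s3 = 0" using z by simp_all
    then show ?thesis using nonzero_s \<open>h = 0\<close> by auto
  qed
  ultimately show ?thesis using t(1) by blast
qed

text \<open>Rank-nullity twice: for the map from triples of degree \<open>t - d\<close> into
  \<open>J\<close>, and on its kernel for the map that records the factor \<open>c\<close>, whose
  own kernel consists of multiples of \<open>s\<close>. Each piece is estimated in the direction
  that bounds \<open>J\<close> from below.\<close>

lemma dim_J_bound:
  assumes t: "2 * d \<le> t"
  shows "3 * card (mons (UNIV :: 'n set) (t - d)) \<le>
    mp.dim (J \<inter> forms t) + card (mons (UNIV :: 'n set) (t - d - r)) + mp.dim (C \<inter> forms (t + r - 2 * d))"
proof -
  let ?pm = "pm_scale :: 'k \<Rightarrow> ('n, 'k) mpoly \<Rightarrow> _"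
  let ?sc2 = "scale_prod ?pm ?pm"
  let ?sc = "scale_prod ?pm ?sc2"
  interpret p2: vector_space ?sc2 by (rule vector_space_scale_prod[OF vector_space_pm_scale vector_space_pm_scale])
  interpret p3: vector_space ?sc by (rule vector_space_scale_prod[OF vector_space_pm_scale p2.vector_space_axioms])
  interpret f: vector_space_pair ?sc ?pm by unfold_locales
  interpret b: vector_space_pair ?pm ?sc by unfold_locales
  define a where "a = t - d"
  have a: "d \<le> a" "d + a = t" "a + r - d = t + r - 2 * d" using t r_le by (auto simp: a_def)
  let ?R = "forms a :: ('n, 'k) mpoly set"
  have T2: "p2.subspace (?R \<times> ?R)" "fin_span ?sc2 (?R \<times> ?R)" "p2.dim (?R \<times> ?R) = mp.dim ?R + mp.dim ?R"
    by (rule dim_Times[OF vector_space_pm_scale vector_space_pm_scale forms_subspace fin_span_forms forms_subspace fin_span_forms])+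
  let ?R3 = "?R \<times> ?R \<times> ?R"
  have T3: "p3.subspace ?R3" "fin_span ?sc ?R3" "p3.dim ?R3 = mp.dim ?R + p2.dim (?R \<times> ?R)"
    by (rule dim_Times[OF vector_space_pm_scale p2.vector_space_axioms forms_subspace fin_span_forms T2(1,2)])+
  define \<phi> where "\<phi> x = fst x * f1 + fst (snd x) * f2 + snd (snd x) * f3" for x :: "('n, 'k) mpoly \<times> ('n, 'k) mpoly \<times> ('n, 'k) mpoly"
  \<comment> \<open>The first component of the cross product with \<open>s\<close>. On syzygies it
    equals \<open>c * f1\<close>, so it determines \<open>c\<close>, a form of degree
    \<open>a + r - d\<close>.\<close>
  define \<mu> where "\<mu> x = s2 * snd (snd x) - s3 * fst (snd x)" for x :: "('n, 'k) mpoly \<times> ('n, 'k) mpoly \<times> ('n, 'k) mpoly"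
  define \<psi> where "\<psi> h = (h * s1, h * s2, h * s3)" for h :: "('n, 'k) mpoly"
  have l1: "Vector_Spaces.linear ?sc ?pm \<phi>"
    by unfold_locales (auto simp: \<phi>_def scale_prod_def pm_scale_cst algebra_simps)
  have l2: "Vector_Spaces.linear ?sc ?pm \<mu>"
    by unfold_locales (auto simp: \<mu>_def scale_prod_def pm_scale_cst algebra_simps)
  have l3: "Vector_Spaces.linear ?pm ?sc \<psi>"
    by unfold_locales (auto simp: \<psi>_def scale_prod_def pm_scale_cst algebra_simps)
  have l4: "Vector_Spaces.linear ?pm ?pm ((*) f1)"
    by unfold_locales (auto simp: pm_scale_cst algebra_simps)
  define Z where "Z = {x \<in> ?R3. \<phi> x = 0}"
  have Zs: "p3.subspace Z"
  proof -
    have "Z = ?R3 \<inter> {x. \<phi> x = 0}" by (auto simp: Z_def)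
    then show ?thesis using p3.subspace_inter[OF T3(1) f.linear_subspace_kernel[OF l1]] by simp
  qed
  have Zf: "fin_span ?sc Z" by (rule p3.fin_span_mono[OF T3(2)]) (auto simp: Z_def)
  have rn1: "p3.dim ?R3 = mp.dim (\<phi> ` ?R3) + p3.dim Z"
    unfolding Z_def by (rule f.rank_nullity_fin_span[OF l1 T3(1,2)])
  have im1: "mp.dim (\<phi> ` ?R3) \<le> mp.dim (J \<inter> forms t)"
  proof (rule mp.dim_mono_fin_span)
    show "\<phi> ` ?R3 \<subseteq> J \<inter> forms t"
    proof (rule subsetI, elim imageE)
      fix x y assume x: "x = \<phi> y" "y \<in> ?R3"
      have "g * h \<in> forms t" if "g \<in> ?R" "h \<in> forms d" for g h
        using forms_mult[OF that] a(2) by (simp add: add.commute)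
      then have "\<phi> y \<in> forms t" unfolding \<phi>_def using x(2) forms_f by (intro forms_add) auto
      moreover have "\<phi> y \<in> J" unfolding \<phi>_def J_def by blast
      ultimately show "x \<in> J \<inter> forms t" using x(1) by simp
    qed
  qed simp
  have rn2: "p3.dim Z = mp.dim (\<mu> ` Z) + p3.dim {x \<in> Z. \<mu> x = 0}"
    by (rule f.rank_nullity_fin_span[OF l2 Zs Zf])
  have Zsyz: "syz (fst x) (fst (snd x)) (snd (snd x))" if "x \<in> Z" for x
    using that by (simp add: Z_def \<phi>_def syz_def)
  have im2: "mp.dim (\<mu> ` Z) \<le> mp.dim (C \<inter> forms (a + r - d))"
  proof -
    have "\<mu> ` Z \<subseteq> (*) f1 ` (C \<inter> forms (a + r - d))"
    proof (rule subsetI, elim imageE)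
      fix y x assume x: "y = \<mu> x" "x \<in> Z"
      obtain c where c: "cross s1 s2 s3 (fst x) (fst (snd x)) (snd (snd x)) c"
        using cross_exists[OF syz_s Zsyz[OF x(2)]] by blast
      have cC: "c \<in> C" unfolding C_def using c Zsyz[OF x(2)] by blast
      have e: "\<mu> x = c * f1" using c by (simp add: cross_def \<mu>_def)
      have "g * h \<in> forms (a + r)" if "g \<in> forms r" "h \<in> ?R" for g h
        using forms_mult[OF that] by (simp add: add.commute)
      then have mf: "c * f1 \<in> forms (a + r)" unfolding e[symmetric] \<mu>_def
        using x(2) forms_s by (auto simp: Z_def)
      have "c \<in> forms (a + r - d)"
      proof (cases "c = 0")
        case False
        from forms_mult_cancel[OF mf] False nonzero_f obtain i where i: "i \<le> a + r" "c \<in> forms i" "f1 \<in> forms (a + r - i)" by auto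
        have "a + r - i = d" by (rule forms_unique[OF i(3) forms_f(1) nonzero_f(1)])
        then have "i = a + r - d" using i(1) by simp
        then show ?thesis using i(2) by simp
      qed simp
      then show "y \<in> (*) f1 ` (C \<inter> forms (a + r - d))" unfolding x(1) e
        using cC by (intro image_eqI[of _ _ c]) (simp_all add: mult.commute)
    qed
    then have "mp.dim (\<mu> ` Z) \<le> mp.dim ((*) f1 ` (C \<inter> forms (a + r - d)))"
      by (rule mp.dim_mono_fin_span[OF mpp.fin_span_image[OF l4 fin_span_Int_forms]])
    also have "\<dots> \<le> mp.dim (C \<inter> forms (a + r - d))"
      by (rule mpp.dim_image_le_fin_span[OF l4 ideal_forms_subspace[OF ideal_C] fin_span_Int_forms])
    finally show ?thesis .
  qed
  have ker2: "p3.dim {x \<in> Z. \<mu> x = 0} \<le> mp.dim (forms (a - r) :: ('n, 'k) mpoly set)"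
  proof -
    have "{x \<in> Z. \<mu> x = 0} \<subseteq> \<psi> ` forms (a - r)"
    proof
      fix x assume x: "x \<in> {x \<in> Z. \<mu> x = 0}"
      then have sx: "syz (fst x) (fst (snd x)) (snd (snd x))" using Zsyz by blast
      obtain c where c: "cross s1 s2 s3 (fst x) (fst (snd x)) (snd (snd x)) c"
        using cross_exists[OF syz_s sx] by blast
      have "c * f1 = 0" using c x by (simp add: cross_def \<mu>_def)
      then have "c = 0" using nonzero_f by simp
      then obtain h where h: "fst x = h * s1" "fst (snd x) = h * s2" "snd (snd x) = h * s3"
        using cross_zero c by blast
      have xR: "h * s1 \<in> forms a" "h * s2 \<in> forms a" "h * s3 \<in> forms a"
        using x h by (auto simp: Z_def)
      have "h \<in> forms (a - r)"
      proof (cases "h = 0")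
        case False
        have one: ?thesis if s: "s \<noteq> 0" "s \<in> forms r" "h * s \<in> forms a" for s
        proof -
          from forms_mult_cancel[OF s(3)] False s(1) obtain i where i: "i \<le> a" "h \<in> forms i" "s \<in> forms (a - i)" by auto
          have "a - i = r" by (rule forms_unique[OF i(3) s(2,1)])
          then have "i = a - r" using i(1) by simp
          then show ?thesis using i(2) by simp
        qed
        then show ?thesis using nonzero_s forms_s xR by blast
      qed simp
      then show "x \<in> \<psi> ` forms (a - r)"
        by (intro image_eqI[of _ _ h]) (simp_all add: \<psi>_def prod_eq_iff h)
    qed
    then have "p3.dim {x \<in> Z. \<mu> x = 0} \<le> p3.dim (\<psi> ` forms (a - r))"
      by (rule p3.dim_mono_fin_span[OF b.fin_span_image[OF l3 fin_span_forms]])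
    also have "\<dots> \<le> mp.dim (forms (a - r) :: ('n, 'k) mpoly set)"
      by (rule b.dim_image_le_fin_span[OF l3 forms_subspace fin_span_forms])
    finally show ?thesis .
  qed
  have "3 * mp.dim ?R \<le> mp.dim (J \<inter> forms t) + mp.dim (forms (a - r) :: ('n, 'k) mpoly set)
      + mp.dim (C \<inter> forms (t + r - 2 * d))"
    using rn1 rn2 im1 im2[unfolded a(3)] ker2 T3(3) T2(3) by linarith
  then show ?thesis unfolding dim_forms a_def .
qed

end

text \<open>The Koszul syzygy shows that \<open>r\<close> is at most \<open>d\<close>. If nothing
  has smaller degree it is minimal itself, and choosing it makes \<open>C\<close> an explicit colon
  ideal.\<close>

lemma (in three_forms) minimal_syzygy_exists:
  shows "\<exists>s1 s2 s3 r. minimal_syzygy f1 f2 f3 d s1 s2 s3 r \<and> (r = d \<longrightarrow> s1 = 0 \<and> s2 = f3 \<and> s3 = - f2)"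
proof -
  define P where "P r \<longleftrightarrow> (\<exists>s1 s2 s3. syz s1 s2 s3 \<and> s1 \<in> forms r \<and> s2 \<in> forms r \<and> s3 \<in> forms r \<and>
    (s1 \<noteq> 0 \<or> s2 \<noteq> 0 \<or> s3 \<noteq> 0))" for r
  have kos: "syz 0 f3 (- f2)" by (simp add: syz_def mult.commute)
  have Pd: "P d" unfolding P_def
    by (intro exI[of _ 0] exI[of _ f3] exI[of _ "- f2"]) (use kos forms_f nonzero_f in auto)
  define r where "r = (LEAST r. P r)"
  have Pr: "P r" unfolding r_def by (rule LeastI[of P, OF Pd])
  have rd: "r \<le> d" unfolding r_def by (rule Least_le[of P, OF Pd])
  have min: "t1 = 0 \<and> t2 = 0 \<and> t3 = 0"
    if "r' < r" "t1 \<in> forms r'" "t2 \<in> forms r'" "t3 \<in> forms r'" "syz t1 t2 t3" for r' t1 t2 t3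
  proof (rule ccontr)
    assume "\<not> ?thesis"
    then have "P r'" unfolding P_def using that by blast
    then show False using not_less_Least[OF that(1)[unfolded r_def]] by simp
  qed
  show ?thesis
  proof (cases "r = d")
    case True
    have "minimal_syzygy f1 f2 f3 d 0 f3 (- f2) r"
      by unfold_locales (use kos forms_f nonzero_f min rd True in auto)
    then show ?thesis by blast
  next
    case False
    obtain s1 s2 s3 where s: "syz s1 s2 s3" "s1 \<in> forms r" "s2 \<in> forms r" "s3 \<in> forms r"
      "s1 \<noteq> 0 \<or> s2 \<noteq> 0 \<or> s3 \<noteq> 0" using Pr unfolding P_def by blast
    have "minimal_syzygy f1 f2 f3 d s1 s2 s3 r"
      by unfold_locales (use s min rd in auto)
    then show ?thesis using False by blast
  qed
qed

text \<open>When no syzygy has degree below \<open>d\<close>, the ideal \<open>C\<close> of the Koszul syzygy \<open>(0, f3, -f2)\<close> is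
  \<open>(f2, f3) : f1\<close>.\<close>

lemma (in minimal_syzygy) koszul_hilbert_bound:
  assumes n: "CARD('n) = N + 3" and rd: "r = d" and s: "s1 = 0" "s2 = f3" "s3 = - f2" and t: "d \<le> t"
  shows "mp.dim (C \<inter> forms t) + (\<Sum>j<d. bin N (t - j)) \<le> card (mons (UNIV :: 'n set) t)"
proof -
  have CC: "C = colon_ideal f2 f3 f1"
  proof (intro set_eqI iffI)
    fix c assume "c \<in> C"
    then obtain t1 t2 t3 where "cross s1 s2 s3 t1 t2 t3 c" unfolding C_def by blast
    then have "f3 * t3 + f2 * t2 = c * f1" unfolding cross_def s by simp
    then have "f1 * c = f2 * t2 + f3 * t3" by (simp add: algebra_simps)
    then show "c \<in> colon_ideal f2 f3 f1" unfolding colon_ideal_def by blast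
  next
    fix c assume "c \<in> colon_ideal f2 f3 f1"
    then obtain u v where uv: "f1 * c = f2 * u + f3 * v" unfolding colon_ideal_def by blast
    have "- c * f1 + u * f2 + v * f3 = 0" using uv by (simp add: algebra_simps)
    then have 1: "syz (- c) u v" by (simp add: syz_def)
    have 2: "cross s1 s2 s3 (- c) u v c" unfolding cross_def s using uv by (simp add: algebra_simps)
    from 1 2 show "c \<in> C" unfolding C_def by blast
  qed
  \<comment> \<open>A relation between \<open>f2\<close> and \<open>f3\<close> is a syzygy with
    first entry 0, whose cross product with the Koszul syzygy vanishes; so it is a multiple of the
    latter.\<close>
  have reg: "f2 dvd v" if dv: "f2 dvd f3 * v" for v
  proof -
    obtain h where h: "f3 * v = f2 * h" using dv by (elim dvdE)
    have "cross s1 s2 s3 0 h (- v) 0" unfolding cross_def s using h by simp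
    from cross_zero[OF this] obtain g where "- v = g * s3" by blast
    then have "v = f2 * g" unfolding s by (simp add: mult.commute)
    then show ?thesis by simp
  qed
  have low: "d \<le> i" if g: "g \<in> colon_ideal f2 f3 f1" "g \<in> forms i" "g \<noteq> 0" for g i
  proof (rule ccontr)
    assume i: "\<not> d \<le> i"
    obtain u v where uv: "f1 * g = f2 * u + f3 * v" using g(1) unfolding colon_ideal_def by blast
    \<comment> \<open>The component of degree \<open>d + i\<close> turns the membership of
      \<open>g\<close> into a syzygy with entries of degree \<open>i\<close>, below the
      minimum.\<close>
    have "hcomp (d + i) (f1 * g) = hcomp (d + i) (f2 * u + f3 * v)" using uv by simp
    then have "f1 * g = f2 * hcomp i u + f3 * hcomp i v"
      by (simp add: hcomp_add hcomp_form_mult[OF forms_f(1)] hcomp_form_mult[OF forms_f(2)] hcomp_form_mult[OF forms_f(3)]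
          hcomp_of_form[OF g(2)])
    then have "- g * f1 + hcomp i u * f2 + hcomp i v * f3 = 0" by (simp add: algebra_simps)
    then have "syz (- g) (hcomp i u) (hcomp i v)" by (simp add: syz_def)
    then have "- g = 0" using minimal[of i "- g" "hcomp i u" "hcomp i v"] i rd g(2) by auto
    then show False using g(3) by simp
  qed
  show ?thesis unfolding CC
    by (rule colon_hilbert_bound[OF n forms_f(2) nonzero_f(2) forms_f(3) reg low t])
qed

text \<open>The descent from \<open>t\<close> to \<open>t - d\<close> is cut after \<open>r\<close>
  steps. The first \<open>r\<close> are compared with those from \<open>t - d\<close> to
  \<open>t - d - r\<close>, a shift by \<open>d\<close>; the other \<open>d - r\<close> with those
  from \<open>t - d\<close> to \<open>t + r - 2 * d\<close>, a shift by \<open>d - r\<close>. The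
  resulting constant equals \<open>d\<^sup>2 - r (d - r)\<close>.\<close>

lemma second_difference_bin_split:
  assumes "r \<le> d" "2 * d \<le> t"
  shows "bin (N + 2) t + bin (N + 2) (t - d - r) + bin (N + 2) (t + r - 2 * d)
    \<le> 3 * bin (N + 2) (t - d) + (r * d + (d - r) * (d - r)) * bin N t"
proof -
  have 1: "bin (N + 2) t = bin (N + 2) (t - r) + (\<Sum>i<r. bin (N + 1) (t - i))"
    using bin_diff[of r t "N + 1"] assms by simp
  have 2: "bin (N + 2) (t - r) = bin (N + 2) (t - d) + (\<Sum>i<d - r. bin (N + 1) (t - r - i))"
    using bin_diff[of "d - r" "t - r" "N + 1"] assms by simp
  have 3: "bin (N + 2) (t - d) = bin (N + 2) (t - d - r) + (\<Sum>i<r. bin (N + 1) (t - d - i))"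
    using bin_diff[of r "t - d" "N + 1"] assms by simp
  have e: "t - d - (d - r) = t + r - 2 * d" using assms by simp
  have 4: "bin (N + 2) (t - d) = bin (N + 2) (t + r - 2 * d) + (\<Sum>i<d - r. bin (N + 1) (t - d - i))"
    using bin_diff[of "d - r" "t - d" "N + 1", unfolded e] assms by simp
  have step: "bin (N + 1) u \<le> bin (N + 1) (u - l) + l * bin N t" if "l \<le> u" "u \<le> t" for u l
  proof -
    have "bin (N + 1) u = bin (N + 1) (u - l) + (\<Sum>i<l. bin N (u - i))"
      using bin_diff[OF that(1), of N] by simp
    also have "(\<Sum>i<l. bin N (u - i)) \<le> (\<Sum>i<l. bin N t)"
      by (intro sum_mono bin_mono) (use that in simp)
    finally show ?thesis by simp
  qed
  have "(\<Sum>i<r. bin (N + 1) (t - i)) \<le> (\<Sum>i<r. bin (N + 1) (t - d - i) + d * bin N t)"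
  proof (rule sum_mono)
    fix i assume i: "i \<in> {..<r}"
    have "t - i - d = t - d - i" by simp
    then show "bin (N + 1) (t - i) \<le> bin (N + 1) (t - d - i) + d * bin N t"
      using step[of d "t - i"] i assms by simp
  qed
  also have "\<dots> = (\<Sum>i<r. bin (N + 1) (t - d - i)) + r * d * bin N t"
    by (simp add: sum.distrib)
  finally have A: "(\<Sum>i<r. bin (N + 1) (t - i)) \<le> (\<Sum>i<r. bin (N + 1) (t - d - i)) + r * d * bin N t" .
  have "(\<Sum>i<d - r. bin (N + 1) (t - r - i)) \<le> (\<Sum>i<d - r. bin (N + 1) (t - d - i) + (d - r) * bin N t)"
  proof (rule sum_mono)
    fix i assume i: "i \<in> {..<d - r}"
    have "t - r - i - (d - r) = t - d - i" using i assms by simp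
    then show "bin (N + 1) (t - r - i) \<le> bin (N + 1) (t - d - i) + (d - r) * bin N t"
      using step[of "d - r" "t - r - i"] i assms by simp
  qed
  also have "\<dots> = (\<Sum>i<d - r. bin (N + 1) (t - d - i)) + (d - r) * (d - r) * bin N t"
    by (simp add: sum.distrib)
  finally have B: "(\<Sum>i<d - r. bin (N + 1) (t - r - i)) \<le> (\<Sum>i<d - r. bin (N + 1) (t - d - i)) + (d - r) * (d - r) * bin N t" .
  have D: "(r * d + (d - r) * (d - r)) * bin N t = r * d * bin N t + (d - r) * (d - r) * bin N t"
    by (rule distrib_right)
  show ?thesis using 1 2 3 4 A B unfolding D by linarith
qed

section \<open>A free module of syzygies gives projective dimension at most one\<close>

lemma projective_summand_coordinates:
  "projective_summand {x :: nat \<Rightarrow>\<^sub>0 'a::comm_ring_1. kys x \<subseteq> A}"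
proof -
  interpret m: module "pm_scale :: 'a \<Rightarrow> (nat \<Rightarrow>\<^sub>0 'a) \<Rightarrow> _" by (rule module_pm_scale)
  have iff: "kys x \<subseteq> B \<longleftrightarrow> (\<forall>i. i \<notin> B \<longrightarrow> lkp x i = 0)" for x :: "nat \<Rightarrow>\<^sub>0 'a" and B
    by (auto simp: in_keys_iff)
  have sub: "m.subspace {x. kys x \<subseteq> B}" for B
    unfolding m.subspace_def iff by (auto simp: lookup_add lookup_pm_scale)
  have "{x :: nat \<Rightarrow>\<^sub>0 'a. kys x \<subseteq> A} \<inter> {x. kys x \<subseteq> - A} = {0}"
  proof (intro set_eqI iffI)
    fix x :: "nat \<Rightarrow>\<^sub>0 'a" assume "x \<in> {x. kys x \<subseteq> A} \<inter> {x. kys x \<subseteq> - A}"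
    then have "lkp x i = 0" for i unfolding Int_iff mem_Collect_eq iff by (cases "i \<in> A") auto
    then show "x \<in> {0}" by (simp add: poly_mapping_eqI)
  qed simp
  moreover have "{p + q | p q. p \<in> {x :: nat \<Rightarrow>\<^sub>0 'a. kys x \<subseteq> A} \<and> q \<in> {x. kys x \<subseteq> - A}} = UNIV"
  proof (rule UNIV_eq_I[symmetric])
    fix x :: "nat \<Rightarrow>\<^sub>0 'a"
    define p where "p = (\<Sum>i\<in>kys x \<inter> A. sng i (lkp x i))"
    have lp: "lkp p i = (if i \<in> A then lkp x i else 0)" for i
    proof -
      have "lkp p i = (\<Sum>j\<in>kys x \<inter> A. if j = i then lkp x i else 0)"
        unfolding p_def lookup_sum by (rule sum.cong) (auto simp: lookup_single when_def)
      then show ?thesis by (auto simp: in_keys_iff)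
    qed
    have "kys p \<subseteq> A" "kys (x - p) \<subseteq> - A" unfolding iff by (auto simp: lp lookup_minus)
    moreover have "x = p + (x - p)" by simp
    ultimately show "x \<in> {p + q | p q. p \<in> {x. kys x \<subseteq> A} \<and> q \<in> {x. kys x \<subseteq> - A}}" by blast
  qed
  ultimately show ?thesis unfolding projective_summand_def using sub by blast
qed

text \<open>The basis of the syzygies yields a free resolution with ranks 2 and 3, realised inside
  the ambient free module by the supports \<open>{0, 1}\<close> and
  \<open>{0, 1, 2}\<close>.\<close>

lemma (in three_forms) proj_dim_le_one:
  assumes s: "syz s1 s2 s3" and t: "syz t1 t2 t3"
    and gen: "\<And>x1 x2 x3. syz x1 x2 x3 \<Longrightarrow> \<exists>g h. x1 = g * s1 + h * t1 \<and> x2 = g * s2 + h * t2 \<and> x3 = g * s3 + h * t3"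
    and free: "\<And>g h. g * s1 + h * t1 = 0 \<and> g * s2 + h * t2 = 0 \<and> g * s3 + h * t3 = 0 \<Longrightarrow> g = 0 \<and> h = 0"
  shows "proj_dim (*) J \<le> 1"
proof -
  define P :: "nat \<Rightarrow> (nat \<Rightarrow>\<^sub>0 ('n, 'k) mpoly) set" where
    "P i = {x. kys x \<subseteq> (if i = 0 then {0, 1, 2} else if i = 1 then {0, 1} else {})}" for i
  define \<epsilon> where "\<epsilon> x = lkp x 0 * f1 + lkp x 1 * f2 + lkp x 2 * f3" for x :: "nat \<Rightarrow>\<^sub>0 ('n, 'k) mpoly"
  define vec where "vec a b c = sng (0 :: nat) a + sng 1 b + sng 2 c" for a b c :: "('n, 'k) mpoly"
  have lv: "lkp (vec a b c) i = (if i = 0 then a else if i = 1 then b else if i = 2 then c else 0)" for a b c i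
    by (auto simp: vec_def lookup_add lookup_single when_def)
  define \<delta> where "\<delta> i x = (if i = 0 then vec (lkp x 0 * s1 + lkp x 1 * t1) (lkp x 0 * s2 + lkp x 1 * t2)
      (lkp x 0 * s3 + lkp x 1 * t3) else 0)" for i :: nat and x :: "nat \<Rightarrow>\<^sub>0 ('n, 'k) mpoly"
  have iff: "kys x \<subseteq> B \<longleftrightarrow> (\<forall>i. i \<notin> B \<longrightarrow> lkp x i = 0)" for x :: "nat \<Rightarrow>\<^sub>0 ('n, 'k) mpoly" and B
    by (auto simp: in_keys_iff)
  have P0: "x \<in> P 0 \<longleftrightarrow> x = vec (lkp x 0) (lkp x 1) (lkp x 2)" for x
    by (auto simp: P_def iff poly_mapping_eq_iff fun_eq_iff lv)
  have P1: "x \<in> P 1 \<longleftrightarrow> x = vec (lkp x 0) (lkp x 1) 0" for x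
    by (auto simp: P_def iff poly_mapping_eq_iff fun_eq_iff lv)
  have P2: "P (Suc (Suc i)) = {0}" for i by (auto simp: P_def)
  have vP0: "vec a b c \<in> P 0" for a b c unfolding P0 lv by simp
  have vP1: "vec a b 0 \<in> P 1" for a b unfolding P1 lv by simp
  have e\<delta>: "\<delta> 0 (vec g h c) = vec (g * s1 + h * t1) (g * s2 + h * t2) (g * s3 + h * t3)" for g h c
    by (simp add: \<delta>_def lv)
  have "projective_resolution (*) J 1 P \<epsilon> \<delta>"
    unfolding projective_resolution_def
  proof (intro conjI allI impI)
    show "projective_summand (P i)" for i unfolding P_def by (rule projective_summand_coordinates)
    show "P i = {0}" if "1 < i" for i using that by (auto simp: P_def)
    show "module_hom pm_scale (*) \<epsilon>"
      by (intro module_hom.intro module_hom_axioms.intro module_pm_scale module_times)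
        (simp_all add: \<epsilon>_def lookup_add lookup_pm_scale algebra_simps)
    show "module_hom pm_scale pm_scale (\<delta> i)" for i
    proof (intro module_hom.intro module_hom_axioms.intro module_pm_scale)
      show "\<delta> i (x + y) = \<delta> i x + \<delta> i y" for x y
        by (rule poly_mapping_eqI) (simp add: \<delta>_def lv lookup_add algebra_simps)
      show "\<delta> i (pm_scale c x) = pm_scale c (\<delta> i x)" for c x
        by (rule poly_mapping_eqI) (simp add: \<delta>_def lv lookup_pm_scale algebra_simps)
    qed
    show "\<epsilon> ` P 0 = J"
    proof (intro set_eqI iffI)
      fix x assume "x \<in> \<epsilon> ` P 0"
      then show "x \<in> J" unfolding \<epsilon>_def J_def by blast
    next
      fix x assume "x \<in> J"
      then obtain a b c where x: "x = a * f1 + b * f2 + c * f3" unfolding J_def by blast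
      have "x = \<epsilon> (vec a b c)" by (simp add: \<epsilon>_def lv x)
      then show "x \<in> \<epsilon> ` P 0" using vP0 by blast
    qed
    show "\<delta> 0 ` P 1 = {x \<in> P 0. \<epsilon> x = 0}"
    proof (intro set_eqI iffI)
      fix x assume "x \<in> \<delta> 0 ` P 1"
      then obtain y where y: "x = \<delta> 0 y" by blast
      let ?g = "lkp y 0" and ?h = "lkp y 1"
      have x: "x = vec (?g * s1 + ?h * t1) (?g * s2 + ?h * t2) (?g * s3 + ?h * t3)" by (simp add: y \<delta>_def)
      have "\<epsilon> x = ?g * (s1 * f1 + s2 * f2 + s3 * f3) + ?h * (t1 * f1 + t2 * f2 + t3 * f3)"
        unfolding x by (simp add: \<epsilon>_def lv algebra_simps)
      also have "\<dots> = 0" using s t by (simp add: syz_def)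
      finally show "x \<in> {x \<in> P 0. \<epsilon> x = 0}" using vP0 unfolding x by blast
    next
      fix x assume x: "x \<in> {x \<in> P 0. \<epsilon> x = 0}"
      then have "syz (lkp x 0) (lkp x 1) (lkp x 2)" by (simp add: syz_def \<epsilon>_def)
      then obtain g h where gh: "lkp x 0 = g * s1 + h * t1" "lkp x 1 = g * s2 + h * t2" "lkp x 2 = g * s3 + h * t3"
        using gen by blast
      have "x = vec (lkp x 0) (lkp x 1) (lkp x 2)" using x P0 by blast
      then have "x = \<delta> 0 (vec g h 0)" unfolding e\<delta> gh .
      then show "x \<in> \<delta> 0 ` P 1" using vP1 by blast
    qed
    fix i
    show "\<delta> (Suc i) ` P (Suc (Suc i)) = {x \<in> P (Suc i). \<delta> i x = 0}"
    proof (cases i)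
      case 0
      have "x = 0" if x: "x \<in> P 1" "\<delta> 0 x = 0" for x
      proof -
        let ?g = "lkp x 0" and ?h = "lkp x 1"
        have "vec (?g * s1 + ?h * t1) (?g * s2 + ?h * t2) (?g * s3 + ?h * t3) = 0" using x(2) by (simp add: \<delta>_def)
        then have "lkp (vec (?g * s1 + ?h * t1) (?g * s2 + ?h * t2) (?g * s3 + ?h * t3)) j = 0" for j by simp
        from this[of 0] this[of 1] this[of 2] have "?g = 0 \<and> ?h = 0" by (intro free) (simp add: lv)
        moreover have "x = vec ?g ?h 0" using x(1) P1 by blast
        ultimately have "x = vec 0 0 0" by metis
        then show ?thesis by (simp add: vec_def)
      qed
      moreover have "0 \<in> P 1" "\<delta> 0 0 = 0" by (simp_all add: P_def \<delta>_def vec_def)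
      ultimately have "{x \<in> P 1. \<delta> 0 x = 0} = {0}" by blast
      then show ?thesis using P2[of 0] by (simp add: 0 \<delta>_def)
    next
      case (Suc l)
      have "{x \<in> P (Suc i). \<delta> i x = 0} = {0}" unfolding Suc P2 by (simp add: \<delta>_def)
      then show ?thesis unfolding P2 by (simp add: \<delta>_def)
    qed
  qed
  then have "enat 1 \<in> {enat m | m. \<exists>P \<epsilon> \<delta>. projective_resolution (*) J m P \<epsilon> \<delta>}" by blast
  then have "proj_dim (*) J \<le> enat 1" unfolding proj_dim_def by (rule Inf_lower)
  then show ?thesis by (simp add: one_enat_def)
qed

section \<open>Leading coefficients of Hilbert polynomials\<close>

fun bin_poly :: "nat \<Rightarrow> rat poly" where
  "bin_poly 0 = 1"
| "bin_poly (Suc N) = smult (1 / of_nat (Suc N)) ([:of_nat (Suc N), 1:] * bin_poly N)"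

lemma poly_bin_poly: "poly (bin_poly N) (of_nat t) = of_nat (bin N t)"
proof (induction N)
  case (Suc N)
  have "of_nat (Suc N) * of_nat (bin (Suc N) t) = (of_nat (t + Suc N) * of_nat (bin N t) :: rat)"
    using bin_absorb[of N t] by (simp only: of_nat_mult[symmetric])
  then have "of_nat (bin (Suc N) t) = ((of_nat (Suc N) + of_nat t) * of_nat (bin N t) :: rat) / of_nat (Suc N)"
    unfolding of_nat_add by (simp add: field_simps del: of_nat_Suc)
  then show ?case using Suc by (simp add: distrib_right del: of_nat_Suc)
qed simp

lemma bin_poly_degree: "degree (bin_poly N) = N \<and> coeff (bin_poly N) N = 1 / fact N"
proof (induction N)
  case (Suc N)
  let ?l = "[:of_nat (Suc N), 1:] :: rat poly"
  have b0: "bin_poly N \<noteq> 0"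
  proof
    assume "bin_poly N = 0"
    then show False using Suc by simp
  qed
  have d: "degree (?l * bin_poly N) = Suc N" using Suc b0 by (subst degree_mult_eq) auto
  have "lead_coeff ?l = 1" by simp
  then have "lead_coeff (?l * bin_poly N) = lead_coeff (bin_poly N)" by (simp only: lead_coeff_mult mult_1)
  then have "coeff (?l * bin_poly N) (Suc N) = 1 / fact N" using d Suc by simp
  then show ?case using d by (simp del: of_nat_Suc mult_pCons_left)
qed simp

text \<open>A bound away from 0, rather than mere negativity, lets \<open>x * poly q x\<close>
  outgrow the constant term in the induction.\<close>

lemma poly_neg_eventually:
  fixes q :: "rat poly"
  assumes "lead_coeff q < 0" shows "\<exists>e>0. \<exists>x0. \<forall>x\<ge>x0. poly q x \<le> - e"
  using assms
proof (induction q)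
  case (pCons a q)
  show ?case
  proof (cases "q = 0")
    case True
    then have "a < 0" using pCons.prems by simp
    then show ?thesis using True by (intro exI[of _ "- a"]) auto
  next
    case False
    then have "lead_coeff q < 0" using pCons.prems by simp
    then obtain e x0 where e: "e > 0" "\<And>x. x \<ge> x0 \<Longrightarrow> poly q x \<le> - e" using pCons.IH by blast
    have "poly (pCons a q) x \<le> - 1" if x: "x \<ge> max 0 (max x0 ((a + 1) / e))" for x
    proof -
      have "x * poly q x \<le> x * (- e)" using e(2)[of x] x by (intro mult_left_mono) auto
      moreover have "(a + 1) / e \<le> x" using x by simp
      then have "a + 1 \<le> x * e" using e(1) by (simp add: pos_divide_le_eq)
      ultimately show ?thesis by simp
    qed
    then show ?thesis by (intro exI[of _ 1] conjI exI[of _ "max 0 (max x0 ((a + 1) / e))"]) auto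
  qed
qed simp

lemma eventually_nonneg_coeff:
  fixes q :: "rat poly"
  assumes "\<forall>\<^sub>F t in sequentially. poly q (of_nat t) \<ge> 0" "degree q \<le> M"
  shows "coeff q M \<ge> 0"
proof (rule ccontr)
  assume n: "\<not> coeff q M \<ge> 0"
  then have "degree q = M" using assms(2) by (metis coeff_eq_0 le_neq_implies_less order_refl)
  then have "lead_coeff q < 0" using n by simp
  then obtain e x0 where e: "e > 0" "\<And>x. x \<ge> x0 \<Longrightarrow> poly q x \<le> - e" using poly_neg_eventually by blast
  obtain k :: nat where k: "x0 \<le> of_nat k" using real_arch_simple[of x0] by blast
  have "\<forall>\<^sub>F t in sequentially. t \<ge> k" by (rule eventually_ge_at_top)
  with assms(1) have "\<forall>\<^sub>F t :: nat in sequentially. False"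
  proof eventually_elim
    case (elim t)
    have "x0 \<le> of_nat t" using k elim(2) by (metis of_nat_le_iff order_trans)
    then have "poly q (of_nat t) \<le> - e" by (rule e(2))
    then show False using elim(1) e(1) by linarith
  qed
  then show False by simp
qed

text \<open>The Hilbert polynomial is squeezed between polynomials of degree at most
  \<open>N\<close>, the lower one with positive coefficient there. So its degree is
  \<open>N\<close>, which fixes the factorial in \<open>mult_quot\<close>, and the upper one bounds
  its leading coefficient. The shifts by \<open>c + j\<close> do not affect leading
  coefficients.\<close>

lemma mult_quot_bound:
  fixes I :: "('n::finite, 'k::field) mpoly set"
  assumes I: "is_ideal I" and lower: "\<And>t. bin N t \<le> hilbert_fun I t"
    and upper: "\<And>t. t \<ge> t0 \<Longrightarrow> hilbert_fun I t + (\<Sum>j<E. bin N (t - c - j)) \<le> K * bin N t"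
    and t0: "t0 \<ge> c + E"
  shows "mult_quot I \<le> of_nat K - of_nat E"
proof -
  define p where "p = hilbert_poly I"
  have p: "\<forall>\<^sub>F t in sequentially. poly p (of_nat t) = of_nat (hilbert_fun I t)"
    unfolding p_def by (rule hilbert_poly_works[OF I])
  define B where "B = bin_poly N"
  have dB: "degree B = N" and cB: "coeff B N = 1 / fact N" using bin_poly_degree by (auto simp: B_def)
  define S where "S j = pcompose B [:- of_nat (c + j), 1:]" for j
  have dS: "degree (S j) = N" for j unfolding S_def by (simp add: degree_pcompose dB)
  have cS: "coeff (S j) N = 1 / fact N" for j
  proof -
    have "lead_coeff (S j) = lead_coeff B" unfolding S_def by (subst lead_coeff_comp) simp_all
    then show ?thesis using dS[of j] dB cB by simp
  qed
  have pS: "poly (S j) (of_nat t) = of_nat (bin N (t - c - j))" if "c + j \<le> t" for j t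
  proof -
    have "poly (S j) (of_nat t) = poly B (of_nat t - of_nat (c + j))"
      by (simp add: S_def poly_pcompose algebra_simps)
    also have "(of_nat t - of_nat (c + j) :: rat) = of_nat (t - (c + j))" by (rule of_nat_diff[OF that, symmetric])
    finally have "poly (S j) (of_nat t) = poly B (of_nat (t - (c + j)))" .
    then show ?thesis by (simp add: B_def poly_bin_poly)
  qed
  define U where "U = smult (of_nat K) B - (\<Sum>j<E. S j)"
  have dU: "degree U \<le> N" unfolding U_def
    by (intro degree_diff_le degree_sum_le order.trans[OF degree_smult_le]) (auto simp: dB dS)
  have cU: "coeff U N = (of_nat K - of_nat E) / fact N"
    by (simp add: U_def coeff_sum cB cS diff_divide_distrib)
  have lo: "\<forall>\<^sub>F t in sequentially. poly (p - B) (of_nat t) \<ge> 0"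
    using p
  proof eventually_elim
    case (elim t)
    have "(of_nat (bin N t) :: rat) \<le> of_nat (hilbert_fun I t)" using lower[of t] by (simp only: of_nat_le_iff)
    then show ?case using elim by (simp add: B_def poly_bin_poly)
  qed
  have up: "\<forall>\<^sub>F t in sequentially. poly (U - p) (of_nat t) \<ge> 0"
    using p eventually_ge_at_top[of t0]
  proof eventually_elim
    case (elim t)
    have "(of_nat (hilbert_fun I t + (\<Sum>j<E. bin N (t - c - j))) :: rat) \<le> of_nat (K * bin N t)"
      using upper[OF elim(2)] by (simp only: of_nat_le_iff)
    moreover have "(\<Sum>j<E. poly (S j) (of_nat t)) = of_nat (\<Sum>j<E. bin N (t - c - j))"
      unfolding of_nat_sum by (rule sum.cong[OF refl]) (rule pS, use elim(2) t0 in auto)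
    ultimately show ?case using elim(1) by (simp add: U_def poly_sum B_def poly_bin_poly)
  qed
  \<comment> \<open>In a degree above \<open>N\<close> the two inequalities force the top
    coefficient of \<open>p\<close> to be both nonnegative and nonpositive.\<close>
  have dp: "degree p \<le> N"
  proof (rule ccontr)
    assume n: "\<not> degree p \<le> N"
    then have "degree (p - B) \<le> degree p" "degree (U - p) \<le> degree p"
      using dB dU by (auto intro: degree_diff_le)
    from eventually_nonneg_coeff[OF lo this(1)] eventually_nonneg_coeff[OF up this(2)]
    have "coeff p (degree p) = 0" using n dB dU by (simp add: coeff_eq_0)
    then have "p = 0" by simp
    then show False using n by simp
  qed
  have 1: "coeff (p - B) N \<ge> 0" by (rule eventually_nonneg_coeff[OF lo]) (use dp dB in \<open>auto intro: degree_diff_le\<close>)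
  have 2: "coeff (U - p) N \<ge> 0" by (rule eventually_nonneg_coeff[OF up]) (use dp dU in \<open>auto intro: degree_diff_le\<close>)
  have "(0 :: rat) < 1 / fact N" by simp
  moreover have "1 / fact N \<le> coeff p N" using 1 cB by simp
  ultimately have pN: "coeff p N > 0" by (rule less_le_trans)
  then have deg: "degree p = N" using dp by (metis coeff_eq_0 le_neq_implies_less less_irrefl)
  have "p \<noteq> 0" using pN by auto
  then have "mult_quot I = fact N * coeff p N" unfolding mult_quot_def p_def[symmetric] deg by simp
  also have "\<dots> \<le> fact N * coeff U N" using 2 by (intro mult_left_mono) auto
  also have "\<dots> = of_nat K - of_nat E" by (simp add: cU)
  finally show ?thesis .
qed

section \<open>From minimal generators to the degree bound\<close>

lemma ideal_gen_three:
  "ideal_gen {f1, f2, f3 :: 'a::comm_ring_1} = {a * f1 + b * f2 + c * f3 | a b c. True}"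
proof -
  interpret m: module "(*) :: 'a \<Rightarrow> 'a \<Rightarrow> 'a" by (rule module_times)
  show ?thesis
  proof (intro set_eqI iffI)
    fix x assume "x \<in> m.span {f1, f2, f3}"
    then obtain a b c where "x - a * f1 - b * f2 - c * f3 = 0" unfolding m.span_insert m.span_empty by blast
    then have "x = a * f1 + b * f2 + c * f3" by (simp add: algebra_simps)
    then show "x \<in> {a * f1 + b * f2 + c * f3 | a b c. True}" by blast
  next
    fix x assume "x \<in> {a * f1 + b * f2 + c * f3 | a b c. True}"
    then obtain a b c where x: "x = a * f1 + b * f2 + c * f3" by blast
    show "x \<in> m.span {f1, f2, f3}" unfolding x
      by (intro m.span_add m.span_scale m.span_base) auto
  qed
qed

lemma minimally_generates_not_in_span:
  fixes G :: "'a::comm_ring_1 set"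
  assumes "minimally_generates G I" "g \<in> G" shows "g \<notin> ideal_gen (G - {g})"
proof
  interpret m: module "(*) :: 'a \<Rightarrow> 'a \<Rightarrow> 'a" by (rule module_times)
  assume g: "g \<in> m.span (G - {g})"
  have "G \<subseteq> m.span (G - {g})"
  proof
    fix x assume "x \<in> G"
    then show "x \<in> m.span (G - {g})" using g m.span_base[of x "G - {g}"] by (cases "x = g") auto
  qed
  moreover have "G - {g} \<subseteq> m.span G" by (rule subset_trans[OF _ m.span_superset]) auto
  ultimately have "m.span (G - {g}) = m.span G" unfolding m.span_eq by (rule conjI[rotated])
  then have "ideal_gen (G - {g}) = I" using assms(1) by (simp add: minimally_generates_def)
  moreover have "G - {g} \<subset> G" using assms(2) by auto
  ultimately show False using assms(1) by (simp add: minimally_generates_def)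
qed

theorem theorem3p8:
  fixes J :: "('n::finite, 'k::{alg_closed_field, field_char_0}) mpoly set"
    and d :: nat
  assumes "CARD('n) \<ge> 3"
    and "d \<ge> 2"
    and "equigenerated_strict_aci2 d J"
    and "proj_dim (*) J = 2"
  shows "mult_quot J \<le> of_nat d ^ 2 - of_nat d \<and> mult_quot J \<noteq> of_nat d ^ 2 - of_nat d + 1"
proof -
  interpret m: module "(*) :: ('n, 'k) mpoly \<Rightarrow> ('n, 'k) mpoly \<Rightarrow> ('n, 'k) mpoly" by (rule module_times)
  obtain N where n: "CARD('n) = N + 3" using assms(1) by (metis add.commute le_iff_add)
  have ht: "ideal_height J = enat 2"
    using assms(3) unfolding equigenerated_strict_aci2_def by (simp add: numeral_eq_enat)
  obtain G where G: "G \<subseteq> forms d" "card G = 3" "minimally_generates G J"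
    using assms(3) unfolding equigenerated_strict_aci2_def by blast
  obtain f1 f2 f3 where fG: "G = {f1, f2, f3}" "f1 \<noteq> f2" "f1 \<noteq> f3" "f2 \<noteq> f3"
    using G(2) unfolding card_3_iff by blast
  have Jgen: "J = {a * f1 + b * f2 + c * f3 | a b c. True}"
    using G(3) unfolding minimally_generates_def fG(1) ideal_gen_three by blast
  have iJ: "is_ideal J" using G(3) m.subspace_span unfolding minimally_generates_def by blast
  have notin: "f1 \<notin> ideal_gen {f2, f3}" "f2 \<notin> ideal_gen {f1, f3}" "f3 \<notin> ideal_gen {f1, f2}"
    using minimally_generates_not_in_span[OF G(3), of f1] minimally_generates_not_in_span[OF G(3), of f2]
      minimally_generates_not_in_span[OF G(3), of f3] fG(2-4) unfolding fG(1)
    by (simp_all add: insert_Diff_if insert_commute)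
  have nz: "f1 \<noteq> 0" "f2 \<noteq> 0" "f3 \<noteq> 0" using notin m.span_zero by metis+
  have fJ: "f1 \<in> J" "f2 \<in> J" "f3 \<in> J"
    using G(3) m.span_superset[of G] unfolding minimally_generates_def fG(1) by auto
  have cop: "\<not> (p dvd f1 \<and> p dvd f2 \<and> p dvd f3)" if p: "prime_in UNIV p" for p
  proof
    assume "p dvd f1 \<and> p dvd f2 \<and> p dvd f3"
    then have "p dvd f" if "f \<in> J" for f using that unfolding Jgen by auto
    then have "ideal_height J \<le> 1" by (rule ideal_height_common_prime[OF p])
    then show False unfolding ht by (simp add: one_enat_def)
  qed
  interpret F: three_forms f1 f2 f3 d
    by unfold_locales (use G(1) fG(1) nz cop in auto)
  have JF: "J = F.J" unfolding Jgen F.J_def ..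
  obtain s1 s2 s3 r where ms: "minimal_syzygy f1 f2 f3 d s1 s2 s3 r"
    and kos: "r = d \<longrightarrow> s1 = 0 \<and> s2 = f3 \<and> s3 = - f2" using F.minimal_syzygy_exists by blast
  interpret M: minimal_syzygy f1 f2 f3 d s1 s2 s3 r by (rule ms)
  \<comment> \<open>A syzygy of degree 0 is a linear relation over the field and would make one of
    the generators redundant.\<close>
  have r0: "r \<noteq> 0"
  proof
    assume "r = 0"
    then obtain a b c where abc: "s1 = cst a" "s2 = cst b" "s3 = cst c" using M.forms_s by (auto simp: forms_0_cst)
    have rel: "cst a * f1 + cst b * f2 + cst c * f3 = 0" using M.syz_s unfolding F.syz_def abc .
    have solve: "g \<in> ideal_gen {h, k}" if "cst a * g + cst b * h + cst c * k = 0" "a \<noteq> 0" for a b c :: 'k and g h k :: "('n, 'k) mpoly"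
    proof -
      have "cst a * g = - (cst b * h + cst c * k)" using that(1) by (intro minus_unique[symmetric]) (simp add: add_ac)
      then have "cst (1 / a) * (cst a * g) = cst (1 / a) * (- (cst b * h + cst c * k))" by simp
      moreover have "cst (1 / a) * (cst a * g) = g" using that(2) by (simp flip: mult.assoc cst_simps(4))
      ultimately have g: "g = cst (1 / a) * (- (cst b * h + cst c * k))" by simp
      have "cst b * h + cst c * k \<in> m.span {h, k}"
        by (intro m.span_add m.span_scale m.span_base) auto
      from m.span_scale[OF m.span_neg[OF this]] show ?thesis unfolding g .
    qed
    have "a = 0" using solve[OF rel] notin(1) by blast
    moreover have "cst b * f2 + cst a * f1 + cst c * f3 = 0" using rel by (simp add: add_ac)
    then have "b = 0" using solve notin(2) by blast
    moreover have "cst c * f3 + cst a * f1 + cst b * f2 = 0" using rel by (simp add: add_ac)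
    then have "c = 0" using solve notin(3) by blast
    ultimately show False using M.nonzero_s unfolding abc by simp
  qed
  have one: "1 \<notin> M.C"
  proof
    assume "1 \<in> M.C"
    then obtain t1 t2 t3 where t: "F.syz t1 t2 t3"
      "\<And>x1 x2 x3. F.syz x1 x2 x3 \<Longrightarrow> \<exists>g h. x1 = g * s1 + h * t1 \<and> x2 = g * s2 + h * t2 \<and> x3 = g * s3 + h * t3"
      "\<And>g h. g * s1 + h * t1 = 0 \<and> g * s2 + h * t2 = 0 \<and> g * s3 + h * t3 = 0 \<Longrightarrow> g = 0 \<and> h = 0"
      using M.syzygies_free by blast
    have "proj_dim (*) J \<le> 1" unfolding JF by (rule F.proj_dim_le_one[OF M.syz_s t])
    then show False using assms(4) by simp
  qed
  have cU: "card (mons (UNIV :: 'n set) t) = bin (N + 2) t" for t by (rule card_mons) (simp add: n)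
  \<comment> \<open>Failure in even a single degree would give a regular triple in \<open>C\<close>,
    and hence 1.\<close>
  have C1: "mp.dim (M.C \<inter> forms t) + bin N t \<le> bin (N + 2) t" for t
  proof (rule ccontr)
    assume "\<not> ?thesis"
    then have "mp.dim (M.C \<inter> forms t) + bin N t > card (mons (UNIV :: 'n set) t)" by (simp add: cU)
    from regular_triple_exists[OF M.ideal_C n this] show False using M.regular_triple_imp_one one by blast
  qed
  \<comment> \<open>The lower bound for the multiplicity of \<open>C\<close>: each summand
    \<open>bin N (t - j)\<close> in \<open>C2\<close> contributes one.\<close>
  define E where "E = (if r = d then d else 1)"
  have C2: "mp.dim (M.C \<inter> forms t) + (\<Sum>j<E. bin N (t - j)) \<le> bin (N + 2) t" if "d \<le> t" for t
  proof (cases "r = d")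
    case True
    then show ?thesis using M.koszul_hilbert_bound[OF n True _ _ _ that] kos by (simp add: E_def cU)
  next
    case False
    then show ?thesis using C1[of t] by (simp add: E_def)
  qed
  have hf: "hilbert_fun J t + mp.dim (J \<inter> forms t) = bin (N + 2) t" for t
    using dim_ideal_le[of J t] unfolding hilbert_fun_def dim_forms cU by simp
  obtain T where T: "card T + 2 \<ge> CARD('n)" "\<forall>f\<in>J. f \<in> polys T \<longrightarrow> f = 0"
    using ideal_height_transversal[OF ht] by blast
  have "N + 1 \<le> card T" using T(1) n by simp
  \<comment> \<open>Trimmed to exactly \<open>N + 1\<close> variables, whose monomials of degree
    \<open>t\<close> number \<open>bin N t\<close>.\<close>
  then obtain T' where T': "T' \<subseteq> T" "card T' = Suc N" by (metis Suc_eq_plus1 obtain_subset_with_card_n)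
  have lower: "bin N t \<le> hilbert_fun J t" for t
  proof -
    have "mp.dim (J \<inter> forms t) + card (mons T' t) \<le> card (mons (UNIV :: 'n set) t)"
    proof (rule dim_disjoint_monomials[OF ideal_forms_subspace[OF iJ] _ mons_subset])
      fix f assume f: "f \<in> J \<inter> forms t" "kys f \<subseteq> mons T' t"
      then have "f \<in> polys T" using polys_mono[OF T'(1)] by (auto simp: keys_mons_iff)
      then show "f = 0" using T(2) f(1) by blast
    qed blast
    then show ?thesis using hf[of t] card_mons[OF T'(2), of t] by (simp add: cU)
  qed
  define K where "K = r * d + (d - r) * (d - r)"
  have upper: "hilbert_fun J t + (\<Sum>j<E. bin N (t - (2 * d - r) - j)) \<le> K * bin N t" if t: "t \<ge> 3 * d" for t
  proof -
    \<comment> \<open>From \<open>3 * d\<close> on, the degree \<open>t + r - 2 * d\<close> in which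
      \<open>C\<close> is measured is at least \<open>d\<close>, as \<open>C2\<close>
      requires.\<close>
    have t2: "2 * d \<le> t" "d \<le> t + r - 2 * d" using t by auto
    have e: "t + r - 2 * d = t - (2 * d - r)" using M.r_le t2 by simp
    have "3 * bin (N + 2) (t - d) \<le> mp.dim (J \<inter> forms t) + bin (N + 2) (t - d - r) + mp.dim (M.C \<inter> forms (t + r - 2 * d))"
      using M.dim_J_bound[OF t2(1)] unfolding JF cU .
    moreover have "mp.dim (M.C \<inter> forms (t + r - 2 * d)) + (\<Sum>j<E. bin N (t - (2 * d - r) - j)) \<le> bin (N + 2) (t + r - 2 * d)"
      using C2[OF t2(2)] unfolding e .
    ultimately show ?thesis
      using hf[of t] second_difference_bin_split[OF M.r_le t2(1), of N] unfolding K_def by linarith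
  qed
  have "mult_quot J \<le> of_nat K - of_nat E"
    by (rule mult_quot_bound[OF iJ lower upper]) (use M.r_le in \<open>auto simp: E_def\<close>)
  also have "\<dots> \<le> (of_nat d ^ 2 - of_nat d :: rat)"
  proof (cases "r = d")
    case True
    then show ?thesis by (simp add: K_def E_def power2_eq_square)
  next
    case False
    \<comment> \<open>In these terms \<open>K\<close> is \<open>d\<^sup>2 - (u + 1) (v + 1)\<close>
      while \<open>d - 1\<close> is \<open>u + v + 1\<close>, so the estimate has slack
      \<open>u * v\<close>.\<close>
    define u where "u = d - r - 1"
    define v where "v = r - 1"
    have d: "d = u + v + 2" "r = v + 1" using False r0 M.r_le by (auto simp: u_def v_def)
    have dr: "d - r = u + 1" using d by simp
    have "K + d \<le> d ^ 2 + 1" unfolding K_def dr d by (simp add: power2_eq_square algebra_simps)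
    then have "(of_nat (K + d) :: rat) \<le> of_nat (d ^ 2 + 1)" by (simp only: of_nat_le_iff)
    then show ?thesis using False by (simp add: E_def)
  qed
  finally show ?thesis by auto
qed

end
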